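(* Let $H$ be a cocommutative Hopf algebra over a field $\mathbf{k}$ and let $\mathcal{L}=\oplus_{n\in\mathbb{Z}}\mathcal{L}^n$ be a graded left $H$-module. An $L_\infty$ $H$-pseudoalgebra structure $\{\beta_k\}_{k\ge1}$ on $\mathcal{L}$ is equivalent, via $\eta_k=(-1)^{\frac{k(k-1)}{2}}\,s\circ\beta_k\circ(s^{-1})^{\otimes k}$, to a collection of degree $-1$ polylinear maps $\{\eta_k\in\mathrm{Hom}^{-1}_{H^{\otimes k}}((\mathcal{L}[-1])^{\boxtimes k},H^{\otimes k}\otimes_H\mathcal{L}[-1])\}_{k\ge1}$ that are graded symmetric and satisfy, for all $N\ge1$ and homogeneous $u_1,\dots,u_N\in\mathcal{L}[-1]$, $$\sum_{k+l=N+1}\sum_{\sigma\in\mathrm{Sh}(l,k-1)}\epsilon(\sigma)\,\eta_k\big(\eta_l(u_{\sigma(1)},\dots,u_{\sigma(l)}),u_{\sigma(l+1)},\dots,u_{\sigma(N)}\big)=0.$$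
   Context: Polylinear maps. $H^{\otimes n}$ is a right $H$-module via $(h_1\otimes\cdots\otimes h_n)h=h_1h_{(1)}\otimes\cdots\otimes h_nh_{(n)}$ (Sweedler notation for the iterated coproduct). For graded left $H$-modules, $\mathrm{Hom}^p_{H^{\otimes n}}(\mathcal{W}^{\boxtimes n},H^{\otimes n}\otimes_H\mathcal{W})$ is the space of degree $p$, $H^{\otimes n}$-linear maps $\mathcal{W}^{\otimes n}\to H^{\otimes n}\otimes_H\mathcal{W}$, where $H^{\otimes n}$ acts factorwise on the source and by left multiplication on the target; $H$ sits in degree $0$. Composition. If $\psi(y_1,\dots,y_l)=\sum_i(h_i^1\otimes\cdots\otimes h_i^l)\otimes_H e_i$ and $\varphi(e_i,x_2,\dots,x_k)=\sum_j(f_{ij}^1\otimes\cdots\otimes f_{ij}^k)\otimes_H e_{ij}$, then $\varphi(\psi(y_1,\dots,y_l),x_2,\dots,x_k)=\sum_{i,j}(h_i^1f^1_{ij(1)}\otimes\cdots\otimes h_i^lf^1_{ij(l)}\otimes f_{ij}^2\otimes\cdots\otimes f_{ij}^k)\otimes_He_{ij}$. Slot convention. Each tensor factor of $H^{\otimes N}$ is attached to one argument. In any identity whose terms involve the same elements $x_1,\dots,x_N$ in different orders, the factors of $H^{\otimes N}$ in each term are permuted so that the $r$-th factor is the one attached to $x_r$ (well defined by cocommutativity). Signs. $\epsilon(\sigma)$ is the Koszul sign of the permutation $(x_1,\dots,x_N)\mapsto(x_{\sigma(1)},\dots,x_{\sigma(N)})$ of homogeneous elements, $(-1)^\sigma$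 the signature, and $\mathrm{Sh}(l,k-1)$ the set of $\sigma\in S_{l+k-1}$ with $\sigma(1)<\cdots<\sigma(l)$ and $\sigma(l+1)<\cdots<\sigma(l+k-1)$. A polylinear map $\varphi$ in $k$ arguments is graded symmetric (resp. graded skew-symmetric) if, under the slot convention, $\varphi(x_1,\dots,x_k)=\epsilon(\sigma)\varphi(x_{\sigma(1)},\dots,x_{\sigma(k)})$ (resp. $=(-1)^\sigma\epsilon(\sigma)\varphi(x_{\sigma(1)},\dots,x_{\sigma(k)})$) for all $\sigma\in S_k$. $L_\infty$ $H$-pseudoalgebra structure on $\mathcal{L}$: graded skew-symmetric maps $\beta_k\in\mathrm{Hom}^{k-2}_{H^{\otimes k}}(\mathcal{L}^{\boxtimes k},H^{\otimes k}\otimes_H\mathcal{L})$, $k\ge1$, such that for all $N\ge1$ and homogeneous $x_1,\dots,x_N\in\mathcal{L}$, $$\sum_{k+l=N+1}\sum_{\sigma\in\mathrm{Sh}(l,k-1)}(-1)^\sigma\epsilon(\sigma)(-1)^{l(k-1)}\beta_k\big(\beta_l(x_{\sigma(1)},\dots,x_{\sigma(l)}),x_{\sigma(l+1)},\dots,x_{\sigma(N)}\big)=0.$$ Shift. $(\mathcal{L}[-1])^n=\mathcal{L}^{n-1}$, and $s:\mathcal{L}\to\mathcal{L}[-1]$ is the degree $+1$ identification; $(s^{-1})^{\otimes k}$ is evaluated with Koszul signs, and $s$ on the target means $\mathrm{id}_{H^{\otimes k}}\otimes_Hs$. *)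

theory Defs
  imports Complex_Main "HOL-Library.Poly_Mapping" "HOL-Library.FuncSet"
    "HOL-Combinatorics.Permutations"
begin

section \<open>Free vector spaces and their quotients\<close>

text \<open>
  Tensor products are quotients of free vector spaces \<open>'b \<Rightarrow>\<^sub>0 'k\<close>, and their elements are cosets.
  A linear map out of a quotient is evaluated on a chosen representative (\<open>rep\<close>) of the coset.
  All the maps below that are given in this way are the standard ones on tensor products,
  which do not depend on the representative.
\<close>

definition gen :: "'b \<Rightarrow> 'b \<Rightarrow>\<^sub>0 'k::field"
  where "gen b = Poly_Mapping.single b 1"

definition fscale :: "'k::field \<Rightarrow> ('b \<Rightarrow>\<^sub>0 'k) \<Rightarrow> ('b \<Rightarrow>\<^sub>0 'k)"
  where "fscale c p = Poly_Mapping.map ((*) c) p"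

lemma lookup_fscale: "Poly_Mapping.lookup (fscale c p) b = c * Poly_Mapping.lookup p b"
  by (simp add: fscale_def Poly_Mapping.map.rep_eq when_def)

lemma vector_space_fscale: "vector_space (fscale :: 'k::field \<Rightarrow> ('b \<Rightarrow>\<^sub>0 'k) \<Rightarrow> _)"
  by unfold_locales
    (auto intro!: poly_mapping_eqI simp: lookup_fscale lookup_add algebra_simps)

definition lext :: "('k::field \<Rightarrow> 'v \<Rightarrow> 'v) \<Rightarrow> ('b \<Rightarrow> 'v) \<Rightarrow> ('b \<Rightarrow>\<^sub>0 'k) \<Rightarrow> 'v::ab_group_add"
  where "lext scale f p =
    (\<Sum>b\<in>Poly_Mapping.keys p. scale (Poly_Mapping.lookup p b) (f b))"

abbreviation fext :: "('b \<Rightarrow> ('c \<Rightarrow>\<^sub>0 'k)) \<Rightarrow> ('b \<Rightarrow>\<^sub>0 'k::field) \<Rightarrow> ('c \<Rightarrow>\<^sub>0 'k)"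
  where "fext \<equiv> lext fscale"

definition cls :: "('b \<Rightarrow>\<^sub>0 'k::field) set \<Rightarrow> ('b \<Rightarrow>\<^sub>0 'k) \<Rightarrow> ('b \<Rightarrow>\<^sub>0 'k) set"
  where "cls N p = {q. q - p \<in> N}"

definition rep :: "('b \<Rightarrow>\<^sub>0 'k::field) set \<Rightarrow> ('b \<Rightarrow>\<^sub>0 'k)"
  where "rep C = (SOME p. p \<in> C)"

definition qadd :: "('b \<Rightarrow>\<^sub>0 'k::field) set \<Rightarrow> ('b \<Rightarrow>\<^sub>0 'k) set \<Rightarrow> ('b \<Rightarrow>\<^sub>0 'k) set \<Rightarrow> ('b \<Rightarrow>\<^sub>0 'k) set"
  where "qadd N A B = cls N (rep A + rep B)"

definition qscale :: "('b \<Rightarrow>\<^sub>0 'k::field) set \<Rightarrow> 'k \<Rightarrow> ('b \<Rightarrow>\<^sub>0 'k) set \<Rightarrow> ('b \<Rightarrow>\<^sub>0 'k) set"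
  where "qscale N c A = cls N (fscale c (rep A))"


section \<open>Tensor powers over the base field\<close>

text \<open>The generator \<open>gen [x\<^sub>1, \<dots>, x\<^sub>n]\<close> stands for the pure tensor of \<open>x\<^sub>1, \<dots>, x\<^sub>n\<close>.\<close>

definition trels :: "('k::field \<Rightarrow> 'v \<Rightarrow> 'v) \<Rightarrow> nat \<Rightarrow> ('v::ab_group_add list \<Rightarrow>\<^sub>0 'k) set"
  where "trels scale n =
    {gen (xs[i := x + y]) - gen (xs[i := x]) - gen (xs[i := y]) | xs i x y. length xs = n \<and> i < n} \<union>
    {gen (xs[i := scale c x]) - fscale c (gen (xs[i := x])) | xs i c x. length xs = n \<and> i < n}"

definition tnull :: "('k::field \<Rightarrow> 'v \<Rightarrow> 'v) \<Rightarrow> nat \<Rightarrow> ('v::ab_group_add list \<Rightarrow>\<^sub>0 'k) set"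
  where "tnull scale n = module.span fscale (trels scale n)"

abbreviation tcls :: "('k::field \<Rightarrow> 'v \<Rightarrow> 'v) \<Rightarrow> nat \<Rightarrow> ('v list \<Rightarrow>\<^sub>0 'k) \<Rightarrow> ('v::ab_group_add list \<Rightarrow>\<^sub>0 'k) set"
  where "tcls scale n \<equiv> cls (tnull scale n)"

definition tpow :: "('k::field \<Rightarrow> 'v \<Rightarrow> 'v) \<Rightarrow> nat \<Rightarrow> ('v::ab_group_add list \<Rightarrow>\<^sub>0 'k) set set"
  where "tpow scale n = tcls scale n ` {p. \<forall>xs\<in>Poly_Mapping.keys p. length xs = n}"

definition tcat :: "('v list \<Rightarrow>\<^sub>0 'k::field) \<Rightarrow> ('v list \<Rightarrow>\<^sub>0 'k) \<Rightarrow> ('v list \<Rightarrow>\<^sub>0 'k)"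
  where "tcat p q = fext (\<lambda>xs. fext (\<lambda>ys. gen (xs @ ys)) q) p"

definition tmul :: "('h::times list \<Rightarrow>\<^sub>0 'k::field) \<Rightarrow> ('h list \<Rightarrow>\<^sub>0 'k) \<Rightarrow> ('h list \<Rightarrow>\<^sub>0 'k)"
  where "tmul p q = fext (\<lambda>xs. fext (\<lambda>ys. gen (map2 (*) xs ys)) q) p"


section \<open>Cocommutative Hopf algebras and graded modules\<close>

text \<open>The unital ring structure of the Hopf algebra is the one of the type \<open>'h\<close>.\<close>

record (overloaded) ('k::field, 'h) hopf =
  smult :: "'k \<Rightarrow> 'h \<Rightarrow> 'h"
  comult :: "'h \<Rightarrow> ('h list \<Rightarrow>\<^sub>0 'k) set"
  counit :: "'h \<Rightarrow> 'k"
  antipode :: "'h \<Rightarrow> 'h"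

definition cocommutative_hopf_algebra :: "('k::field, 'h::ring_1) hopf \<Rightarrow> bool"
  where "cocommutative_hopf_algebra H \<longleftrightarrow>
    vector_space (smult H) \<and>
    (\<forall>c x y. smult H c x * y = smult H c (x * y) \<and> x * smult H c y = smult H c (x * y)) \<and>
    (\<forall>x. comult H x \<in> tpow (smult H) 2) \<and>
    (\<forall>x y. comult H (x + y) = qadd (tnull (smult H) 2) (comult H x) (comult H y)) \<and>
    (\<forall>c x. comult H (smult H c x) = qscale (tnull (smult H) 2) c (comult H x)) \<and>
    (\<forall>x y. comult H (x * y) = tcls (smult H) 2 (tmul (rep (comult H x)) (rep (comult H y)))) \<and>
    comult H 1 = tcls (smult H) 2 (gen [1, 1]) \<and>
    Vector_Spaces.linear (smult H) (*) (counit H) \<and>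
    (\<forall>x y. counit H (x * y) = counit H x * counit H y) \<and> counit H 1 = 1 \<and>
    (\<forall>h. tcls (smult H) 3
            (fext (\<lambda>ab. tcat (rep (comult H (ab ! 0))) (gen [ab ! 1])) (rep (comult H h)))
       = tcls (smult H) 3
            (fext (\<lambda>ab. tcat (gen [ab ! 0]) (rep (comult H (ab ! 1)))) (rep (comult H h)))) \<and>
    (\<forall>h. lext (smult H) (\<lambda>ab. smult H (counit H (ab ! 0)) (ab ! 1)) (rep (comult H h)) = h) \<and>
    (\<forall>h. lext (smult H) (\<lambda>ab. smult H (counit H (ab ! 1)) (ab ! 0)) (rep (comult H h)) = h) \<and>
    Vector_Spaces.linear (smult H) (smult H) (antipode H) \<and>
    (\<forall>h. lext (smult H) (\<lambda>ab. antipode H (ab ! 0) * ab ! 1) (rep (comult H h))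
       = smult H (counit H h) 1) \<and>
    (\<forall>h. lext (smult H) (\<lambda>ab. ab ! 0 * antipode H (ab ! 1)) (rep (comult H h))
       = smult H (counit H h) 1) \<and>
    (\<forall>h. tcls (smult H) 2 (fext (\<lambda>ab. gen [ab ! 1, ab ! 0]) (rep (comult H h))) = comult H h)"

text \<open>
  A representative of the iterated coproduct \<open>h\<^sub>(\<^sub>1\<^sub>) \<otimes> \<dots> \<otimes> h\<^sub>(\<^sub>n\<^sub>)\<close>.
\<close>

fun itcomult :: "('k::field, 'h::ring_1) hopf \<Rightarrow> nat \<Rightarrow> 'h \<Rightarrow> ('h list \<Rightarrow>\<^sub>0 'k)"
  where
    "itcomult H 0 h = fscale (counit H h) (gen [])"
  | "itcomult H (Suc 0) h = gen [h]"
  | "itcomult H (Suc (Suc n)) h =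
       fext (\<lambda>ab. tcat (gen [ab ! 0]) (itcomult H (Suc n) (ab ! 1))) (rep (comult H h))"

record ('h, 'l) gmod =
  act :: "'h \<Rightarrow> 'l \<Rightarrow> 'l"
  grade :: "int \<Rightarrow> 'l set"

definition graded_module :: "('k::field, 'h::ring_1) hopf \<Rightarrow> ('h, 'l::ab_group_add) gmod \<Rightarrow> bool"
  where "graded_module H W \<longleftrightarrow>
    (\<forall>h x y. act W h (x + y) = act W h x + act W h y) \<and>
    (\<forall>g h x. act W (g + h) x = act W g x + act W h x) \<and>
    (\<forall>g h x. act W (g * h) x = act W g (act W h x)) \<and>
    (\<forall>x. act W 1 x = x) \<and>
    (\<forall>n. 0 \<in> grade W n \<and> (\<forall>x\<in>grade W n. \<forall>y\<in>grade W n. x + y \<in> grade W n) \<and>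
         (\<forall>h. \<forall>x\<in>grade W n. act W h x \<in> grade W n)) \<and>
    (\<forall>x. \<exists>!p :: int \<Rightarrow>\<^sub>0 'l. (\<forall>n. Poly_Mapping.lookup p n \<in> grade W n) \<and>
         x = (\<Sum>n\<in>Poly_Mapping.keys p. Poly_Mapping.lookup p n))"

definition homogeneous :: "('h, 'l) gmod \<Rightarrow> int list \<Rightarrow> 'l list \<Rightarrow> bool"
  where "homogeneous W ds xs \<longleftrightarrow> list_all2 (\<lambda>d x. x \<in> grade W d) ds xs"

definition components :: "('h, 'l::ab_group_add) gmod \<Rightarrow> 'l \<Rightarrow> (int \<Rightarrow>\<^sub>0 'l)"
  where "components W x = (THE p. (\<forall>n. Poly_Mapping.lookup p n \<in> grade W n) \<and>
         x = (\<Sum>n\<in>Poly_Mapping.keys p. Poly_Mapping.lookup p n))"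

text \<open>The vector space structure underlying a module over the algebra \<open>H\<close>.\<close>

definition lscale :: "('k::field, 'h::ring_1) hopf \<Rightarrow> ('h, 'l) gmod \<Rightarrow> 'k \<Rightarrow> 'l \<Rightarrow> 'l"
  where "lscale H W c x = act W (smult H c 1) x"


section \<open>The space \<open>H\<^sup>\<otimes>\<^sup>n \<otimes>\<^sub>H W\<close>\<close>

text \<open>
  The generator \<open>gen ([h\<^sub>1, \<dots>, h\<^sub>n], e)\<close> stands for \<open>(h\<^sub>1 \<otimes> \<dots> \<otimes> h\<^sub>n) \<otimes>\<^sub>H e\<close>.
\<close>

definition pemb :: "'l \<Rightarrow> ('h list \<Rightarrow>\<^sub>0 'k::field) \<Rightarrow> ('h list \<times> 'l \<Rightarrow>\<^sub>0 'k)"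
  where "pemb e p = fext (\<lambda>hs. gen (hs, e)) p"

text \<open>
  The last family of relations is \<open>(h\<^sub>1 \<otimes> \<dots> \<otimes> h\<^sub>n)h \<otimes>\<^sub>H e = (h\<^sub>1 \<otimes> \<dots> \<otimes> h\<^sub>n) \<otimes>\<^sub>H he\<close>
  for the right action of \<open>h\<close> through the iterated coproduct.
\<close>

definition prels :: "('k::field, 'h::ring_1) hopf \<Rightarrow> ('h, 'l::ab_group_add) gmod \<Rightarrow> nat \<Rightarrow> ('h list \<times> 'l \<Rightarrow>\<^sub>0 'k) set"
  where "prels H W n =
    {pemb e r | e r. r \<in> trels (smult H) n} \<union>
    {gen (hs, e + e') - gen (hs, e) - gen (hs, e') | hs e e'. length hs = n} \<union>
    {gen (hs, lscale H W c e) - fscale c (gen (hs, e)) | hs c e. length hs = n} \<union>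
    {pemb e (tmul (gen hs) (itcomult H n h)) - gen (hs, act W h e) | hs h e. length hs = n}"

definition pnull :: "('k::field, 'h::ring_1) hopf \<Rightarrow> ('h, 'l::ab_group_add) gmod \<Rightarrow> nat \<Rightarrow> ('h list \<times> 'l \<Rightarrow>\<^sub>0 'k) set"
  where "pnull H W n = module.span fscale (prels H W n)"

abbreviation pcls :: "('k::field, 'h::ring_1) hopf \<Rightarrow> ('h, 'l::ab_group_add) gmod \<Rightarrow> nat \<Rightarrow>
    ('h list \<times> 'l \<Rightarrow>\<^sub>0 'k) \<Rightarrow> ('h list \<times> 'l \<Rightarrow>\<^sub>0 'k) set"
  where "pcls H W n \<equiv> cls (pnull H W n)"

definition ptensor :: "('k::field, 'h::ring_1) hopf \<Rightarrow> ('h, 'l::ab_group_add) gmod \<Rightarrow> nat \<Rightarrow> ('h list \<times> 'l \<Rightarrow>\<^sub>0 'k) set set"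
  where "ptensor H W n = pcls H W n ` {p. \<forall>(hs, e)\<in>Poly_Mapping.keys p. length hs = n}"

text \<open>The component of degree \<open>d\<close>; \<open>H\<close> sits in degree \<open>0\<close>.\<close>

definition pgrade :: "('k::field, 'h::ring_1) hopf \<Rightarrow> ('h, 'l::ab_group_add) gmod \<Rightarrow> nat \<Rightarrow> int \<Rightarrow> ('h list \<times> 'l \<Rightarrow>\<^sub>0 'k) set set"
  where "pgrade H W n d =
    pcls H W n ` {p. \<forall>(hs, e)\<in>Poly_Mapping.keys p. length hs = n \<and> e \<in> grade W d}"

text \<open>Factorwise action of \<open>H\<^sup>\<otimes>\<^sup>n\<close> on \<open>W\<^sup>\<otimes>\<^sup>n\<close>, and its action on \<open>H\<^sup>\<otimes>\<^sup>n \<otimes>\<^sub>H W\<close> by left multiplication.\<close>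

definition tact :: "('k::field, 'h::ring_1) hopf \<Rightarrow> ('h, 'l::ab_group_add) gmod \<Rightarrow> nat \<Rightarrow>
    ('h list \<Rightarrow>\<^sub>0 'k) set \<Rightarrow> ('l list \<Rightarrow>\<^sub>0 'k) set \<Rightarrow> ('l list \<Rightarrow>\<^sub>0 'k) set"
  where "tact H W n a t = tcls (lscale H W) n
    (fext (\<lambda>hs. fext (\<lambda>xs. gen (map2 (act W) hs xs)) (rep t)) (rep a))"

definition pact :: "('k::field, 'h::ring_1) hopf \<Rightarrow> ('h, 'l::ab_group_add) gmod \<Rightarrow> nat \<Rightarrow>
    ('h list \<Rightarrow>\<^sub>0 'k) set \<Rightarrow> ('h list \<times> 'l \<Rightarrow>\<^sub>0 'k) set \<Rightarrow> ('h list \<times> 'l \<Rightarrow>\<^sub>0 'k) set"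
  where "pact H W n a t = pcls H W n
    (fext (\<lambda>hs. fext (\<lambda>(gs, e). gen (map2 (*) hs gs, e)) (rep t)) (rep a))"


section \<open>Polylinear maps\<close>

type_synonym ('k, 'h, 'l) polymap = "('l list \<Rightarrow>\<^sub>0 'k) set \<Rightarrow> ('h list \<times> 'l \<Rightarrow>\<^sub>0 'k) set"

definition polyhom :: "('k::field, 'h::ring_1) hopf \<Rightarrow> ('h, 'l::ab_group_add) gmod \<Rightarrow> nat \<Rightarrow> int \<Rightarrow> ('k, 'h, 'l) polymap set"
  where "polyhom H W n d =
    {f \<in> tpow (lscale H W) n \<rightarrow>\<^sub>E ptensor H W n.
      (\<forall>s\<in>tpow (lscale H W) n. \<forall>t\<in>tpow (lscale H W) n.
         f (qadd (tnull (lscale H W) n) s t) = qadd (pnull H W n) (f s) (f t)) \<and>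
      (\<forall>a\<in>tpow (smult H) n. \<forall>t\<in>tpow (lscale H W) n. f (tact H W n a t) = pact H W n a (f t)) \<and>
      (\<forall>xs ds. length xs = n \<and> homogeneous W ds xs \<longrightarrow>
         f (tcls (lscale H W) n (gen xs)) \<in> pgrade H W n (sum_list ds + d))}"

text \<open>The value \<open>f(x\<^sub>1, \<dots>, x\<^sub>n)\<close>.\<close>

definition pev :: "('k::field, 'h::ring_1) hopf \<Rightarrow> ('h, 'l::ab_group_add) gmod \<Rightarrow> ('k, 'h, 'l) polymap \<Rightarrow> 'l list \<Rightarrow> ('h list \<times> 'l \<Rightarrow>\<^sub>0 'k) set"
  where "pev H W f xs = f (tcls (lscale H W) (length xs) (gen xs))"

text \<open>
  \<open>pcomp H W l k f t xs\<close> is \<open>f(t, x\<^sub>2, \<dots>, x\<^sub>k)\<close> for \<open>t \<in> H\<^sup>\<otimes>\<^sup>l \<otimes>\<^sub>H W\<close> and a polylinear map \<open>f\<close>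
  in \<open>k\<close> arguments.
\<close>

definition pcomp :: "('k::field, 'h::ring_1) hopf \<Rightarrow> ('h, 'l::ab_group_add) gmod \<Rightarrow> nat \<Rightarrow> nat \<Rightarrow>
    ('k, 'h, 'l) polymap \<Rightarrow> ('h list \<times> 'l \<Rightarrow>\<^sub>0 'k) set \<Rightarrow> 'l list \<Rightarrow> ('h list \<times> 'l \<Rightarrow>\<^sub>0 'k) set"
  where "pcomp H W l k f t xs = pcls H W (l + k - 1)
    (fext (\<lambda>(hs, e). fext (\<lambda>(fs, e').
        pemb e' (tcat (tmul (gen hs) (itcomult H l (hd fs))) (gen (tl fs))))
      (rep (pev H W f (e # xs)))) (rep t))"


section \<open>Permutations, signs and symmetry\<close>

text \<open>
  Permutations of \<open>{..<N}\<close> act on lists by \<open>permute_list \<sigma> [x\<^sub>0, x\<^sub>1, \<dots>] = [x\<^bsub>\<sigma> 0\<^esub>, x\<^bsub>\<sigma> 1\<^esub>, \<dots>]\<close>.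
  In the value of a polylinear map at the permuted arguments, the \<open>j\<close>-th tensor factor is attached
  to \<open>x\<^bsub>\<sigma> j\<^esub>\<close>; \<open>slots\<close> moves it to position \<open>\<sigma> j\<close>.
\<close>

definition slots :: "('k::field, 'h::ring_1) hopf \<Rightarrow> ('h, 'l::ab_group_add) gmod \<Rightarrow> nat \<Rightarrow> (nat \<Rightarrow> nat) \<Rightarrow>
    ('h list \<times> 'l \<Rightarrow>\<^sub>0 'k) set \<Rightarrow> ('h list \<times> 'l \<Rightarrow>\<^sub>0 'k) set"
  where "slots H W n \<sigma> t =
    pcls H W n (fext (\<lambda>(hs, e). gen (permute_list (inv \<sigma>) hs, e)) (rep t))"

definition koszul :: "(nat \<Rightarrow> nat) \<Rightarrow> int list \<Rightarrow> 'k::field"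
  where "koszul \<sigma> ds =
    (\<Prod>(i, j)\<in>{(i, j). i < j \<and> j < length ds \<and> \<sigma> j < \<sigma> i}. (-1) powi (ds ! \<sigma> i * ds ! \<sigma> j))"

definition shuffles :: "nat \<Rightarrow> nat \<Rightarrow> (nat \<Rightarrow> nat) set"
  where "shuffles l m = {\<sigma>. \<sigma> permutes {..<l + m} \<and>
    strict_mono_on {..<l} \<sigma> \<and> strict_mono_on {l..<l + m} \<sigma>}"

definition graded_symmetric :: "('k::field, 'h::ring_1) hopf \<Rightarrow> ('h, 'l::ab_group_add) gmod \<Rightarrow> nat \<Rightarrow> ('k, 'h, 'l) polymap \<Rightarrow> bool"
  where "graded_symmetric H W n f \<longleftrightarrow>
    (\<forall>\<sigma> xs ds. \<sigma> permutes {..<n} \<and> length xs = n \<and> homogeneous W ds xs \<longrightarrow>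
       pev H W f xs = qscale (pnull H W n) (koszul \<sigma> ds)
         (slots H W n \<sigma> (pev H W f (permute_list \<sigma> xs))))"

definition graded_skew_symmetric :: "('k::field, 'h::ring_1) hopf \<Rightarrow> ('h, 'l::ab_group_add) gmod \<Rightarrow> nat \<Rightarrow> ('k, 'h, 'l) polymap \<Rightarrow> bool"
  where "graded_skew_symmetric H W n f \<longleftrightarrow>
    (\<forall>\<sigma> xs ds. \<sigma> permutes {..<n} \<and> length xs = n \<and> homogeneous W ds xs \<longrightarrow>
       pev H W f xs = qscale (pnull H W n) (of_int (sign \<sigma>) * koszul \<sigma> ds)
         (slots H W n \<sigma> (pev H W f (permute_list \<sigma> xs))))"

text \<open>
  The term \<open>\<beta>\<^sub>k(\<beta>\<^sub>l(x\<^bsub>\<sigma>(1)\<^esub>, \<dots>, x\<^bsub>\<sigma>(l)\<^esub>), x\<^bsub>\<sigma>(l+1)\<^esub>, \<dots>, x\<^bsub>\<sigma>(N)\<^esub>)\<close> with its tensor factors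
  put in the order of \<open>x\<^sub>1, \<dots>, x\<^sub>N\<close>.
\<close>

definition jacobi_term :: "('k::field, 'h::ring_1) hopf \<Rightarrow> ('h, 'l::ab_group_add) gmod \<Rightarrow>
    (nat \<Rightarrow> ('k, 'h, 'l) polymap) \<Rightarrow> nat \<Rightarrow> nat \<Rightarrow> (nat \<Rightarrow> nat) \<Rightarrow> 'l list \<Rightarrow> ('h list \<times> 'l \<Rightarrow>\<^sub>0 'k) set"
  where "jacobi_term H W \<beta> k l \<sigma> xs = slots H W (length xs) \<sigma>
    (pcomp H W l k (\<beta> k) (pev H W (\<beta> l) (take l (permute_list \<sigma> xs))) (drop l (permute_list \<sigma> xs)))"


section \<open>The two kinds of structures and the correspondence\<close>

text \<open>
  A collection of maps indexed by \<open>k \<ge> 1\<close> is an extensional function on \<open>{1..}\<close>.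
  A sum of cosets vanishes iff the sum of representatives lies in \<open>pnull\<close>.
\<close>

definition L_infinity :: "('k::field, 'h::ring_1) hopf \<Rightarrow> ('h, 'l::ab_group_add) gmod \<Rightarrow> (nat \<Rightarrow> ('k, 'h, 'l) polymap) \<Rightarrow> bool"
  where "L_infinity H L \<beta> \<longleftrightarrow>
    \<beta> \<in> (\<Pi>\<^sub>E k\<in>{1..}. polyhom H L k (int k - 2)) \<and>
    (\<forall>k\<ge>1. graded_skew_symmetric H L k (\<beta> k)) \<and>
    (\<forall>N\<ge>1. \<forall>xs ds. length xs = N \<and> homogeneous L ds xs \<longrightarrow>
      (\<Sum>(k, l)\<in>{(k, l). 1 \<le> k \<and> 1 \<le> l \<and> k + l = N + 1}. \<Sum>\<sigma>\<in>shuffles l (k - 1).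
         fscale (of_int (sign \<sigma>) * koszul \<sigma> ds * (-1) ^ (l * (k - 1)))
           (rep (jacobi_term H L \<beta> k l \<sigma> xs))) \<in> pnull H L N)"

definition symmetric_L_infinity :: "('k::field, 'h::ring_1) hopf \<Rightarrow> ('h, 'l::ab_group_add) gmod \<Rightarrow> (nat \<Rightarrow> ('k, 'h, 'l) polymap) \<Rightarrow> bool"
  where "symmetric_L_infinity H U \<eta> \<longleftrightarrow>
    \<eta> \<in> (\<Pi>\<^sub>E k\<in>{1..}. polyhom H U k (- 1)) \<and>
    (\<forall>k\<ge>1. graded_symmetric H U k (\<eta> k)) \<and>
    (\<forall>N\<ge>1. \<forall>us ds. length us = N \<and> homogeneous U ds us \<longrightarrow>
      (\<Sum>(k, l)\<in>{(k, l). 1 \<le> k \<and> 1 \<le> l \<and> k + l = N + 1}. \<Sum>\<sigma>\<in>shuffles l (k - 1).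
         fscale (koszul \<sigma> ds) (rep (jacobi_term H U \<eta> k l \<sigma> us))) \<in> pnull H U N)"

text \<open>
  The shift \<open>L[-1]\<close> has the same underlying \<open>H\<close>-module as \<open>L\<close>, so that \<open>s\<close> is the identity on elements
  and \<open>s\<close> on the target \<open>H\<^sup>\<otimes>\<^sup>k \<otimes>\<^sub>H L\<close> is the identity as well; only the degrees change.
\<close>

definition shift :: "('h, 'l) gmod \<Rightarrow> ('h, 'l) gmod"
  where "shift L = L\<lparr>grade := \<lambda>n. grade L (n - 1)\<rparr>"

text \<open>
  \<open>(s\<^sup>-\<^sup>1)\<^sup>\<otimes>\<^sup>k\<close> on the module \<open>U = L[-1]\<close>, by the Koszul rule for \<open>s\<^sup>-\<^sup>1 \<otimes> (s\<^sup>-\<^sup>1)\<^sup>\<otimes>\<^sup>(\<^sup>k\<^sup>-\<^sup>1\<^sup>)\<close>: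
  a component of degree \<open>n\<close> of the first argument is passed by \<open>k - 1\<close> maps of degree \<open>-1\<close>.
\<close>

fun desusp :: "('h, 'l::ab_group_add) gmod \<Rightarrow> 'l list \<Rightarrow> ('l list \<Rightarrow>\<^sub>0 'k::field)"
  where
    "desusp U [] = gen []"
  | "desusp U (u # us) = (\<Sum>n\<in>Poly_Mapping.keys (components U u).
       fscale ((-1) powi (n * int (length us)))
         (tcat (gen [Poly_Mapping.lookup (components U u) n]) (desusp U us)))"

definition decalage :: "('k::field, 'h::ring_1) hopf \<Rightarrow> ('h, 'l::ab_group_add) gmod \<Rightarrow>
    (nat \<Rightarrow> ('k, 'h, 'l) polymap) \<Rightarrow> (nat \<Rightarrow> ('k, 'h, 'l) polymap)"
  where "decalage H L \<beta> = (\<lambda>k\<in>{1..}. \<lambda>t\<in>tpow (lscale H (shift L)) k.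
    qscale (pnull H (shift L) k) ((-1) ^ (k * (k - 1) div 2))
      (\<beta> k (tcls (lscale H L) k (fext (desusp (shift L)) (rep t)))))"

end

theory Submission
  imports Defs
begin

text \<open>
  Since \<open>s\<close> is the identity on elements, \<open>\<eta>\<^sub>k\<close> and \<open>\<beta>\<^sub>k\<close> differ on homogeneous arguments only by a sign.
  With \<open>d\<^sub>i = |u\<^sub>i|\<close> that sign is \<open>(-1)^(k(k-1)/2 + \<Sum> d\<^sub>i (k-i))\<close>. Up to the factor \<open>(-1)^(l(k-1))\<close>, the signs of
  \<open>\<eta>\<^sub>l\<close> and \<open>\<eta>\<^sub>k\<close> in a composition multiply to the same expression for all \<open>N = k + l - 1\<close> arguments in
  permuted order, and putting the arguments back in order turns \<open>\<epsilon>(\<sigma>)\<close> for the degrees of \<open>u\<close> into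
  \<open>(-1)^\<sigma> \<epsilon>(\<sigma>)\<close> for those of \<open>x\<close>. Hence corresponding terms of the two identities differ by a common sign.
  Signs may be pulled through compositions and permutations of slots because both are well defined
  on \<open>H\<^sup>\<otimes>\<^sup>n \<otimes>\<^sub>H L\<close>; this uses multiplicativity and coassociativity of the iterated coproduct for
  compositions, and cocommutativity for permutations. Desuspension squares to the identity as a map
  of elements, so the correspondence is an involution.
\<close>

text \<open>Maps out of quotients are evaluated on \<open>rep\<close>, an arbitrary member of a
  coset, so nothing can be computed on chosen generators before the map is known to descend. Hence
  each operation has a counterpart on free spaces (\<open>slotr\<close>, \<open>tactr\<close>,
  \<open>pactr\<close>, \<open>compr\<close>, \<open>desuspr\<close>) that is shown to respect
  \<open>eqv\<close>, the congruence modulo the relations. The second obstacle is that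
  \<open>desusp\<close> is a sign only on homogeneous arguments and a sum over components otherwise.
  Its identities are therefore reduced to homogeneous pure tensors, which span. In a composition the
  inner value must likewise be written with homogeneous module elements, and the degree condition in
  \<open>polyhom\<close> provides such a representative. The prefactor (-1)^(k(k-1)/2) fits because
  binomial(l+m,2) = binomial(l,2) + binomial(m,2) + lm: with m = k-1 the cross term is exactly the
  (-1)^(l(k-1)) of the skew-symmetric identity. Signatures and Koszul signs are both written as
  products over pairs i < j, where they can be compared factor by factor.\<close>

interpretation fs: vector_space "fscale :: 'k::field \<Rightarrow> ('b \<Rightarrow>\<^sub>0 'k) \<Rightarrow> _"
  by (rule vector_space_fscale)

section \<open>Free vector spaces modulo relations\<close>

lemma keys_gen [simp]: "Poly_Mapping.keys (gen b :: 'b \<Rightarrow>\<^sub>0 'k::field) = {b}"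
  by (simp add: gen_def)

lemma lookup_gen: "Poly_Mapping.lookup (gen b) x = (if x = b then 1 else 0)"
  by (auto simp: gen_def lookup_single when_def)

lemma keys_fscale: "Poly_Mapping.keys (fscale c p) \<subseteq> Poly_Mapping.keys p"
  by (auto simp: in_keys_iff lookup_fscale)

text \<open>The support of a sum can be smaller than the union of the supports, so linearity of
  \<open>fext\<close> is proved over a common finite set containing all of them.\<close>

lemma fext_superset:
  assumes "finite A" "Poly_Mapping.keys p \<subseteq> A"
  shows "fext f p = (\<Sum>b\<in>A. fscale (Poly_Mapping.lookup p b) (f b))"
  unfolding lext_def using assms
  by (intro sum.mono_neutral_left) (auto simp: in_keys_iff)

lemma fext_gen [simp]: "fext f (gen b) = f b"
  by (simp add: lext_def lookup_gen)

lemma fext_zero [simp]: "fext f 0 = 0"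
  by (simp add: lext_def)

lemma fext_add: "fext f (p + q) = fext f p + fext f q"
proof -
  let ?A = "Poly_Mapping.keys p \<union> Poly_Mapping.keys q"
  have "fext f (p + q) = (\<Sum>b\<in>?A. fscale (Poly_Mapping.lookup (p + q) b) (f b))"
    by (rule fext_superset) (auto simp: Poly_Mapping.keys_add)
  then show ?thesis
    by (simp add: fext_superset[of ?A p] fext_superset[of ?A q] lookup_add fs.scale_left_distrib
        sum.distrib)
qed

lemma fext_scale: "fext f (fscale c p) = fscale c (fext f p)"
  by (subst fext_superset[OF finite_keys keys_fscale])
    (simp add: lext_def lookup_fscale fs.scale_sum_right)

lemma fext_minus: "fext f (- p) = - fext f p"
  using fext_add[of f p "-p"] by (simp add: eq_neg_iff_add_eq_0 add.commute)

lemma fext_diff: "fext f (p - q) = fext f p - fext f q"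
  using fext_add[of f p "-q"] by (simp add: fext_minus)

lemma fext_sum: "fext f (\<Sum>i\<in>I. g i) = (\<Sum>i\<in>I. fext f (g i))"
  by (induction I rule: infinite_finite_induct) (auto simp: fext_add)

lemma fext_fext: "fext f (fext g p) = fext (\<lambda>b. fext f (g b)) p"
  by (simp add: lext_def[of _ g] lext_def[of _ "\<lambda>b. fext f (g b)"] fext_sum fext_scale)

lemma fext_gen_id [simp]: "fext gen p = p"
proof (rule poly_mapping_eqI)
  fix x
  have "Poly_Mapping.lookup (fext gen p) x
      = (\<Sum>b\<in>Poly_Mapping.keys p. if b = x then Poly_Mapping.lookup p b else 0)"
    unfolding lext_def lookup_sum by (rule sum.cong) (auto simp: lookup_fscale lookup_gen)
  then show "Poly_Mapping.lookup (fext gen p) x = Poly_Mapping.lookup p x"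
    by (simp add: in_keys_iff)
qed

lemma fext_fun_add: "fext (\<lambda>b. f b + g b) p = fext f p + fext g p"
  by (simp add: lext_def fs.scale_right_distrib sum.distrib)

lemma fext_fun_scale: "fext (\<lambda>b. fscale c (f b)) p = fscale c (fext f p)"
  by (simp add: lext_def fs.scale_sum_right mult.commute)

lemma fext_cong:
  "(\<And>b. b \<in> Poly_Mapping.keys p \<Longrightarrow> f b = g b) \<Longrightarrow> fext f p = fext g p"
  by (simp add: lext_def)

lemma fext_swap: "fext (\<lambda>x. fext (F x) q) p = fext (\<lambda>y. fext (\<lambda>x. F x y) p) q"
proof -
  have "fext (\<lambda>x. fext (F x) q) p = (\<Sum>x\<in>Poly_Mapping.keys p. \<Sum>y\<in>Poly_Mapping.keys q.
      fscale (Poly_Mapping.lookup p x) (fscale (Poly_Mapping.lookup q y) (F x y)))"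
    by (simp only: lext_def fs.scale_sum_right)
  also have "\<dots> = (\<Sum>y\<in>Poly_Mapping.keys q. \<Sum>x\<in>Poly_Mapping.keys p.
      fscale (Poly_Mapping.lookup p x) (fscale (Poly_Mapping.lookup q y) (F x y)))"
    by (rule sum.swap)
  also have "\<dots> = (\<Sum>y\<in>Poly_Mapping.keys q. \<Sum>x\<in>Poly_Mapping.keys p.
      fscale (Poly_Mapping.lookup q y) (fscale (Poly_Mapping.lookup p x) (F x y)))"
    by (intro sum.cong refl fs.scale_left_commute)
  also have "\<dots> = fext (\<lambda>y. fext (\<lambda>x. F x y) p) q"
    by (simp only: lext_def fs.scale_sum_right)
  finally show ?thesis .
qed

lemma keys_fext: "Poly_Mapping.keys (fext f p) \<subseteq> (\<Union>b\<in>Poly_Mapping.keys p. Poly_Mapping.keys (f b))"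
  unfolding lext_def by (rule order.trans[OF keys_sum UN_mono]) (auto dest: subsetD[OF keys_fscale])

text \<open>Equality in a quotient, kept as a relation on the free space so that chains of
  congruences can be run without passing to cosets and back.\<close>

definition eqv :: "('b \<Rightarrow>\<^sub>0 'k::field) set \<Rightarrow> ('b \<Rightarrow>\<^sub>0 'k) \<Rightarrow> ('b \<Rightarrow>\<^sub>0 'k) \<Rightarrow> bool"
  where "eqv R p q \<longleftrightarrow> p - q \<in> fs.span R"

lemma eqv_refl [simp, intro]: "eqv R p p"
  by (simp add: eqv_def fs.span_zero)

lemma eqv_sym: "eqv R p q \<Longrightarrow> eqv R q p"
  unfolding eqv_def using fs.span_neg[of "p - q"] by simp

lemma eqv_trans [trans]: "eqv R p q \<Longrightarrow> eqv R q r \<Longrightarrow> eqv R p r"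
  unfolding eqv_def using fs.span_add[of "p - q" R "q - r"] by simp

lemma eqv_add: "eqv R p q \<Longrightarrow> eqv R p' q' \<Longrightarrow> eqv R (p + p') (q + q')"
  unfolding eqv_def using fs.span_add[of "p - q" R "p' - q'"] by (simp add: algebra_simps)

lemma eqv_scale: "eqv R p q \<Longrightarrow> eqv R (fscale c p) (fscale c q)"
  unfolding eqv_def using fs.span_scale[of "p - q" R c] by (simp add: fs.scale_right_diff_distrib)

lemma eqv_sum: "(\<And>i. i \<in> I \<Longrightarrow> eqv R (f i) (g i)) \<Longrightarrow> eqv R (sum f I) (sum g I)"
  by (induction I rule: infinite_finite_induct) (auto intro: eqv_add)

lemma eqv_mem: "eqv R p q \<Longrightarrow> p \<in> fs.span R \<longleftrightarrow> q \<in> fs.span R"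
  unfolding eqv_def using fs.span_add[of "p - q" R q] fs.span_diff[of p R "p - q"] by auto

lemma eqv_base: "p - q \<in> R \<Longrightarrow> eqv R p q"
  by (simp add: eqv_def fs.span_base)

lemma eqv_add_base: "p - q - r \<in> R \<Longrightarrow> eqv R p (q + r)"
  using eqv_base[of p "q + r" R] by (simp add: diff_diff_eq)

lemma fext_eqv:
  "(\<And>b. b \<in> Poly_Mapping.keys p \<Longrightarrow> eqv R (f b) (g b)) \<Longrightarrow> eqv R (fext f p) (fext g p)"
  unfolding lext_def by (intro eqv_sum eqv_scale)

text \<open>A linear map descends once it kills the relations: the vectors sent into the span of
  \<open>R'\<close> form a subspace containing \<open>R\<close>, hence its span.\<close>

lemma fext_resp:
  assumes "\<And>r. r \<in> R \<Longrightarrow> eqv R' (fext f r) 0" and "eqv R p q"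
  shows "eqv R' (fext f p) (fext f q)"
proof -
  have "fext f r \<in> fs.span R'" if "r \<in> fs.span R" for r
    using that
  proof (induction rule: fs.span_induct)
    case base
    then show ?case
      by (auto simp: fs.subspace_def fext_add fext_scale fs.span_zero fs.span_add fs.span_scale)
  next
    case (step r)
    then show ?case using assms(1)[of r] by (simp add: eqv_def)
  qed
  then show ?thesis using assms(2) by (simp add: eqv_def flip: fext_diff)
qed

lemma cls_eq_iff: "cls (fs.span R) p = cls (fs.span R) q \<longleftrightarrow> eqv R p q"
proof
  assume "cls (fs.span R) p = cls (fs.span R) q"
  moreover have "p \<in> cls (fs.span R) p" by (simp add: cls_def fs.span_zero)
  ultimately have "p \<in> cls (fs.span R) q" by simp
  then show "eqv R p q" by (simp add: cls_def eqv_def)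
next
  assume "eqv R p q"
  then show "cls (fs.span R) p = cls (fs.span R) q"
    unfolding cls_def eqv_def[symmetric] using eqv_trans eqv_sym by blast
qed

text \<open>The choice made by \<open>rep\<close> is controlled only up to congruence, which
  suffices for every operation that respects \<open>eqv\<close>.\<close>

lemma rep_cls: "eqv R (rep (cls (fs.span R) p)) p"
proof -
  have "p \<in> cls (fs.span R) p" by (simp add: cls_def fs.span_zero)
  then have "rep (cls (fs.span R) p) \<in> cls (fs.span R) p"
    unfolding rep_def by (rule someI)
  then show ?thesis by (simp add: cls_def eqv_def)
qed

lemma qadd_cls: "qadd (fs.span R) (cls (fs.span R) p) (cls (fs.span R) q) = cls (fs.span R) (p + q)"
  unfolding qadd_def cls_eq_iff by (intro eqv_add rep_cls)

lemma qscale_cls: "qscale (fs.span R) c (cls (fs.span R) p) = cls (fs.span R) (fscale c p)"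
  unfolding qscale_def cls_eq_iff by (intro eqv_scale rep_cls)


section \<open>Tensors\<close>

definition hom_len :: "nat \<Rightarrow> ('v list \<Rightarrow>\<^sub>0 'k::field) \<Rightarrow> bool"
  where "hom_len n p \<longleftrightarrow> (\<forall>xs\<in>Poly_Mapping.keys p. length xs = n)"

lemma hom_len_gen [simp]: "hom_len n (gen xs) \<longleftrightarrow> length xs = n"
  by (simp add: hom_len_def)

lemma hom_len_add: "hom_len n p \<Longrightarrow> hom_len n q \<Longrightarrow> hom_len n (p + q)"
  unfolding hom_len_def using Poly_Mapping.keys_add[of p q] by blast

lemma hom_len_diff: "hom_len n p \<Longrightarrow> hom_len n q \<Longrightarrow> hom_len n (p - q)"
  unfolding hom_len_def using keys_diff[of p q] by blast

lemma hom_len_scale: "hom_len n p \<Longrightarrow> hom_len n (fscale c p)"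
  unfolding hom_len_def using keys_fscale[of c p] by blast

lemma hom_len_zero [simp]: "hom_len n 0"
  by (simp add: hom_len_def)

lemma hom_len_sum: "(\<And>i. i \<in> I \<Longrightarrow> hom_len n (f i)) \<Longrightarrow> hom_len n (sum f I)"
  by (induction I rule: infinite_finite_induct) (auto intro: hom_len_add)

lemma hom_len_fext: "(\<And>b. b \<in> Poly_Mapping.keys p \<Longrightarrow> hom_len n (f b)) \<Longrightarrow> hom_len n (fext f p)"
  unfolding hom_len_def using keys_fext[of f p] by blast

lemma hom_lenD: "hom_len n p \<Longrightarrow> xs \<in> Poly_Mapping.keys p \<Longrightarrow> length xs = n"
  by (simp add: hom_len_def)

lemma hom_len_span:
  assumes "\<And>r. r \<in> R \<Longrightarrow> hom_len n r" and "p \<in> fs.span R"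
  shows "hom_len n p"
  using assms(2)
proof (induction rule: fs.span_induct)
  case base
  then show ?case by (simp add: fs.subspace_def hom_len_add hom_len_scale)
qed (rule assms(1))

lemma hom_len_tnull: "p \<in> fs.span (trels s n) \<Longrightarrow> hom_len n p"
  by (rule hom_len_span) (auto simp: trels_def intro!: hom_len_diff hom_len_scale)

text \<open>All relations in \<open>trels s n\<close> consist of words of length \<open>n\<close>,
  so length is an invariant of the coset: even an arbitrary \<open>rep\<close> contains only words
  of the right length. Operations built on \<open>map2\<close>, \<open>!\<close> and
  \<open>hd\<close> rely on this.\<close>

lemma hom_len_eqv: "eqv (trels s n) p q \<Longrightarrow> hom_len n p \<longleftrightarrow> hom_len n q"
  unfolding eqv_def using hom_len_tnull[of "p - q" s n] hom_len_add[of n "p - q" q]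
    hom_len_diff[of n p "p - q"] by fastforce

lemma tensor_add:
  "length xs = n \<Longrightarrow> i < n \<Longrightarrow>
    eqv (trels s n) (gen (xs[i := x + y])) (gen (xs[i := x]) + gen (xs[i := y]))"
  by (rule eqv_add_base) (unfold trels_def, blast)

lemma tensor_scale:
  "length xs = n \<Longrightarrow> i < n \<Longrightarrow>
    eqv (trels s n) (gen (xs[i := s c x])) (fscale c (gen (xs[i := x])))"
  by (rule eqv_base) (unfold trels_def, blast)

text \<open>Universal property of the tensor power: a function on words that is multilinear modulo
  \<open>R\<close> factors through the tensor relations.\<close>

lemma fext_tensor:
  assumes add: "\<And>xs i x y. length xs = n \<Longrightarrow> i < n \<Longrightarrow>
      eqv R (f (xs[i := x + y])) (f (xs[i := x]) + f (xs[i := y]))"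
    and scale: "\<And>xs i c x. length xs = n \<Longrightarrow> i < n \<Longrightarrow>
      eqv R (f (xs[i := s c x])) (fscale c (f (xs[i := x])))"
    and "eqv (trels s n) p q"
  shows "eqv R (fext f p) (fext f q)"
proof (rule fext_resp[OF _ assms(3)])
  fix r assume "r \<in> trels s n"
  then consider (1) xs i x y where "length xs = n" "i < n"
      "r = gen (xs[i := x + y]) - gen (xs[i := x]) - gen (xs[i := y])"
    | (2) xs i c x where "length xs = n" "i < n"
      "r = gen (xs[i := s c x]) - fscale c (gen (xs[i := x]))"
    by (auto simp: trels_def)
  then show "eqv R (fext f r) 0"
  proof cases
    case 1
    then show ?thesis
      using add[of xs i x y] by (simp add: fext_diff fext_add eqv_def diff_diff_eq)
  next
    case 2
    then show ?thesis
      using scale[of xs i c x] by (simp add: fext_diff fext_scale eqv_def)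
  qed
qed

section \<open>Concatenation and factorwise multiplication of tensors\<close>

lemma tcat_gen [simp]: "tcat (gen xs) (gen ys) = gen (xs @ ys)"
  by (simp add: tcat_def)

lemma tcat_gen_left: "tcat (gen xs) q = fext (\<lambda>ys. gen (xs @ ys)) q"
  by (simp add: tcat_def)

lemma tcat_gen_right: "tcat p (gen ys) = fext (\<lambda>xs. gen (xs @ ys)) p"
  by (simp add: tcat_def)

lemma tcat_fext_left: "tcat (fext f p) q = fext (\<lambda>b. tcat (f b) q) p"
  by (simp add: tcat_def fext_fext)

lemma tcat_fext_right: "tcat q (fext f p) = fext (\<lambda>b. tcat q (f b)) p"
  unfolding tcat_def fext_fext by (rule fext_swap)

lemma tcat_expand: "tcat p q = fext (\<lambda>xs. tcat (gen xs) q) p"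
  by (simp add: tcat_def)

lemma tcat_add_left: "tcat (p + p') q = tcat p q + tcat p' q"
  by (simp add: tcat_def fext_add)

lemma tcat_scale_left: "tcat (fscale c p) q = fscale c (tcat p q)"
  by (simp add: tcat_def fext_scale)

lemma tcat_add_right: "tcat p (q + q') = tcat p q + tcat p q'"
  by (simp add: tcat_def fext_add fext_fun_add)

lemma tcat_scale_right: "tcat p (fscale c q) = fscale c (tcat p q)"
  by (simp add: tcat_def fext_scale fext_fun_scale)

lemma tcat_zero_left [simp]: "tcat 0 q = 0"
  by (simp add: tcat_def)

lemma tcat_Nil_right [simp]: "tcat p (gen []) = p"
  by (simp add: tcat_gen_right)

lemma tcat_assoc: "tcat (tcat p q) r = tcat p (tcat q r)"
  by (simp add: tcat_def fext_fext)

lemma hom_len_tcat: "hom_len m p \<Longrightarrow> hom_len n q \<Longrightarrow> hom_len (m + n) (tcat p q)"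
  unfolding tcat_def by (intro hom_len_fext) (auto simp: hom_len_def)

lemma tcat_eqv_left:
  assumes "hom_len m q" "eqv (trels s n) p p'"
  shows "eqv (trels s (n + m)) (tcat p q) (tcat p' q)"
  unfolding tcat_expand[of p] tcat_expand[of p']
proof (rule fext_tensor[OF _ _ assms(2)])
  fix xs :: "'a list" and i x y
  assume "length xs = n" "i < n"
  then show "eqv (trels s (n + m)) (tcat (gen (xs[i := x + y])) q)
        (tcat (gen (xs[i := x])) q + tcat (gen (xs[i := y])) q)"
    unfolding tcat_gen_left fext_fun_add[symmetric]
    by (intro fext_eqv)
      (use hom_lenD[OF assms(1)] in \<open>auto simp: list_update_append1[symmetric] intro!: tensor_add\<close>)
next
  fix xs :: "'a list" and i c x
  assume "length xs = n" "i < n"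
  then show "eqv (trels s (n + m)) (tcat (gen (xs[i := s c x])) q)
        (fscale c (tcat (gen (xs[i := x])) q))"
    unfolding tcat_gen_left fext_fun_scale[symmetric]
    by (intro fext_eqv)
      (use hom_lenD[OF assms(1)] in \<open>auto simp: list_update_append1[symmetric] intro!: tensor_scale\<close>)
qed

lemma tcat_eqv_right:
  assumes "hom_len m p" "eqv (trels s n) q q'"
  shows "eqv (trels s (m + n)) (tcat p q) (tcat p q')"
proof -
  have "eqv (trels s (m + n)) (tcat (gen zs) q) (tcat (gen zs) q')" if "length zs = m" for zs
    unfolding tcat_gen_left
  proof (rule fext_tensor[OF _ _ assms(2)])
    fix xs :: "'a list" and i x y
    assume "length xs = n" "i < n"
    then show "eqv (trels s (m + n)) (gen (zs @ xs[i := x + y]))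
        (gen (zs @ xs[i := x]) + gen (zs @ xs[i := y]))"
      using tensor_add[of "zs @ xs" "m + n" "m + i" s x y] that by (simp add: list_update_append)
  next
    fix xs :: "'a list" and i c x
    assume "length xs = n" "i < n"
    then show "eqv (trels s (m + n)) (gen (zs @ xs[i := s c x]))
        (fscale c (gen (zs @ xs[i := x])))"
      using tensor_scale[of "zs @ xs" "m + n" "m + i" s c x] that by (simp add: list_update_append)
  qed
  then show ?thesis
    unfolding tcat_expand[of p]
    by (intro fext_eqv) (use hom_lenD[OF assms(1)] in auto)
qed

lemma tcat_eqv:
  assumes "eqv (trels s m) p p'" "eqv (trels s n) q q'" "hom_len m p" "hom_len n q"
  shows "eqv (trels s (m + n)) (tcat p q) (tcat p' q')"
proof (rule eqv_trans[OF tcat_eqv_left[OF assms(4,1)] tcat_eqv_right[OF _ assms(2)]])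
  show "hom_len m p'" using hom_len_eqv[OF assms(1)] assms(3) by simp
qed

lemma map2_update_left:
  "length xs = length ys \<Longrightarrow> i < length ys \<Longrightarrow> map2 f (xs[i := x]) ys = (map2 f xs ys)[i := f x (ys ! i)]"
  by (rule nth_equalityI) (auto simp: nth_list_update)

lemma map2_update_right:
  "length xs = length ys \<Longrightarrow> i < length ys \<Longrightarrow> map2 f xs (ys[i := y]) = (map2 f xs ys)[i := f (xs ! i) y]"
  by (rule nth_equalityI) (auto simp: nth_list_update)

lemma tmul_gen [simp]: "tmul (gen xs) (gen ys) = gen (map2 (*) xs ys)"
  by (simp add: tmul_def)

lemma tmul_gen_left: "tmul (gen xs) q = fext (\<lambda>ys. gen (map2 (*) xs ys)) q"
  by (simp add: tmul_def)

lemma tmul_expand: "tmul p q = fext (\<lambda>xs. tmul (gen xs) q) p"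
  by (simp add: tmul_def)

lemma tmul_fext_left: "tmul (fext f p) q = fext (\<lambda>b. tmul (f b) q) p"
  by (simp add: tmul_def fext_fext)

lemma tmul_fext_right: "tmul q (fext f p) = fext (\<lambda>b. tmul q (f b)) p"
  unfolding tmul_def fext_fext by (rule fext_swap)

lemma tmul_expand_right: "tmul p q = fext (\<lambda>ys. tmul p (gen ys)) q"
  using tmul_fext_right[of p gen q] by simp

lemma hom_len_tmul: "hom_len n p \<Longrightarrow> hom_len n q \<Longrightarrow> hom_len n (tmul p q)"
  unfolding tmul_def by (intro hom_len_fext) (auto simp: hom_len_def)

lemma map2_mult_assoc:
  fixes xs :: "'a::semigroup_mult list"
  shows "map2 (*) (map2 (*) xs ys) zs = map2 (*) xs (map2 (*) ys zs)"
  by (induction xs arbitrary: ys zs) (auto simp: zip_Cons1 mult.assoc split: list.split)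

lemma tmul_assoc:
  fixes p :: "'a::semigroup_mult list \<Rightarrow>\<^sub>0 'k::field"
  shows "tmul (tmul p q) r = tmul p (tmul q r)"
  by (simp add: tmul_def fext_fext map2_mult_assoc)

text \<open>Interchange law. The left halves share one length, since otherwise \<open>map2\<close>
  would pair letters across the boundary.\<close>

lemma tmul_tcat:
  assumes "hom_len n p" "hom_len n p'"
  shows "tmul (tcat p q) (tcat p' q') = tcat (tmul p p') (tmul q q')"
proof -
  have "tmul (tcat (gen xs) (gen ys)) (tcat (gen xs') (gen ys'))
      = tcat (tmul (gen xs) (gen xs') :: 'a list \<Rightarrow>\<^sub>0 'b) (tmul (gen ys) (gen ys'))"
    if "length xs = n" "length xs' = n" for xs xs' ys ys' :: "'a list"
    using that by simp
  note base = this
  have "tmul (tcat p q) (tcat p' q') = fext (\<lambda>xs. fext (\<lambda>ys. fext (\<lambda>xs'. fext (\<lambda>ys'.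
       tmul (tcat (gen xs) (gen ys)) (tcat (gen xs') (gen ys'))) q') p') q) p"
    by (simp add: tmul_def tcat_def fext_fext)
  also have "\<dots> = fext (\<lambda>xs. fext (\<lambda>ys. fext (\<lambda>xs'. fext (\<lambda>ys'.
       tcat (tmul (gen xs) (gen xs')) (tmul (gen ys) (gen ys'))) q') p') q) p"
    by (intro fext_cong base) (use assms in \<open>auto simp: hom_len_def\<close>)
  \<comment> \<open>The sums over \<open>ys\<close> and \<open>xs'\<close> change places, so that
    the two left words meet before the two right ones.\<close>
  also have "\<dots> = fext (\<lambda>xs. fext (\<lambda>xs'. fext (\<lambda>ys. fext (\<lambda>ys'.
       tcat (tmul (gen xs) (gen xs')) (tmul (gen ys) (gen ys'))) q') q) p') p"
    by (intro fext_cong fext_swap)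
  also have "\<dots> = tcat (tmul p p') (tmul q q')"
    by (simp add: tmul_def tcat_def fext_fext)
  finally show ?thesis .
qed


section \<open>Permutations generated by adjacent transpositions\<close>

lemma transpose_adjacent_conj:
  "a < b \<Longrightarrow> Transposition.transpose a (Suc b) =
    Transposition.transpose b (Suc b) \<circ> (Transposition.transpose a b \<circ> Transposition.transpose b (Suc b))"
  by (rule ext) (auto simp: Transposition.transpose_def)

text \<open>Adjacent transpositions generate the symmetric group. The property is asked to be closed
  under all compositions because a transposition of distant points is reached as a conjugate, by
  \<open>transpose_adjacent_conj\<close>.\<close>

lemma permutes_adjacent_induct [consumes 1, case_names id adjacent comp]:
  assumes "\<sigma> permutes {..<n}"
    and "P id"
    and adj: "\<And>i. Suc i < n \<Longrightarrow> P (Transposition.transpose i (Suc i))"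
    and comp: "\<And>\<sigma> \<tau>. \<sigma> permutes {..<n} \<Longrightarrow> \<tau> permutes {..<n} \<Longrightarrow> P \<sigma> \<Longrightarrow> P \<tau> \<Longrightarrow> P (\<sigma> \<circ> \<tau>)"
  shows "P \<sigma>"
proof -
  have less: "P (Transposition.transpose a b)" if "a < b" "b < n" for a b
    using that
  proof (induction b)
    case (Suc b)
    show ?case
    proof (cases "a = b")
      case True
      then show ?thesis using adj Suc.prems by simp
    next
      case False
      then have "a < b" "b < n" "Suc b < n" using Suc.prems by auto
      then show ?thesis
        unfolding transpose_adjacent_conj[OF \<open>a < b\<close>]
        by (intro comp permutes_compose permutes_swap_id Suc.IH adj) auto
    qed
  qed simp
  have transp: "P (Transposition.transpose a b)" if "a \<in> {..<n}" "b \<in> {..<n}" "a \<noteq> b" for a b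
    using less[of a b] less[of b a] that by (cases "a < b") (auto simp: transpose_commute)
  show ?thesis
    using assms(1) finite_lessThan[of n]
  proof (induction rule: permutes_induct)
    case (swap a b p)
    then show ?case
      by (intro comp permutes_swap_id transp)
  qed (rule \<open>P id\<close>)
qed

definition tperm :: "(nat \<Rightarrow> nat) \<Rightarrow> ('v list \<Rightarrow>\<^sub>0 'k::field) \<Rightarrow> ('v list \<Rightarrow>\<^sub>0 'k)"
  where "tperm \<sigma> p = fext (\<lambda>xs. gen (permute_list \<sigma> xs)) p"

lemma nth_permute_list: "i < length xs \<Longrightarrow> permute_list f xs ! i = xs ! f i"
  by (simp add: permute_list_def)

lemma permute_list_update:
  assumes "\<sigma> permutes {..<length xs}" "i < length xs"
  shows "permute_list \<sigma> (xs[i := x]) = (permute_list \<sigma> xs)[inv \<sigma> i := x]"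
proof (rule nth_equalityI)
  fix j assume "j < length (permute_list \<sigma> (xs[i := x]))"
  then have "\<sigma> j < length xs" "j < length xs"
    using permutes_in_image[OF assms(1), of j] by auto
  moreover have "inv \<sigma> i = j \<longleftrightarrow> \<sigma> j = i"
    using permutes_inv_eq[OF assms(1)] by auto
  moreover have "inv \<sigma> i < length xs"
    using permutes_in_image[OF permutes_inv[OF assms(1)], of i] assms(2) by simp
  ultimately show "permute_list \<sigma> (xs[i := x]) ! j = (permute_list \<sigma> xs)[inv \<sigma> i := x] ! j"
    by (auto simp: permute_list_def nth_list_update)
qed simp

lemma tperm_eqv:
  assumes "\<sigma> permutes {..<n}" "eqv (trels s n) p q"
  shows "eqv (trels s n) (tperm \<sigma> p) (tperm \<sigma> q)"
  unfolding tperm_def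
proof (rule fext_tensor[OF _ _ assms(2)])
  fix xs :: "'a list" and i x y
  assume "length xs = n" "i < n"
  then show "eqv (trels s n) (gen (permute_list \<sigma> (xs[i := x + y])))
      (gen (permute_list \<sigma> (xs[i := x])) + gen (permute_list \<sigma> (xs[i := y])))"
    using assms(1) permutes_in_image[OF permutes_inv[OF assms(1)], of i]
    by (auto simp: permute_list_update intro!: tensor_add)
next
  fix xs :: "'a list" and i c x
  assume "length xs = n" "i < n"
  then show "eqv (trels s n) (gen (permute_list \<sigma> (xs[i := s c x])))
      (fscale c (gen (permute_list \<sigma> (xs[i := x]))))"
    using assms(1) permutes_in_image[OF permutes_inv[OF assms(1)], of i]
    by (auto simp: permute_list_update intro!: tensor_scale)
qed

text \<open>Reindexing positions is a right action, so the left factor of the composition is applied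
  first.\<close>

lemma tperm_comp:
  assumes "\<tau> permutes {..<n}" "hom_len n p"
  shows "tperm (\<sigma> \<circ> \<tau>) p = tperm \<tau> (tperm \<sigma> p)"
  unfolding tperm_def fext_fext
  by (rule fext_cong) (use assms hom_lenD[OF assms(2)] in \<open>simp add: permute_list_compose\<close>)

lemma tperm_tmul:
  assumes "\<sigma> permutes {..<n}" "length hs = n" "hom_len n p"
  shows "tperm \<sigma> (tmul (gen hs) p) = tmul (gen (permute_list \<sigma> hs)) (tperm \<sigma> p)"
proof -
  have "permute_list \<sigma> (map2 (*) hs xs) = map2 (*) (permute_list \<sigma> hs) (permute_list \<sigma> xs)"
    if "length xs = n" for xs
    using assms that by (simp add: permute_list_map permute_list_zip)
  then show ?thesis
    unfolding tperm_def tmul_fext_right fext_fext tmul_gen_left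
    using hom_lenD[OF assms(3)] by (auto intro!: fext_cong)
qed


section \<open>Iterated coproducts\<close>

locale cc_hopf =
  fixes H :: "('k::field, 'h::ring_1) hopf"
  assumes hopf: "cocommutative_hopf_algebra H"
begin

abbreviation T :: "nat \<Rightarrow> ('h list \<Rightarrow>\<^sub>0 'k) set"
  where "T n \<equiv> trels (smult H) n"

abbreviation cm :: "'h \<Rightarrow> ('h list \<Rightarrow>\<^sub>0 'k)"
  where "cm h \<equiv> rep (comult H h)"

abbreviation it :: "nat \<Rightarrow> 'h \<Rightarrow> ('h list \<Rightarrow>\<^sub>0 'k)"
  where "it n h \<equiv> itcomult H n h"

lemma smult_mult: "smult H c x * y = smult H c (x * y)" "x * smult H c y = smult H c (x * y)"
proof -
  have "\<forall>c x y. smult H c x * y = smult H c (x * y) \<and> x * smult H c y = smult H c (x * y)"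
    using hopf unfolding cocommutative_hopf_algebra_def by (elim conjE)
  then show "smult H c x * y = smult H c (x * y)" "x * smult H c y = smult H c (x * y)"
    by auto
qed

lemma hom_len_cm: "hom_len 2 (cm h)"
proof -
  have "\<forall>h. comult H h \<in> tpow (smult H) 2"
    using hopf unfolding cocommutative_hopf_algebra_def by (elim conjE)
  then have "comult H h \<in> tpow (smult H) 2" ..
  then obtain p where p: "comult H h = cls (fs.span (T 2)) p" "hom_len 2 p"
    unfolding tpow_def tnull_def hom_len_def by blast
  show ?thesis
    unfolding p(1) hom_len_eqv[OF rep_cls] by (rule p(2))
qed

lemma cm_add: "eqv (T 2) (cm (x + y)) (cm x + cm y)"
proof -
  have "\<forall>x y. comult H (x + y) = qadd (tnull (smult H) 2) (comult H x) (comult H y)"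
    using hopf unfolding cocommutative_hopf_algebra_def by (elim conjE)
  then have "comult H (x + y) = cls (fs.span (T 2)) (cm x + cm y)" unfolding qadd_def tnull_def by (elim allE)
  then show ?thesis by (rule ssubst) (rule rep_cls)
qed

lemma cm_scale: "eqv (T 2) (cm (smult H c x)) (fscale c (cm x))"
proof -
  have "\<forall>c x. comult H (smult H c x) = qscale (tnull (smult H) 2) c (comult H x)"
    using hopf unfolding cocommutative_hopf_algebra_def by (elim conjE)
  then have "comult H (smult H c x) = cls (fs.span (T 2)) (fscale c (cm x))" unfolding qscale_def tnull_def by (elim allE)
  then show ?thesis by (rule ssubst) (rule rep_cls)
qed

lemma cm_mult: "eqv (T 2) (cm (x * y)) (tmul (cm x) (cm y))"
proof -
  have "\<forall>x y. comult H (x * y) = tcls (smult H) 2 (tmul (cm x) (cm y))"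
    using hopf unfolding cocommutative_hopf_algebra_def by (elim conjE)
  then have "comult H (x * y) = cls (fs.span (T 2)) (tmul (cm x) (cm y))" unfolding tnull_def by (elim allE)
  then show ?thesis by (rule ssubst) (rule rep_cls)
qed

lemma cm_coassoc: "eqv (T 3) (fext (\<lambda>ab. tcat (cm (ab ! 0)) (gen [ab ! 1])) (cm h))
    (fext (\<lambda>ab. tcat (gen [ab ! 0]) (cm (ab ! 1))) (cm h))"
proof -
  have "\<forall>h. tcls (smult H) 3 (fext (\<lambda>ab. tcat (cm (ab ! 0)) (gen [ab ! 1])) (cm h))
      = tcls (smult H) 3 (fext (\<lambda>ab. tcat (gen [ab ! 0]) (cm (ab ! 1))) (cm h))"
    using hopf unfolding cocommutative_hopf_algebra_def by (elim conjE)
  then show ?thesis unfolding tnull_def cls_eq_iff ..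
qed

lemma cm_cocomm: "eqv (T 2) (fext (\<lambda>ab. gen [ab ! 1, ab ! 0]) (cm h)) (cm h)"
proof -
  have "\<forall>h. tcls (smult H) 2 (fext (\<lambda>ab. gen [ab ! 1, ab ! 0]) (cm h)) = comult H h"
    using hopf unfolding cocommutative_hopf_algebra_def by (elim conjE)
  then have eq: "cls (fs.span (T 2)) (fext (\<lambda>ab. gen [ab ! 1, ab ! 0]) (cm h)) = comult H h"
    unfolding tnull_def by (elim allE)
  show ?thesis
    using rep_cls[of "T 2" "fext (\<lambda>ab. gen [ab ! 1, ab ! 0]) (cm h)"] unfolding eq by (rule eqv_sym)
qed

text \<open>A linear map from the Hopf algebra to its \<open>n\<close>-th tensor power, given by
  representatives. Linearity can hold only up to congruence because \<open>itcomult\<close> is built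
  from chosen representatives of the coproduct.\<close>

definition lin :: "nat \<Rightarrow> ('h \<Rightarrow> ('h list \<Rightarrow>\<^sub>0 'k)) \<Rightarrow> bool"
  where "lin n F \<longleftrightarrow> (\<forall>x. hom_len n (F x)) \<and> (\<forall>x y. eqv (T n) (F (x + y)) (F x + F y)) \<and>
    (\<forall>c x. eqv (T n) (F (smult H c x)) (fscale c (F x)))"

lemma linD:
  assumes "lin n F"
  shows "hom_len n (F x)" "eqv (T n) (F (x + y)) (F x + F y)"
    "eqv (T n) (F (smult H c x)) (fscale c (F x))"
  using assms by (auto simp: lin_def)

lemma tcat_lin_left_add:
  "lin m F \<Longrightarrow> hom_len n q \<Longrightarrow> eqv (T (m + n)) (tcat (F (x + y)) q) (tcat (F x) q + tcat (F y) q)"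
  using tcat_eqv_left[OF _ linD(2)] by (simp add: tcat_add_left)

lemma tcat_lin_left_scale:
  "lin m F \<Longrightarrow> hom_len n q \<Longrightarrow> eqv (T (m + n)) (tcat (F (smult H c x)) q) (fscale c (tcat (F x) q))"
  using tcat_eqv_left[OF _ linD(3)] by (simp add: tcat_scale_left)

lemma tcat_lin_right_add:
  "lin n F \<Longrightarrow> hom_len m q \<Longrightarrow> eqv (T (m + n)) (tcat q (F (x + y))) (tcat q (F x) + tcat q (F y))"
  using tcat_eqv_right[OF _ linD(2)] by (simp add: tcat_add_right)

lemma tcat_lin_right_scale:
  "lin n F \<Longrightarrow> hom_len m q \<Longrightarrow> eqv (T (m + n)) (tcat q (F (smult H c x))) (fscale c (tcat q (F x)))"
  using tcat_eqv_right[OF _ linD(3)] by (simp add: tcat_scale_right)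

text \<open>Descent of F \<otimes> G to the tensor square, which allows \<open>cm\<close> to be
  replaced by any congruent representative.\<close>

lemma pair_resp:
  assumes "lin m F" "lin n G" "eqv (T 2) p q"
  shows "eqv (T (m + n)) (fext (\<lambda>ab. tcat (F (ab ! 0)) (G (ab ! 1))) p)
    (fext (\<lambda>ab. tcat (F (ab ! 0)) (G (ab ! 1))) q)"
proof (rule fext_tensor[OF _ _ assms(3)])
  fix xs :: "'h list" and i :: nat and x y
  assume "length xs = 2" "i < 2"
  then show "eqv (T (m + n)) (tcat (F (xs[i := x + y] ! 0)) (G (xs[i := x + y] ! 1)))
      (tcat (F (xs[i := x] ! 0)) (G (xs[i := x] ! 1)) + tcat (F (xs[i := y] ! 0)) (G (xs[i := y] ! 1)))"
    using assms(1,2) by (auto simp: less_2_cases_iff linD intro!: tcat_lin_left_add tcat_lin_right_add)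
next
  fix xs :: "'h list" and i :: nat and c x
  assume "length xs = 2" "i < 2"
  then show "eqv (T (m + n)) (tcat (F (xs[i := smult H c x] ! 0)) (G (xs[i := smult H c x] ! 1)))
      (fscale c (tcat (F (xs[i := x] ! 0)) (G (xs[i := x] ! 1))))"
    using assms(1,2) by (auto simp: less_2_cases_iff linD intro!: tcat_lin_left_scale tcat_lin_right_scale)
qed

text \<open>The analogue for F \<otimes> G \<otimes> K; coassociativity, an identity in the tensor
  cube, is applied in this form.\<close>

lemma triple_resp:
  assumes "lin l F" "lin m G" "lin n K" "eqv (T 3) p q"
  shows "eqv (T (l + (m + n))) (fext (\<lambda>xs. tcat (F (xs ! 0)) (tcat (G (xs ! 1)) (K (xs ! 2)))) p)
    (fext (\<lambda>xs. tcat (F (xs ! 0)) (tcat (G (xs ! 1)) (K (xs ! 2)))) q)"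
proof (rule fext_tensor[OF _ _ assms(4)])
  note len = linD(1)[OF assms(1)] linD(1)[OF assms(2)] linD(1)[OF assms(3)]
  \<comment> \<open>With one of the last two factors frozen, these slots form a single linear map,
    so every slot reduces to the two-factor lemmas.\<close>
  have left: "lin (m + n) (\<lambda>x. tcat (G x) (K b))" for b
    using assms len by (auto simp: lin_def hom_len_tcat intro!: tcat_lin_left_add tcat_lin_left_scale)
  have right: "lin (m + n) (\<lambda>x. tcat (G b) (K x))" for b
    using assms len by (auto simp: lin_def hom_len_tcat intro!: tcat_lin_right_add tcat_lin_right_scale)
  have cases3: "i = 0 \<or> i = 1 \<or> i = 2" if "i < 3" for i :: nat
    using that by auto
  {
    fix xs :: "'h list" and i :: nat and x y
    assume "length xs = 3" "i < 3"
    then show "eqv (T (l + (m + n)))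
        (tcat (F (xs[i := x + y] ! 0)) (tcat (G (xs[i := x + y] ! 1)) (K (xs[i := x + y] ! 2))))
        (tcat (F (xs[i := x] ! 0)) (tcat (G (xs[i := x] ! 1)) (K (xs[i := x] ! 2))) +
         tcat (F (xs[i := y] ! 0)) (tcat (G (xs[i := y] ! 1)) (K (xs[i := y] ! 2))))"
      using cases3[of i] tcat_lin_left_add[OF assms(1) hom_len_tcat[OF len(2,3)]]
        tcat_lin_right_add[OF left len(1)] tcat_lin_right_add[OF right len(1)]
      by auto
  next
    fix xs :: "'h list" and i :: nat and c x
    assume "length xs = 3" "i < 3"
    then show "eqv (T (l + (m + n)))
        (tcat (F (xs[i := smult H c x] ! 0)) (tcat (G (xs[i := smult H c x] ! 1)) (K (xs[i := smult H c x] ! 2))))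
        (fscale c (tcat (F (xs[i := x] ! 0)) (tcat (G (xs[i := x] ! 1)) (K (xs[i := x] ! 2)))))"
      using cases3[of i] tcat_lin_left_scale[OF assms(1) hom_len_tcat[OF len(2,3)]]
        tcat_lin_right_scale[OF left len(1)] tcat_lin_right_scale[OF right len(1)]
      by auto
  }
qed

text \<open>Convolution h \<mapsto> F(h_(1)) \<otimes> G(h_(2)), with concatenation of tensors as
  product. The iterated coproduct is the \<open>n\<close>-th convolution power of the identity, so
  its laws become laws of powers.\<close>

definition conv :: "('h \<Rightarrow> ('h list \<Rightarrow>\<^sub>0 'k)) \<Rightarrow> ('h \<Rightarrow> ('h list \<Rightarrow>\<^sub>0 'k)) \<Rightarrow> 'h \<Rightarrow> ('h list \<Rightarrow>\<^sub>0 'k)"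
  where "conv F G h = fext (\<lambda>ab. tcat (F (ab ! 0)) (G (ab ! 1))) (cm h)"

lemma hom_len_conv: "(\<And>x. hom_len m (F x)) \<Longrightarrow> (\<And>x. hom_len n (G x)) \<Longrightarrow> hom_len (m + n) (conv F G h)"
  unfolding conv_def by (intro hom_len_fext hom_len_tcat)

lemma lin_conv:
  assumes "lin m F" "lin n G"
  shows "lin (m + n) (conv F G)"
  unfolding lin_def
proof (intro conjI allI)
  show "hom_len (m + n) (conv F G x)" for x
    by (intro hom_len_conv linD(1) assms)
  show "eqv (T (m + n)) (conv F G (x + y)) (conv F G x + conv F G y)" for x y
    using pair_resp[OF assms cm_add[of x y]] by (simp add: conv_def fext_add)
  show "eqv (T (m + n)) (conv F G (smult H c x)) (fscale c (conv F G x))" for c x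
    using pair_resp[OF assms cm_scale[of c x]] by (simp add: conv_def fext_scale)
qed

lemma conv_eqv:
  assumes "\<And>x. eqv (T m) (F x) (F' x)" "\<And>x. eqv (T n) (G x) (G' x)"
    and "\<And>x. hom_len m (F x)" "\<And>x. hom_len n (G x)"
  shows "eqv (T (m + n)) (conv F G h) (conv F' G' h)"
  unfolding conv_def by (intro fext_eqv tcat_eqv assms)

text \<open>Both sides evaluate F \<otimes> G \<otimes> K, one on each side of the coassociativity
  law.\<close>

lemma conv_assoc:
  assumes "lin l F" "lin m G" "lin n K"
  shows "eqv (T (l + (m + n))) (conv (conv F G) K h) (conv F (conv G K) h)"
proof -
  let ?\<Phi> = "\<lambda>xs. tcat (F (xs ! 0)) (tcat (G (xs ! 1)) (K (xs ! 2)))"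
  have "conv (conv F G) K h = fext ?\<Phi> (fext (\<lambda>ab. tcat (cm (ab ! 0)) (gen [ab ! 1])) (cm h))"
    unfolding conv_def fext_fext tcat_fext_left tcat_gen_right
    by (intro fext_cong)
      (use hom_lenD[OF hom_len_cm] in \<open>auto simp: tcat_assoc nth_append intro!: fext_cong\<close>)
  moreover have "conv F (conv G K) h = fext ?\<Phi> (fext (\<lambda>ab. tcat (gen [ab ! 0]) (cm (ab ! 1))) (cm h))"
    unfolding conv_def fext_fext tcat_fext_right tcat_gen_left
    by (intro fext_cong) (auto simp: numeral_2_eq_2)
  ultimately show ?thesis
    using triple_resp[OF assms cm_coassoc[of h]] by simp
qed

lemma lin_gen: "lin (Suc 0) (\<lambda>a. gen [a])"
  using tensor_add[of "[_]" "Suc 0" 0 "smult H"] tensor_scale[of "[_]" "Suc 0" 0 "smult H"]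
  by (auto simp: lin_def)

lemma itcomult_Suc: "n \<ge> 1 \<Longrightarrow> it (Suc n) = conv (\<lambda>a. gen [a]) (it n)"
  by (cases n) (auto simp: conv_def)

lemma lin_itcomult: "n \<ge> 1 \<Longrightarrow> lin n (it n)"
proof (induction n rule: dec_induct)
  case base
  have "it 1 = (\<lambda>a. gen [a])" by auto
  then show ?case using lin_gen by simp
next
  case (step n)
  then show ?case using lin_conv[OF lin_gen step.IH] itcomult_Suc[of n] by simp
qed

lemma hom_len_itcomult: "n \<ge> 1 \<Longrightarrow> hom_len n (it n h)"
  using lin_itcomult linD(1) by blast

text \<open>Exponent law for convolution powers of the identity, by induction from
  associativity.\<close>

lemma conv_itcomult:
  assumes "l \<ge> 1" "m \<ge> 1"
  shows "eqv (T (l + m)) (conv (it l) (it m) h) (it (l + m) h)"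
  using assms(1)
proof (induction l arbitrary: h rule: dec_induct)
  case base
  have "it 1 = (\<lambda>a. gen [a])" by auto
  then show ?case using itcomult_Suc[OF assms(2)] by simp
next
  case (step l)
  have "conv (it (Suc l)) (it m) h = conv (conv (\<lambda>a. gen [a]) (it l)) (it m) h"
    using step itcomult_Suc by simp
  also have "eqv (T (Suc 0 + (l + m))) \<dots> (conv (\<lambda>a. gen [a]) (conv (it l) (it m)) h)"
    by (rule conv_assoc[OF lin_gen lin_itcomult lin_itcomult]) (use step assms in auto)
  also have "eqv (T (Suc 0 + (l + m))) \<dots> (conv (\<lambda>a. gen [a]) (it (l + m)) h)"
    by (intro conv_eqv step.IH hom_len_conv hom_len_itcomult) (use step assms in auto)
  also have "\<dots> = it (Suc l + m) h"
    using itcomult_Suc[of "l + m"] assms by simp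
  finally show ?case by simp
qed

lemma tmul_eqv_left:
  assumes "hom_len n q" "eqv (T n) p p'"
  shows "eqv (T n) (tmul p q) (tmul p' q)"
  unfolding tmul_expand[of p] tmul_expand[of p']
proof (rule fext_tensor[OF _ _ assms(2)])
  fix xs :: "'h list" and i :: nat and x y
  assume "length xs = n" "i < n"
  then show "eqv (T n) (tmul (gen (xs[i := x + y])) q)
      (tmul (gen (xs[i := x])) q + tmul (gen (xs[i := y])) q)"
    unfolding tmul_gen_left fext_fun_add[symmetric]
    by (intro fext_eqv)
      (use hom_lenD[OF assms(1)] in
        \<open>auto simp: map2_update_left distrib_right intro!: tensor_add\<close>)
next
  fix xs :: "'h list" and i :: nat and c x
  assume "length xs = n" "i < n"
  then show "eqv (T n) (tmul (gen (xs[i := smult H c x])) q)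
      (fscale c (tmul (gen (xs[i := x])) q))"
    unfolding tmul_gen_left fext_fun_scale[symmetric]
    by (intro fext_eqv)
      (use hom_lenD[OF assms(1)] in
        \<open>auto simp: map2_update_left smult_mult intro!: tensor_scale\<close>)
qed

lemma tmul_eqv_right:
  assumes "hom_len n p" "eqv (T n) q q'"
  shows "eqv (T n) (tmul p q) (tmul p q')"
proof -
  have "eqv (T n) (tmul (gen zs) q) (tmul (gen zs) q')" if "length zs = n" for zs
    unfolding tmul_gen_left
  proof (rule fext_tensor[OF _ _ assms(2)])
    fix xs :: "'h list" and i :: nat and x y
    assume "length xs = n" "i < n"
    then show "eqv (T n) (gen (map2 (*) zs (xs[i := x + y])))
        (gen (map2 (*) zs (xs[i := x])) + gen (map2 (*) zs (xs[i := y])))"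
      using that by (auto simp: map2_update_right distrib_left intro!: tensor_add)
  next
    fix xs :: "'h list" and i :: nat and c x
    assume "length xs = n" "i < n"
    then show "eqv (T n) (gen (map2 (*) zs (xs[i := smult H c x])))
        (fscale c (gen (map2 (*) zs (xs[i := x]))))"
      using that by (auto simp: map2_update_right smult_mult intro!: tensor_scale)
  qed
  then show ?thesis
    unfolding tmul_expand[of p]
    by (intro fext_eqv) (use hom_lenD[OF assms(1)] in auto)
qed

text \<open>The coproduct is multiplicative, and so is the identity tensored with the
  \<open>n\<close>-fold coproduct, by the interchange law and the induction hypothesis.\<close>

lemma itcomult_mult: "n \<ge> 1 \<Longrightarrow> eqv (T n) (it n (x * y)) (tmul (it n x) (it n y))"
proof (induction n arbitrary: x y rule: dec_induct)
  case base
  then show ?case by simp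
next
  case (step n)
  define \<Phi> where "\<Phi> = (\<lambda>ab. tcat (gen [ab ! 0]) (it n (ab ! 1)) :: 'h list \<Rightarrow>\<^sub>0 'k)"
  have it: "it (Suc n) h = fext \<Phi> (cm h)" for h
    using itcomult_Suc[of n] step by (simp add: conv_def \<Phi>_def)
  have gens: "eqv (T (Suc n)) (\<Phi> (map2 (*) xs ys)) (tmul (\<Phi> xs) (\<Phi> ys))"
    if "length xs = 2" "length ys = 2" for xs ys
  proof -
    have "\<Phi> (map2 (*) xs ys) = tcat (gen [xs ! 0 * ys ! 0]) (it n (xs ! 1 * ys ! 1))"
      using that by (simp add: \<Phi>_def)
    also have "eqv (T (Suc 0 + n)) \<dots>
        (tcat (gen [xs ! 0 * ys ! 0]) (tmul (it n (xs ! 1)) (it n (ys ! 1))))"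
      by (rule tcat_eqv_right[OF _ step.IH]) simp
    also have "\<dots> = tmul (\<Phi> xs) (\<Phi> ys)"
      unfolding \<Phi>_def by (subst tmul_tcat[of "Suc 0"]) auto
    finally show ?thesis by simp
  qed
  have "eqv (T (Suc n)) (fext \<Phi> (cm (x * y))) (fext \<Phi> (tmul (cm x) (cm y)))"
    using pair_resp[OF lin_gen lin_itcomult cm_mult] step unfolding \<Phi>_def by simp
  also have "fext \<Phi> (tmul (cm x) (cm y)) = fext (\<lambda>xs. fext (\<lambda>ys. \<Phi> (map2 (*) xs ys)) (cm y)) (cm x)"
    by (simp add: tmul_def fext_fext)
  also have "eqv (T (Suc n)) \<dots> (fext (\<lambda>xs. fext (\<lambda>ys. tmul (\<Phi> xs) (\<Phi> ys)) (cm y)) (cm x))"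
    by (intro fext_eqv gens hom_lenD[OF hom_len_cm])
  also have "\<dots> = tmul (fext \<Phi> (cm x)) (fext \<Phi> (cm y))"
    unfolding tmul_fext_left unfolding tmul_fext_right ..
  finally show ?case by (simp add: it)
qed

text \<open>Splitting off the first factor of the \<open>k\<close>-fold coproduct and expanding it
  into \<open>l\<close> factors gives a convolution of powers. Inserting an \<open>l\<close>-ary
  value into the first slot of a \<open>k\<close>-ary map produces exactly this expression.\<close>

lemma itcomult_coassoc:
  assumes "l \<ge> 1" "k \<ge> 1"
  shows "eqv (T (l + k - 1)) (fext (\<lambda>fs. tcat (it l (hd fs)) (gen (tl fs))) (it k h)) (it (l + k - 1) h)"
proof (cases "k = 1")
  case True
  then show ?thesis by simp
next
  case False
  then obtain m where m: "k = Suc m" "m \<ge> 1" using assms by (cases k) auto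
  have "fext (\<lambda>fs. tcat (it l (hd fs)) (gen (tl fs))) (it k h) = conv (it l) (it m) h"
    unfolding m(1) itcomult_Suc[OF m(2)] conv_def fext_fext tcat_gen_left
    by (simp add: tcat_fext_right[of _ gen, simplified, symmetric] flip: tcat_fext_right)
  then show ?thesis using conv_itcomult[OF assms(1) m(2)] m(1) by simp
qed

text \<open>For i = 0 the coproduct is a convolution of a two-fold and an (n-2)-fold one, and
  cocommutativity flips the first. For larger i the first factor is peeled off and the transposition
  moves one place down in the rest, which is why \<open>n\<close> and \<open>h\<close> are
  generalised.\<close>

lemma itcomult_swap:
  "Suc i < n \<Longrightarrow> eqv (T n) (tperm (Transposition.transpose i (Suc i)) (it n h)) (it n h)"
proof (induction i arbitrary: n h)
  case 0
  have perm2: "tperm (Transposition.transpose 0 (Suc 0)) (it 2 a) = fext (\<lambda>ab. gen [ab ! 1, ab ! 0]) (cm a)" for a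
    by (auto simp: tperm_def numeral_2_eq_2 fext_fext permute_list_def intro!: fext_cong)
  have it2: "it 2 a = cm a" for a
  proof -
    have "it 2 a = fext gen (cm a)"
      unfolding numeral_2_eq_2 itcomult.simps
      by (rule fext_cong) (drule hom_lenD[OF hom_len_cm], auto simp: numeral_2_eq_2 length_Suc_conv)
    then show ?thesis by simp
  qed
  have swap2: "eqv (T 2) (tperm (Transposition.transpose 0 (Suc 0)) (it 2 a)) (it 2 a)" for a
    unfolding perm2 unfolding it2 by (rule cm_cocomm)
  show ?case
  proof (cases "n = 2")
    case True
    then show ?thesis using swap2 by simp
  next
    case False
    define m where "m = n - 2"
    then have m: "m \<ge> 1" "n = 2 + m" using 0 False by auto
    let ?\<tau> = "Transposition.transpose 0 (Suc 0)"
    have \<tau>: "?\<tau> permutes {..<n}" using 0 by (intro permutes_swap_id) auto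
    have split: "eqv (T n) (conv (it 2) (it m) h) (it n h)"
      using conv_itcomult[of 2 m h] m by simp
    have cat: "tperm ?\<tau> (tcat p q) = tcat (tperm ?\<tau> p) q" if "hom_len 2 p" for p q :: "'h list \<Rightarrow>\<^sub>0 'k"
    proof -
      have "permute_list ?\<tau> (xs @ ys) = permute_list ?\<tau> xs @ ys" if "length xs = 2" for xs ys :: "'h list"
        using that by (intro nth_equalityI) (auto simp: nth_permute_list nth_append Transposition.transpose_def)
      then show ?thesis
        unfolding tperm_def tcat_def fext_fext fext_gen
        by (intro fext_cong) (use hom_lenD[OF that] in auto)
    qed
    have "eqv (T n) (tperm ?\<tau> (it n h)) (tperm ?\<tau> (conv (it 2) (it m) h))"
      by (rule tperm_eqv[OF \<tau> eqv_sym[OF split]])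
    also have "\<dots> = conv (\<lambda>a. tperm ?\<tau> (it 2 a)) (it m) h"
      unfolding conv_def tperm_def fext_fext
      by (rule fext_cong) (simp add: cat[unfolded tperm_def] hom_len_itcomult)
    also have "eqv (T n) \<dots> (conv (it 2) (it m) h)"
      unfolding m(2)
      by (intro conv_eqv swap2 hom_len_itcomult m eqv_refl) (simp add: hom_len_eqv[OF swap2] hom_len_itcomult)
    also note split
    finally show ?thesis .
  qed
next
  case (Suc i)
  then obtain m where m: "n = Suc m" "Suc i < m" by (cases n) auto
  let ?\<tau> = "Transposition.transpose (Suc i) (Suc (Suc i))" and ?\<tau>' = "Transposition.transpose i (Suc i)"
  have cat: "tperm ?\<tau> (tcat (gen [a]) q) = tcat (gen [a]) (tperm ?\<tau>' q)" if "hom_len m q" for a and q :: "'h list \<Rightarrow>\<^sub>0 'k"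
  proof -
    have "permute_list ?\<tau> (a # ys) = a # permute_list ?\<tau>' ys" if "length ys = m" for ys
      using that m(2)
      by (intro nth_equalityI)
        (auto simp: nth_permute_list nth_Cons Transposition.transpose_def split: nat.split)
    then show ?thesis
      unfolding tperm_def tcat_gen_left fext_fext fext_gen
      by (intro fext_cong) (use hom_lenD[OF that] in auto)
  qed
  have "tperm ?\<tau> (it n h) = conv (\<lambda>a. gen [a]) (\<lambda>b. tperm ?\<tau>' (it m b)) h"
    unfolding m(1) using itcomult_Suc[of m] m(2)
    by (simp add: conv_def tperm_def fext_fext) (simp add: cat[unfolded tperm_def] hom_len_itcomult)
  also have "eqv (T (Suc 0 + m)) \<dots> (conv (\<lambda>a. gen [a]) (it m) h)"
    by (intro conv_eqv Suc.IH m eqv_refl) (use m in \<open>auto simp: hom_len_eqv[OF Suc.IH] hom_len_itcomult\<close>)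
  also have "\<dots> = it n h" using itcomult_Suc[of m] m by simp
  finally show ?case using m by simp
qed

lemma itcomult_perm:
  assumes "\<sigma> permutes {..<n}"
  shows "eqv (T n) (tperm \<sigma> (it n h)) (it n h)"
proof (cases "n = 0")
  case True
  then show ?thesis by (simp add: tperm_def fext_scale)
next
  case False
  show ?thesis
    using assms
  proof (induction rule: permutes_adjacent_induct)
    case id
    then show ?case by (simp add: tperm_def)
  next
    case (adjacent i)
    then show ?case by (rule itcomult_swap)
  next
    case (comp \<sigma> \<tau>)
    then show ?case
      using tperm_eqv[of \<tau> n "smult H"] False
      by (subst tperm_comp[of _ n]) (auto intro: eqv_trans hom_len_itcomult)
  qed
qed

end


section \<open>The spaces \<open>H\<^sup>\<otimes>\<^sup>n \<otimes>\<^sub>H W\<close>\<close>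

lemma pemb_gen [simp]: "pemb e (gen hs) = gen (hs, e)"
  by (simp add: pemb_def)

lemma pemb_fext: "pemb e (fext f p) = fext (\<lambda>b. pemb e (f b)) p"
  by (simp add: pemb_def fext_fext)

lemma pemb_scale: "pemb e (fscale c p) = fscale c (pemb e p)"
  by (simp add: pemb_def fext_scale)

lemma pemb_expand: "pemb e p = fext (\<lambda>hs. pemb e (gen hs)) p"
  by (simp add: pemb_def)

definition ph_len :: "nat \<Rightarrow> ('h list \<times> 'l \<Rightarrow>\<^sub>0 'k::field) \<Rightarrow> bool"
  where "ph_len n p \<longleftrightarrow> (\<forall>(hs, e)\<in>Poly_Mapping.keys p. length hs = n)"

lemma ph_lenD: "ph_len n p \<Longrightarrow> (hs, e) \<in> Poly_Mapping.keys p \<Longrightarrow> length hs = n"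
  by (auto simp: ph_len_def)

lemma ph_len_gen [simp]: "ph_len n (gen (hs, e)) \<longleftrightarrow> length hs = n"
  by (simp add: ph_len_def)

lemma ph_len_zero [simp]: "ph_len n 0"
  by (simp add: ph_len_def)

lemma ph_len_add: "ph_len n p \<Longrightarrow> ph_len n q \<Longrightarrow> ph_len n (p + q)"
  unfolding ph_len_def using Poly_Mapping.keys_add[of p q] by blast

lemma ph_len_diff: "ph_len n p \<Longrightarrow> ph_len n q \<Longrightarrow> ph_len n (p - q)"
  unfolding ph_len_def using keys_diff[of p q] by blast

lemma ph_len_scale: "ph_len n p \<Longrightarrow> ph_len n (fscale c p)"
  unfolding ph_len_def using keys_fscale[of c p] by blast

lemma ph_len_fext: "(\<And>b. b \<in> Poly_Mapping.keys p \<Longrightarrow> ph_len n (f b)) \<Longrightarrow> ph_len n (fext f p)"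
  unfolding ph_len_def using keys_fext[of f p] by blast

lemma ph_len_pemb: "hom_len n p \<Longrightarrow> ph_len n (pemb e p)"
  unfolding pemb_def by (rule ph_len_fext) (auto dest: hom_lenD)

locale cc_module = cc_hopf H for H :: "('k::field, 'h::ring_1) hopf" +
  fixes W :: "('h, 'l::ab_group_add) gmod"
  assumes graded: "graded_module H W"
begin

abbreviation P :: "nat \<Rightarrow> ('h list \<times> 'l \<Rightarrow>\<^sub>0 'k) set"
  where "P n \<equiv> prels H W n"

abbreviation TL :: "nat \<Rightarrow> ('l list \<Rightarrow>\<^sub>0 'k) set"
  where "TL n \<equiv> trels (lscale H W) n"

lemma act_add_right: "act W h (x + y) = act W h x + act W h y"
  and act_add_left: "act W (g + h) x = act W g x + act W h x"
  and act_mult: "act W (g * h) x = act W g (act W h x)"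
  and act_one: "act W 1 x = x"
  and grade_zero: "0 \<in> grade W n"
  and grade_add: "x \<in> grade W n \<Longrightarrow> y \<in> grade W n \<Longrightarrow> x + y \<in> grade W n"
  and grade_act: "x \<in> grade W n \<Longrightarrow> act W h x \<in> grade W n"
  using graded unfolding graded_module_def by auto

lemma act_smult: "act W (smult H c h) x = lscale H W c (act W h x)"
  using smult_mult(1)[of c 1 h] by (simp add: lscale_def flip: act_mult)

lemma act_lscale: "act W h (lscale H W c x) = lscale H W c (act W h x)"
  using smult_mult(1)[of c 1 h] smult_mult(2)[of h c 1] by (simp add: lscale_def flip: act_mult)

lemma P_tensor:
  assumes "eqv (T n) p q"
  shows "eqv (P n) (pemb e p) (pemb e q)"
  unfolding pemb_def
proof (rule fext_resp[OF _ assms])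
  fix r assume "r \<in> T n"
  then have "pemb e r \<in> P n" unfolding prels_def by blast
  then show "eqv (P n) (fext (\<lambda>hs. gen (hs, e)) r) 0"
    using eqv_base[of "pemb e r" 0] by (simp add: pemb_def)
qed

lemma P_add:
  assumes "hom_len n p"
  shows "eqv (P n) (pemb (e + e') p) (pemb e p + pemb e' p)"
  unfolding pemb_def fext_fun_add[symmetric]
proof (rule fext_eqv)
  fix hs assume "hs \<in> Poly_Mapping.keys p"
  then have "length hs = n" using assms by (rule hom_lenD[rotated])
  then show "eqv (P n) (gen (hs, e + e')) (gen (hs, e) + gen (hs, e'))"
    unfolding prels_def by (intro eqv_add_base) blast
qed

lemma P_scale:
  assumes "hom_len n p"
  shows "eqv (P n) (pemb (lscale H W c e) p) (fscale c (pemb e p))"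
  unfolding pemb_def fext_fun_scale[symmetric]
proof (rule fext_eqv)
  fix hs assume "hs \<in> Poly_Mapping.keys p"
  then have "length hs = n" using assms by (rule hom_lenD[rotated])
  then show "eqv (P n) (gen (hs, lscale H W c e)) (fscale c (gen (hs, e)))"
    unfolding prels_def by (intro eqv_base) blast
qed

lemma P_balanced:
  assumes "hom_len n p"
  shows "eqv (P n) (pemb e (tmul p (it n h))) (pemb (act W h e) p)"
  unfolding tmul_expand[of p] pemb_fext pemb_expand[of _ p]
proof (rule fext_eqv)
  fix hs assume "hs \<in> Poly_Mapping.keys p"
  then have "length hs = n" using assms by (rule hom_lenD[rotated])
  then show "eqv (P n) (pemb e (tmul (gen hs) (it n h))) (pemb (act W h e) (gen hs))"
    unfolding prels_def pemb_gen by (intro eqv_base) blast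
qed

text \<open>Multiplication by the iterated coproduct preserves word length, so all four families of
  relations are homogeneous in length and \<open>rep\<close> cannot leave it.\<close>

lemma ph_len_eqv:
  assumes "n \<ge> 1" "eqv (P n) p q"
  shows "ph_len n p \<longleftrightarrow> ph_len n q"
proof -
  have base: "ph_len n r" if "r \<in> P n" for r
    using that unfolding prels_def
  proof (elim UnE CollectE exE conjE)
    fix e r' assume "r = pemb e r'" "r' \<in> T n"
    then show ?thesis
      using ph_len_pemb hom_len_tnull fs.span_base by metis
  next
    fix hs h e assume "r = pemb e (tmul (gen hs) (it n h)) - gen (hs, act W h e)" "length hs = n"
    then show ?thesis
      using assms(1) by (auto intro!: ph_len_diff ph_len_pemb hom_len_tmul hom_len_itcomult)
  qed (auto intro!: ph_len_diff ph_len_scale)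
  have "p - q \<in> fs.span (P n)" using assms(2) by (simp add: eqv_def)
  then have "ph_len n (p - q)"
  proof (induction rule: fs.span_induct)
    case base
    then show ?case by (simp add: fs.subspace_def ph_len_add ph_len_scale)
  qed (rule base)
  then show ?thesis using ph_len_add[of n "p - q" q] ph_len_diff[of n p "p - q"] by auto
qed

text \<open>Universal property of the balanced tensor product. The first premise speaks of congruent
  tensors rather than of single multilinear relations, since each use supplies it from an earlier
  descent lemma.\<close>

lemma fext_prels:
  assumes tensor: "\<And>e p q. eqv (T n) p q \<Longrightarrow> eqv R (fext f (pemb e p)) (fext f (pemb e q))"
    and add: "\<And>hs e e'. length hs = n \<Longrightarrow> eqv R (f (hs, e + e')) (f (hs, e) + f (hs, e'))"
    and scale: "\<And>hs c e. length hs = n \<Longrightarrow> eqv R (f (hs, lscale H W c e)) (fscale c (f (hs, e)))"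
    and balanced: "\<And>hs h e. length hs = n \<Longrightarrow>
      eqv R (fext f (pemb e (tmul (gen hs) (it n h)))) (f (hs, act W h e))"
    and "eqv (P n) p q"
  shows "eqv R (fext f p) (fext f q)"
proof (rule fext_resp[OF _ assms(5)])
  fix r assume "r \<in> P n"
  then show "eqv R (fext f r) 0"
    unfolding prels_def
  proof (elim UnE CollectE exE conjE)
    fix e r' assume r: "r = pemb e r'" "r' \<in> T n"
    then have "eqv (T n) r' 0" using eqv_base[of r' 0] by simp
    from tensor[OF this, of e] show ?thesis by (simp add: r pemb_def)
  next
    fix hs e e' assume "r = gen (hs, e + e') - gen (hs, e) - gen (hs, e')" "length hs = n"
    then show ?thesis using add[of hs e e'] by (simp add: fext_diff fext_add eqv_def diff_diff_eq)
  next
    fix hs c e assume "r = gen (hs, lscale H W c e) - fscale c (gen (hs, e))" "length hs = n"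
    then show ?thesis using scale[of hs c e] by (simp add: fext_diff fext_scale eqv_def)
  next
    fix hs h e assume "r = pemb e (tmul (gen hs) (it n h)) - gen (hs, act W h e)" "length hs = n"
    then show ?thesis using balanced[of hs e h] by (simp add: fext_diff eqv_def)
  qed
qed

definition slotr :: "(nat \<Rightarrow> nat) \<Rightarrow> ('h list \<times> 'l \<Rightarrow>\<^sub>0 'k) \<Rightarrow> ('h list \<times> 'l \<Rightarrow>\<^sub>0 'k)"
  where "slotr \<sigma> q = fext (\<lambda>(hs, e). gen (permute_list (inv \<sigma>) hs, e)) q"

lemma slotr_pemb: "slotr \<sigma> (pemb e p) = pemb e (tperm (inv \<sigma>) p)"
  by (simp add: slotr_def pemb_def tperm_def fext_fext)

text \<open>The balancing relation is the one at stake: permuting (h_1 \<otimes> ... \<otimes> h_n)h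
  permutes the word and the iterated coproduct, and the permuted coproduct is congruent to the
  original one. This is the well-definedness behind the slot convention.\<close>

lemma slotr_eqv:
  assumes "\<sigma> permutes {..<n}" "eqv (P n) p q"
  shows "eqv (P n) (slotr \<sigma> p) (slotr \<sigma> q)"
proof (cases "n = 0")
  case True
  have "slotr \<sigma> r = r" for r
  proof -
    have "\<sigma> = id" using assms(1) True by simp
    then show ?thesis by (simp add: slotr_def inv_id[unfolded id_def] id_def split_def)
  qed
  then show ?thesis using assms(2) by simp
next
  case False
  note inv = permutes_inv[OF assms(1)]
  show ?thesis
    unfolding slotr_def
  proof (rule fext_prels[OF _ _ _ _ assms(2)], fold slotr_def)
    fix e and p q :: "'h list \<Rightarrow>\<^sub>0 'k"
    assume "eqv (T n) p q"
    then show "eqv (P n) (slotr \<sigma> (pemb e p)) (slotr \<sigma> (pemb e q))"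
      unfolding slotr_pemb by (intro P_tensor tperm_eqv inv)
  next
    fix hs :: "'h list" and e e'
    assume "length hs = n"
    then show "eqv (P n) (case (hs, e + e') of (hs, e) \<Rightarrow> gen (permute_list (inv \<sigma>) hs, e))
      ((case (hs, e) of (hs, e) \<Rightarrow> gen (permute_list (inv \<sigma>) hs, e)) +
       (case (hs, e') of (hs, e) \<Rightarrow> gen (permute_list (inv \<sigma>) hs, e)))"
      using P_add[of n "gen (permute_list (inv \<sigma>) hs)" e e'] by simp
  next
    fix hs :: "'h list" and c e
    assume "length hs = n"
    then show "eqv (P n) (case (hs, lscale H W c e) of (hs, e) \<Rightarrow> gen (permute_list (inv \<sigma>) hs, e))
      (fscale c (case (hs, e) of (hs, e) \<Rightarrow> gen (permute_list (inv \<sigma>) hs, e)))"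
      using P_scale[of n "gen (permute_list (inv \<sigma>) hs)" c e] by simp
  next
    fix hs :: "'h list" and h e
    assume len: "length hs = n"
    have "slotr \<sigma> (pemb e (tmul (gen hs) (it n h)))
        = pemb e (tmul (gen (permute_list (inv \<sigma>) hs)) (tperm (inv \<sigma>) (it n h)))"
      unfolding slotr_pemb using False by (simp add: tperm_tmul[OF inv len] hom_len_itcomult)
    also have "eqv (P n) \<dots> (pemb e (tmul (gen (permute_list (inv \<sigma>) hs)) (it n h)))"
      by (intro P_tensor tmul_eqv_right itcomult_perm inv) (simp add: len)
    also have "eqv (P n) \<dots> (pemb (act W h e) (gen (permute_list (inv \<sigma>) hs)))"
      by (rule P_balanced) (simp add: len)
    finally show "eqv (P n) (slotr \<sigma> (pemb e (tmul (gen hs) (it n h))))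
        (case (hs, act W h e) of (hs, e) \<Rightarrow> gen (permute_list (inv \<sigma>) hs, e))"
      by simp
  qed
qed

section \<open>Descent of the two actions of the n-th tensor power of H\<close>

definition tactr :: "('h list \<Rightarrow>\<^sub>0 'k) \<Rightarrow> ('l list \<Rightarrow>\<^sub>0 'k) \<Rightarrow> ('l list \<Rightarrow>\<^sub>0 'k)"
  where "tactr a p = fext (\<lambda>hs. fext (\<lambda>xs. gen (map2 (act W) hs xs)) p) a"

definition pactr :: "('h list \<Rightarrow>\<^sub>0 'k) \<Rightarrow> ('h list \<times> 'l \<Rightarrow>\<^sub>0 'k) \<Rightarrow> ('h list \<times> 'l \<Rightarrow>\<^sub>0 'k)"
  where "pactr a q = fext (\<lambda>hs. fext (\<lambda>(gs, e). gen (map2 (*) hs gs, e)) q) a"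

text \<open>Summing in the other order puts the second argument outermost, so that descent in it can
  be tested by \<open>fext_prels\<close>.\<close>

lemma pactr_eq: "pactr a q = fext (\<lambda>(gs, e). pemb e (tmul a (gen gs))) q"
proof -
  have "pactr a q = fext (\<lambda>b. fext (\<lambda>hs. case b of (gs, e) \<Rightarrow> gen (map2 (*) hs gs, e)) a) q"
    unfolding pactr_def by (rule fext_swap)
  then show ?thesis
    by (simp add: tmul_def pemb_fext split_def)
qed

lemma hom_len_tactr: "hom_len n a \<Longrightarrow> hom_len n p \<Longrightarrow> hom_len n (tactr a p)"
  unfolding tactr_def by (intro hom_len_fext) (auto simp: hom_len_def)

lemma tactr_expand: "tactr a p = fext (\<lambda>hs. tactr (gen hs) p) a"
  by (simp add: tactr_def)

lemma tactr_gen: "tactr (gen hs) p = fext (\<lambda>xs. gen (map2 (act W) hs xs)) p"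
  by (simp add: tactr_def)

lemma tactr_eqv_right:
  assumes "hom_len n a" "eqv (TL n) p q"
  shows "eqv (TL n) (tactr a p) (tactr a q)"
proof -
  have "eqv (TL n) (tactr (gen hs) p) (tactr (gen hs) q)" if "length hs = n" for hs
    unfolding tactr_gen
  proof (rule fext_tensor[OF _ _ assms(2)])
    fix xs :: "'l list" and i x y
    assume "length xs = n" "i < n"
    then show "eqv (TL n) (gen (map2 (act W) hs (xs[i := x + y])))
        (gen (map2 (act W) hs (xs[i := x])) + gen (map2 (act W) hs (xs[i := y])))"
      using that by (auto simp: map2_update_right act_add_right intro!: tensor_add)
  next
    fix xs :: "'l list" and i c x
    assume "length xs = n" "i < n"
    then show "eqv (TL n) (gen (map2 (act W) hs (xs[i := lscale H W c x])))
        (fscale c (gen (map2 (act W) hs (xs[i := x]))))"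
      using that by (auto simp: map2_update_right act_lscale intro!: tensor_scale)
  qed
  then show ?thesis
    unfolding tactr_expand[of a] by (intro fext_eqv) (use hom_lenD[OF assms(1)] in auto)
qed

lemma tactr_eqv_left:
  assumes "hom_len n p" "eqv (T n) a b"
  shows "eqv (TL n) (tactr a p) (tactr b p)"
  unfolding tactr_expand[of a] tactr_expand[of b]
proof (rule fext_tensor[OF _ _ assms(2)])
  fix hs :: "'h list" and i x y
  assume "length hs = n" "i < n"
  then show "eqv (TL n) (tactr (gen (hs[i := x + y])) p)
      (tactr (gen (hs[i := x])) p + tactr (gen (hs[i := y])) p)"
    unfolding tactr_gen fext_fun_add[symmetric]
    by (intro fext_eqv)
      (use hom_lenD[OF assms(1)] in \<open>auto simp: map2_update_left act_add_left intro!: tensor_add\<close>)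
next
  fix hs :: "'h list" and i c x
  assume "length hs = n" "i < n"
  then show "eqv (TL n) (tactr (gen (hs[i := smult H c x])) p)
      (fscale c (tactr (gen (hs[i := x])) p))"
    unfolding tactr_gen fext_fun_scale[symmetric]
    by (intro fext_eqv)
      (use hom_lenD[OF assms(1)] in \<open>auto simp: map2_update_left act_smult intro!: tensor_scale\<close>)
qed

lemma tactr_eqv:
  assumes "hom_len n a" "hom_len n p" "eqv (T n) a b" "eqv (TL n) p q"
  shows "eqv (TL n) (tactr a p) (tactr b q)"
  using tactr_eqv_right[OF assms(1,4)] tactr_eqv_left[OF _ assms(3)] assms(2) hom_len_eqv[OF assms(4)]
  by (blast intro: eqv_trans)

lemma pactr_eqv_left:
  assumes "ph_len n q" "eqv (T n) a b"
  shows "eqv (P n) (pactr a q) (pactr b q)"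
  unfolding pactr_eq
  by (intro fext_eqv)
    (use ph_lenD[OF assms(1)] in \<open>auto intro!: P_tensor tmul_eqv_left[OF _ assms(2)]\<close>)

text \<open>By associativity, left multiplication commutes with right multiplication by the
  coproduct, so the balancing relation survives.\<close>

lemma pactr_eqv_right:
  assumes "hom_len n a" "n \<ge> 1" "eqv (P n) p q"
  shows "eqv (P n) (pactr a p) (pactr a q)"
proof -
  have pemb: "fext (\<lambda>(gs, e). pemb e (tmul a (gen gs))) (pemb e p) = pemb e (tmul a p)" for e p
    by (simp add: tmul_expand_right[of a p] pemb_fext pemb_expand[of e p] fext_fext)
  show ?thesis
    unfolding pactr_eq
  proof (rule fext_prels[OF _ _ _ _ assms(3)])
    show "eqv (P n) (fext (\<lambda>(gs, e). pemb e (tmul a (gen gs))) (pemb e p))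
        (fext (\<lambda>(gs, e). pemb e (tmul a (gen gs))) (pemb e q))" if "eqv (T n) p q" for e p q
      unfolding pemb by (intro P_tensor tmul_eqv_right assms that)
    show "eqv (P n) (fext (\<lambda>(gs, e). pemb e (tmul a (gen gs))) (pemb e (tmul (gen hs) (it n h))))
        (case (hs, act W h e) of (gs, e) \<Rightarrow> pemb e (tmul a (gen gs)))" if "length hs = n" for hs h e
      unfolding pemb prod.case tmul_assoc[symmetric]
      by (rule P_balanced) (simp add: hom_len_tmul assms that)
  qed (use assms(1) in \<open>auto intro!: P_add P_scale hom_len_tmul\<close>)
qed

lemma pactr_eqv:
  assumes "n \<ge> 1" "hom_len n a" "ph_len n p" "eqv (T n) a b" "eqv (P n) p q"
  shows "eqv (P n) (pactr a p) (pactr b q)"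
  using pactr_eqv_right[OF assms(2,1,5)] pactr_eqv_left[OF _ assms(4)] assms(3)
    ph_len_eqv[OF assms(1,5)]
  by (blast intro: eqv_trans)


section \<open>Polylinear maps\<close>

text \<open>The part of \<open>polyhom\<close> that does not mention degrees. Composition and
  \<open>dmap\<close> are first treated at this level; degrees enter again through
  \<open>polyhom_iff\<close>.\<close>

definition lhom :: "nat \<Rightarrow> ('k, 'h, 'l) polymap \<Rightarrow> bool"
  where "lhom n f \<longleftrightarrow> f \<in> tpow (lscale H W) n \<rightarrow>\<^sub>E ptensor H W n \<and>
      (\<forall>s\<in>tpow (lscale H W) n. \<forall>t\<in>tpow (lscale H W) n.
         f (qadd (tnull (lscale H W) n) s t) = qadd (pnull H W n) (f s) (f t)) \<and>
      (\<forall>a\<in>tpow (smult H) n. \<forall>t\<in>tpow (lscale H W) n. f (tact H W n a t) = pact H W n a (f t))"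

lemma polyhom_iff:
  "f \<in> polyhom H W n d \<longleftrightarrow> lhom n f \<and> (\<forall>xs ds. length xs = n \<and> homogeneous W ds xs \<longrightarrow>
         f (tcls (lscale H W) n (gen xs)) \<in> pgrade H W n (sum_list ds + d))"
  unfolding polyhom_def lhom_def by blast

definition pv :: "nat \<Rightarrow> ('k, 'h, 'l) polymap \<Rightarrow> ('l list \<Rightarrow>\<^sub>0 'k) \<Rightarrow> ('h list \<times> 'l \<Rightarrow>\<^sub>0 'k)"
  where "pv n f p = rep (f (tcls (lscale H W) n p))"

lemma tpow_mem: "hom_len n p \<Longrightarrow> tcls s n p \<in> tpow s n"
  unfolding tpow_def hom_len_def by blast

lemma tpow_cases:
  assumes "t \<in> tpow s n" obtains p where "hom_len n p" "t = tcls s n p"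
  using assms unfolding tpow_def hom_len_def by blast

lemma ptensor_mem: "ph_len n p \<Longrightarrow> pcls H W n p \<in> ptensor H W n"
  unfolding ptensor_def ph_len_def by blast

lemma ptensor_cases:
  assumes "t \<in> ptensor H W n" obtains p where "ph_len n p" "t = pcls H W n p"
  using assms unfolding ptensor_def ph_len_def by blast

lemma pcls_eq_iff: "pcls H W n p = pcls H W n q \<longleftrightarrow> eqv (P n) p q"
  unfolding pnull_def by (rule cls_eq_iff)

lemma tcls_eq_iff: "tcls s n p = tcls s n q \<longleftrightarrow> eqv (trels s n) p q"
  unfolding tnull_def by (rule cls_eq_iff)

lemma rep_pcls: "eqv (P n) (rep (pcls H W n p)) p"
  unfolding pnull_def by (rule rep_cls)

lemma rep_tcls: "eqv (trels s n) (rep (tcls s n p)) p"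
  unfolding tnull_def by (rule rep_cls)

lemma qscale_pcls: "qscale (pnull H W n) c (pcls H W n p) = pcls H W n (fscale c p)"
  unfolding pnull_def by (rule qscale_cls)

lemma qadd_pcls: "qadd (pnull H W n) (pcls H W n p) (pcls H W n q) = pcls H W n (p + q)"
  unfolding pnull_def by (rule qadd_cls)

lemma qadd_tcls: "qadd (tnull s n) (tcls s n p) (tcls s n q) = tcls s n (p + q)"
  unfolding tnull_def by (rule qadd_cls)

lemma lhom_tcls:
  assumes "lhom n f" "n \<ge> 1" "hom_len n p"
  shows "f (tcls (lscale H W) n p) = pcls H W n (pv n f p)" "ph_len n (pv n f p)"
proof -
  have "f (tcls (lscale H W) n p) \<in> ptensor H W n"
    using assms(1) tpow_mem[OF assms(3)] unfolding lhom_def by blast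
  then obtain q where q: "ph_len n q" "f (tcls (lscale H W) n p) = pcls H W n q"
    by (rule ptensor_cases)
  have eq: "eqv (P n) (pv n f p) q"
    unfolding pv_def q(2) by (rule rep_pcls)
  then show "f (tcls (lscale H W) n p) = pcls H W n (pv n f p)"
    unfolding q(2) pcls_eq_iff by (rule eqv_sym)
  show "ph_len n (pv n f p)"
    using ph_len_eqv[OF assms(2) eq] q(1) by simp
qed

text \<open>An equality and not merely a congruence: congruent arguments give the same coset and
  hence the same chosen representative of the value.\<close>

lemma pv_cong: "eqv (TL n) p q \<Longrightarrow> pv n f p = pv n f q"
  unfolding pv_def tcls_eq_iff[symmetric] by simp

lemma pv_add:
  assumes "lhom n f" "n \<ge> 1" "hom_len n p" "hom_len n q"
  shows "eqv (P n) (pv n f (p + q)) (pv n f p + pv n f q)"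
proof -
  have "f (qadd (tnull (lscale H W) n) (tcls (lscale H W) n p) (tcls (lscale H W) n q))
      = qadd (pnull H W n) (f (tcls (lscale H W) n p)) (f (tcls (lscale H W) n q))"
    using assms(1) tpow_mem[OF assms(3)] tpow_mem[OF assms(4)] unfolding lhom_def by blast
  then show ?thesis
    using assms by (simp add: qadd_tcls lhom_tcls hom_len_add qadd_pcls pcls_eq_iff)
qed

lemma tact_tcls:
  assumes "hom_len n a" "hom_len n p"
  shows "tact H W n (tcls (smult H) n a) (tcls (lscale H W) n p) = tcls (lscale H W) n (tactr a p)"
  unfolding tact_def tactr_def[symmetric] tcls_eq_iff
  by (rule tactr_eqv) (use assms hom_len_eqv rep_tcls in blast)+

lemma pact_pcls:
  assumes "n \<ge> 1" "hom_len n a" "ph_len n p"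
  shows "pact H W n (tcls (smult H) n a) (pcls H W n p) = pcls H W n (pactr a p)"
  unfolding pact_def pactr_def[symmetric] pcls_eq_iff
  by (rule pactr_eqv) (use assms hom_len_eqv rep_tcls ph_len_eqv rep_pcls in blast)+

lemma pv_tactr:
  assumes "lhom n f" "n \<ge> 1" "hom_len n a" "hom_len n p"
  shows "eqv (P n) (pv n f (tactr a p)) (pactr a (pv n f p))"
proof -
  have "f (tact H W n (tcls (smult H) n a) (tcls (lscale H W) n p))
      = pact H W n (tcls (smult H) n a) (f (tcls (lscale H W) n p))"
    using assms(1) tpow_mem[OF assms(3)] tpow_mem[OF assms(4)] unfolding lhom_def by blast
  then show ?thesis
    using assms by (simp add: tact_tcls lhom_tcls hom_len_tactr pact_pcls pcls_eq_iff)
qed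

lemma map2_act_ones: "length xs = m \<Longrightarrow> map2 (act W) (replicate m 1) xs = xs"
  by (induction xs arbitrary: m) (auto simp: act_one)

lemma map2_mult_ones: "length xs = m \<Longrightarrow> map2 (*) (replicate m 1) xs = (xs :: 'h list)"
  by (induction xs arbitrary: m) auto

text \<open>The element h \<otimes> 1 \<otimes> ... \<otimes> 1 reaches one argument only; it serves
  both for scalars (\<open>pv_scale\<close>) and for balancing in compositions
  (\<open>compr_eqv\<close>).\<close>

lemma tactr_head:
  assumes "hom_len (Suc m) p"
  shows "tactr (gen (h # replicate m 1)) p = fext (\<lambda>xs. gen (act W h (hd xs) # tl xs)) p"
  unfolding tactr_gen
proof (rule fext_cong)
  fix xs assume "xs \<in> Poly_Mapping.keys p"
  then have "length xs = Suc m" using assms by (rule hom_lenD[rotated])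
  then show "gen (map2 (act W) (h # replicate m 1) xs) = gen (act W h (hd xs) # tl xs)"
    by (cases xs) (auto simp: map2_act_ones)
qed

lemma pactr_head:
  assumes "ph_len (Suc m) q"
  shows "pactr (gen (h # replicate m 1)) q = fext (\<lambda>(gs, e). gen (h * hd gs # tl gs, e)) q"
  unfolding pactr_eq
proof (rule fext_cong, clarify)
  fix gs e assume "(gs, e) \<in> Poly_Mapping.keys q"
  then have "length gs = Suc m" using assms by (rule ph_lenD[rotated])
  then show "pemb e (tmul (gen (h # replicate m 1)) (gen gs)) = gen (h * hd gs # tl gs, e)"
    by (cases gs) (auto simp: map2_mult_ones)
qed

text \<open>\<open>polyhom\<close> asks for additivity and linearity over the tensor power of H.
  Scalars come from the action of c1 \<otimes> 1 \<otimes> ... \<otimes> 1, which multiplies the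
  first argument by c on the source and the first tensor factor by c on the target.\<close>

lemma pv_scale:
  assumes "lhom n f" "n \<ge> 1" "hom_len n p"
  shows "eqv (P n) (pv n f (fscale c p)) (fscale c (pv n f p))"
proof -
  obtain m where n: "n = Suc m" using assms(2) by (cases n) auto
  let ?a = "gen (smult H c 1 # replicate m 1)"
  have "eqv (TL n) (tactr ?a p) (fext (\<lambda>xs. fscale c (gen xs)) p)"
    unfolding tactr_head[OF assms(3)[unfolded n]]
  proof (rule fext_eqv)
    fix xs assume "xs \<in> Poly_Mapping.keys p"
    then have "length xs = n" using assms(3) by (rule hom_lenD[rotated])
    then show "eqv (TL n) (gen (act W (smult H c 1) (hd xs) # tl xs)) (fscale c (gen xs))"
      using tensor_scale[of xs n 0 "lscale H W" c "hd xs"] n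
      by (cases xs) (auto simp: lscale_def)
  qed
  then have "pv n f (tactr ?a p) = pv n f (fscale c p)"
    by (intro pv_cong) (simp add: fext_fun_scale)
  moreover have "eqv (P n) (pactr ?a (pv n f p)) (fext (\<lambda>q. fscale c (gen q)) (pv n f p))"
    unfolding pactr_head[OF lhom_tcls(2)[OF assms, unfolded n], folded n]
  proof (rule fext_eqv, clarify)
    fix gs e assume "(gs, e) \<in> Poly_Mapping.keys (pv n f p)"
    then have len: "length gs = n" using lhom_tcls(2)[OF assms] by (rule ph_lenD[rotated])
    have "eqv (T n) (gen (smult H c 1 * hd gs # tl gs)) (fscale c (gen gs))"
      using tensor_scale[of gs n 0 "smult H" c "hd gs"] n len
      by (cases gs) (auto simp: smult_mult)
    from P_tensor[OF this, of e]
    show "eqv (P n) (gen (smult H c 1 * hd gs # tl gs, e)) (fscale c (gen (gs, e)))"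
      by (simp add: pemb_scale)
  qed
  ultimately show ?thesis
    using pv_tactr[OF assms(1,2) _ assms(3), of ?a] n
    by (auto simp: fext_fun_scale intro: eqv_trans)
qed

end


section \<open>Composition\<close>

lemma tmul_add_right: "tmul p (q + q') = tmul p q + tmul p q'"
  by (simp add: tmul_def fext_add fext_fun_add)

lemma tmul_scale_right: "tmul p (fscale c q) = fscale c (tmul p q)"
  by (simp add: tmul_def fext_scale fext_fun_scale)

context cc_module
begin

text \<open>The tensor part of the composition rule, with factors h^i f^1_(i) followed by f^2, ...,
  f^k, for one word \<open>fs\<close> of f's and an arbitrary tensor \<open>p\<close> of
  h's.\<close>

definition insertion :: "nat \<Rightarrow> ('h list \<Rightarrow>\<^sub>0 'k) \<Rightarrow> 'h list \<Rightarrow> ('h list \<Rightarrow>\<^sub>0 'k)"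
  where "insertion l p fs = tcat (tmul p (it l (hd fs))) (gen (tl fs))"

text \<open>Composition with the inner tensor \<open>p\<close> and the outer value \<open>q\<close>
  decoupled, so that descent can be proved in each separately.\<close>

definition comp1 :: "nat \<Rightarrow> ('h list \<Rightarrow>\<^sub>0 'k) \<Rightarrow> ('h list \<times> 'l \<Rightarrow>\<^sub>0 'k) \<Rightarrow> ('h list \<times> 'l \<Rightarrow>\<^sub>0 'k)"
  where "comp1 l p q = fext (\<lambda>(fs, e). pemb e (insertion l p fs)) q"

lemma comp1_pemb: "comp1 l p (pemb e r) = pemb e (fext (insertion l p) r)"
  by (simp add: comp1_def pemb_fext pemb_expand[of e r] fext_fext)

context
  fixes l k m :: nat
  assumes l: "l \<ge> 1" and k: "k = Suc m"
begin

lemma hom_len_insertion: "hom_len l p \<Longrightarrow> length fs = k \<Longrightarrow> hom_len (l + m) (insertion l p fs)"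
  unfolding insertion_def using l k
  by (intro hom_len_tcat hom_len_tmul hom_len_itcomult) auto

lemma insertion_tensor:
  assumes p: "hom_len l p" and "eqv (T k) r r'"
  shows "eqv (T (l + m)) (fext (insertion l p) r) (fext (insertion l p) r')"
proof (rule fext_tensor[OF _ _ assms(2)])
  fix xs :: "'h list" and i x y
  assume xs: "length xs = k" "i < k"
  then obtain a as where as: "xs = a # as" "length as = m" using k by (cases xs) auto
  have len: "hom_len l (tmul p (it l a))" using l p by (intro hom_len_tmul hom_len_itcomult)
  show "eqv (T (l + m)) (insertion l p (xs[i := x + y]))
      (insertion l p (xs[i := x]) + insertion l p (xs[i := y]))"
  proof (cases i)
    case 0
    have "eqv (T l) (tmul p (it l (x + y))) (tmul p (it l x) + tmul p (it l y))"
      using tmul_eqv_right[OF p linD(2)[OF lin_itcomult[OF l], of x y]] by (simp add: tmul_add_right)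
    from tcat_eqv_left[OF _ this, of m "gen as"] show ?thesis
      using 0 as by (simp add: insertion_def tcat_add_left)
  next
    case (Suc j)
    then show ?thesis
      using as xs k tcat_eqv_right[OF len tensor_add[of as m j "smult H" x y]]
      by (simp add: insertion_def tcat_add_right)
  qed
next
  fix xs :: "'h list" and i c x
  assume xs: "length xs = k" "i < k"
  then obtain a as where as: "xs = a # as" "length as = m" using k by (cases xs) auto
  have len: "hom_len l (tmul p (it l a))" using l p by (intro hom_len_tmul hom_len_itcomult)
  show "eqv (T (l + m)) (insertion l p (xs[i := smult H c x]))
      (fscale c (insertion l p (xs[i := x])))"
  proof (cases i)
    case 0
    have "eqv (T l) (tmul p (it l (smult H c x))) (fscale c (tmul p (it l x)))"
      using tmul_eqv_right[OF p linD(3)[OF lin_itcomult[OF l], of c x]] by (simp add: tmul_scale_right)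
    from tcat_eqv_left[OF _ this, of m "gen as"] show ?thesis
      using 0 as by (simp add: insertion_def tcat_scale_left)
  next
    case (Suc j)
    then show ?thesis
      using as xs k tcat_eqv_right[OF len tensor_scale[of as m j "smult H" c x]]
      by (simp add: insertion_def flip: tcat_scale_right)
  qed
qed

text \<open>Multiplicativity of the iterated coproduct separates the two factors of the head, while
  the tails multiply letter by letter.\<close>

lemma insertion_mult:
  assumes p: "hom_len l p" and fs: "length fs = k" and gs: "length gs = k"
  shows "eqv (T (l + m)) (insertion l p (map2 (*) fs gs))
    (tmul (insertion l p fs) (tcat (it l (hd gs)) (gen (tl gs))))"
proof -
  obtain a as where as: "fs = a # as" "length as = m" using fs k by (cases fs) auto
  obtain b bs where bs: "gs = b # bs" "length bs = m" using gs k by (cases gs) auto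
  have "insertion l p (map2 (*) fs gs) = tcat (tmul p (it l (a * b))) (gen (map2 (*) as bs))"
    by (simp add: insertion_def as bs)
  also have "eqv (T (l + m)) \<dots> (tcat (tmul p (tmul (it l a) (it l b))) (gen (map2 (*) as bs)))"
    by (intro tcat_eqv_left tmul_eqv_right itcomult_mult p l) (simp add: as bs)
  also have "\<dots> = tmul (tcat (tmul p (it l a)) (gen as)) (tcat (it l b) (gen bs))"
    by (subst tmul_tcat[of l]) (auto simp: tmul_assoc intro!: hom_len_tmul hom_len_itcomult p l)
  also have "\<dots> = tmul (insertion l p fs) (tcat (it l (hd gs)) (gen (tl gs)))"
    by (simp add: insertion_def as bs)
  finally show ?thesis .
qed

text \<open>\<open>insertion_mult\<close> pulls the coproduct out on the right, and coassociativity
  recognises what remains as the (l+m)-fold coproduct. Thus composition respects the balancing in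
  the value of the outer map.\<close>

lemma insertion_balanced:
  assumes p: "hom_len l p" and fs: "length fs = k"
  shows "eqv (T (l + m)) (fext (insertion l p) (tmul (gen fs) (it k h)))
    (tmul (insertion l p fs) (it (l + m) h))"
proof -
  have "fext (insertion l p) (tmul (gen fs) (it k h)) = fext (\<lambda>gs. insertion l p (map2 (*) fs gs)) (it k h)"
    by (simp add: tmul_gen_left fext_fext)
  also have "eqv (T (l + m)) \<dots>
      (fext (\<lambda>gs. tmul (insertion l p fs) (tcat (it l (hd gs)) (gen (tl gs)))) (it k h))"
    using k by (intro fext_eqv insertion_mult assms hom_lenD[OF hom_len_itcomult]) auto
  also have "\<dots> = tmul (insertion l p fs) (fext (\<lambda>gs. tcat (it l (hd gs)) (gen (tl gs))) (it k h))"
    by (simp only: tmul_fext_right)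
  also have "eqv (T (l + m)) \<dots> (tmul (insertion l p fs) (it (l + m) h))"
    using itcomult_coassoc[OF l, of k h] k
    by (intro tmul_eqv_right hom_len_insertion assms) simp
  finally show ?thesis .
qed

lemma comp1_eqv_right:
  assumes p: "hom_len l p" and "eqv (P k) q q'"
  shows "eqv (P (l + m)) (comp1 l p q) (comp1 l p q')"
  unfolding comp1_def
proof (rule fext_prels[OF _ _ _ _ assms(2)], fold comp1_def)
  show "eqv (P (l + m)) (comp1 l p (pemb e r)) (comp1 l p (pemb e r'))" if "eqv (T k) r r'" for e r r'
    unfolding comp1_pemb by (intro P_tensor insertion_tensor p that)
  show "eqv (P (l + m)) (comp1 l p (pemb e (tmul (gen fs) (it k h))))
      (case (fs, act W h e) of (fs, e) \<Rightarrow> pemb e (insertion l p fs))" if "length fs = k" for fs h e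
    using eqv_trans[OF P_tensor[OF insertion_balanced[OF p that]] P_balanced[OF hom_len_insertion[OF p that]]]
    by (simp add: comp1_pemb)
qed (auto intro!: P_add P_scale hom_len_insertion p)

lemma comp1_eqv_left:
  assumes "ph_len k q" "eqv (T l) p p'"
  shows "eqv (P (l + m)) (comp1 l p q) (comp1 l p' q)"
  unfolding comp1_def insertion_def
proof (rule fext_eqv, clarify)
  fix fs e assume "(fs, e) \<in> Poly_Mapping.keys q"
  then have "length fs = k" using assms(1) by (rule ph_lenD[rotated])
  then show "eqv (P (l + m)) (pemb e (tcat (tmul p (it l (hd fs))) (gen (tl fs))))
      (pemb e (tcat (tmul p' (it l (hd fs))) (gen (tl fs))))"
    by (intro P_tensor tcat_eqv_left tmul_eqv_left assms hom_len_itcomult l) (simp add: k)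
qed

end

definition compr :: "nat \<Rightarrow> nat \<Rightarrow> ('k, 'h, 'l) polymap \<Rightarrow> 'l list \<Rightarrow>
    ('h list \<times> 'l \<Rightarrow>\<^sub>0 'k) \<Rightarrow> ('h list \<times> 'l \<Rightarrow>\<^sub>0 'k)"
  where "compr l k f xs p = fext (\<lambda>(hs, e). comp1 l (gen hs) (pv k f (gen (e # xs)))) p"

lemma comp1_expand: "comp1 l p q = fext (\<lambda>hs. comp1 l (gen hs) q) p"
proof -
  have "comp1 l p q = fext (\<lambda>b. fext (\<lambda>hs. case b of (fs, e) \<Rightarrow> pemb e (insertion l (gen hs) fs)) p) q"
    by (simp add: comp1_def insertion_def split_def tmul_expand[of p] tcat_fext_left pemb_fext)
  also have "\<dots> = fext (\<lambda>hs. comp1 l (gen hs) q) p"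
    unfolding comp1_def by (rule fext_swap)
  finally show ?thesis .
qed

lemma comp1_add: "comp1 l p (q + q') = comp1 l p q + comp1 l p q'"
  by (simp add: comp1_def fext_add)

lemma comp1_scale: "comp1 l p (fscale c q) = fscale c (comp1 l p q)"
  by (simp add: comp1_def fext_scale)

text \<open>Linearity of \<open>f\<close> over \<open>H\<^sup>\<otimes>\<^sup>k\<close> in its first slot makes the composition balanced over \<open>H\<close>.\<close>

lemma compr_eqv:
  assumes f: "lhom k f" and l: "l \<ge> 1" and k: "k = Suc m" and xs: "length xs = m"
    and "eqv (P l) p q"
  shows "eqv (P (l + m)) (compr l k f xs p) (compr l k f xs q)"
proof -
  let ?q = "\<lambda>e. pv k f (gen (e # xs))"
  have len: "hom_len k (gen (e # xs))" for e using k xs by simp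
  have k1: "k \<ge> 1" using k by simp
  note plen = lhom_tcls(2)[OF f k1 len]
  have pemb: "compr l k f xs (pemb e p) = comp1 l p (?q e)" for e p
    by (simp add: compr_def pemb_expand[of e p] fext_fext comp1_expand[of l p])
  show ?thesis
    unfolding compr_def
  proof (rule fext_prels[OF _ _ _ _ assms(5)], fold compr_def)
    fix e and p q :: "'h list \<Rightarrow>\<^sub>0 'k"
    assume "eqv (T l) p q"
    then show "eqv (P (l + m)) (compr l k f xs (pemb e p)) (compr l k f xs (pemb e q))"
      unfolding pemb by (rule comp1_eqv_left[OF l k plen])
  next
    fix hs :: "'h list" and e e'
    assume hs: "length hs = l"
    have "pv k f (gen ((e + e') # xs)) = pv k f (gen (e # xs) + gen (e' # xs))"
      using tensor_add[of "e # xs" k 0 "lscale H W" e e'] k xs by (intro pv_cong) simp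
    then have "eqv (P k) (?q (e + e')) (?q e + ?q e')"
      using pv_add[OF f k1 len len] by simp
    then show "eqv (P (l + m)) (case (hs, e + e') of (hs, e) \<Rightarrow> comp1 l (gen hs) (?q e))
       ((case (hs, e) of (hs, e) \<Rightarrow> comp1 l (gen hs) (?q e)) +
        (case (hs, e') of (hs, e) \<Rightarrow> comp1 l (gen hs) (?q e)))"
      using comp1_eqv_right[OF l k, of "gen hs"] hs by (simp flip: comp1_add)
  next
    fix hs :: "'h list" and c e
    assume hs: "length hs = l"
    have "pv k f (gen (lscale H W c e # xs)) = pv k f (fscale c (gen (e # xs)))"
      using tensor_scale[of "e # xs" k 0 "lscale H W" c e] k xs by (intro pv_cong) simp
    then have "eqv (P k) (?q (lscale H W c e)) (fscale c (?q e))"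
      using pv_scale[OF f k1 len] by simp
    then show "eqv (P (l + m)) (case (hs, lscale H W c e) of (hs, e) \<Rightarrow> comp1 l (gen hs) (?q e))
       (fscale c (case (hs, e) of (hs, e) \<Rightarrow> comp1 l (gen hs) (?q e)))"
      using comp1_eqv_right[OF l k, of "gen hs"] hs by (simp flip: comp1_scale)
  next
    fix hs :: "'h list" and h e
    assume hs: "length hs = l"
    \<comment> \<open>Balancing in the inner value: an h acting on \<open>e\<close> is carried by h
      \<otimes> 1 \<otimes> ... \<otimes> 1 into the first factor of the outer value.\<close>
    let ?a = "gen (h # replicate m 1) :: 'h list \<Rightarrow>\<^sub>0 'k"
    have "tactr ?a (gen (e # xs)) = gen (act W h e # xs)"
      using tactr_head[of m "gen (e # xs)" h] xs by simp
    then have "eqv (P k) (?q (act W h e)) (pactr ?a (?q e))"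
      using pv_tactr[OF f k1 _ len, of ?a e] k by simp
    also have "pactr ?a (?q e) = fext (\<lambda>(gs, e). gen (h * hd gs # tl gs, e)) (?q e)"
      using pactr_head[of m "?q e" h] plen k by simp
    finally have "eqv (P (l + m)) (comp1 l (gen hs) (?q (act W h e)))
        (comp1 l (gen hs) (fext (\<lambda>(gs, e). gen (h * hd gs # tl gs, e)) (?q e)))"
      using comp1_eqv_right[OF l k, of "gen hs"] hs by simp
    also have "\<dots> = fext (\<lambda>(gs, e). pemb e (insertion l (gen hs) (h * hd gs # tl gs))) (?q e)"
      by (simp add: comp1_def fext_fext split_def)
    \<comment> \<open>Multiplicativity of the \<open>l\<close>-fold coproduct releases the coproduct
      of h, which joins \<open>hs\<close> as the balancing relation demands.\<close>
    also have "eqv (P (l + m)) \<dots> (fext (\<lambda>(gs, e). pemb e (insertion l (tmul (gen hs) (it l h)) gs)) (?q e))"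
    proof (rule fext_eqv, clarify)
      fix gs e' assume "(gs, e') \<in> Poly_Mapping.keys (?q e)"
      then have gs: "length gs = k" using plen by (rule ph_lenD[rotated])
      have "eqv (T l) (tmul (gen hs) (it l (h * hd gs))) (tmul (gen hs) (tmul (it l h) (it l (hd gs))))"
        by (intro tmul_eqv_right itcomult_mult l) (simp add: hs)
      then have "eqv (T (l + m)) (insertion l (gen hs) (h * hd gs # tl gs)) (insertion l (tmul (gen hs) (it l h)) gs)"
        unfolding insertion_def tmul_assoc list.sel using gs k by (intro tcat_eqv_left) simp
      then show "eqv (P (l + m)) (pemb e' (insertion l (gen hs) (h * hd gs # tl gs)))
          (pemb e' (insertion l (tmul (gen hs) (it l h)) gs))"
        by (rule P_tensor)
    qed
    also have "\<dots> = comp1 l (tmul (gen hs) (it l h)) (?q e)"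
      by (simp add: comp1_def)
    finally show "eqv (P (l + m)) (compr l k f xs (pemb e (tmul (gen hs) (it l h))))
        (case (hs, act W h e) of (hs, e) \<Rightarrow> comp1 l (gen hs) (?q e))"
      unfolding pemb prod.case by (rule eqv_sym)
  qed
qed

text \<open>The composition may be computed from any representative of the inner value; later a
  homogeneous one is used.\<close>

lemma pcomp_pcls:
  assumes "lhom k f" "l \<ge> 1" "k \<ge> 1" "length xs = k - 1"
  shows "pcomp H W l k f (pcls H W l p) xs = pcls H W (l + k - 1) (compr l k f xs p)"
proof -
  have len: "length (e # xs) = k" for e using assms by simp
  have "pcomp H W l k f (pcls H W l p) xs = pcls H W (l + k - 1) (compr l k f xs (rep (pcls H W l p)))"
    unfolding pcomp_def compr_def comp1_def insertion_def pev_def pv_def len ..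
  also have "\<dots> = pcls H W (l + k - 1) (compr l k f xs p)"
    unfolding pcls_eq_iff
    using compr_eqv[OF assms(1,2) _ assms(4) rep_pcls[of l p]] assms(3) by simp
  finally show ?thesis .
qed

lemma slots_pcls:
  assumes "\<sigma> permutes {..<n}"
  shows "slots H W n \<sigma> (pcls H W n p) = pcls H W n (slotr \<sigma> p)"
  unfolding slots_def slotr_def[symmetric] pcls_eq_iff by (intro slotr_eqv assms rep_pcls)

end


section \<open>Desuspension\<close>

text \<open>The Koszul sign of the k-fold tensor power of s^-1 on arguments of degrees
  \<open>ds\<close>: the i-th argument is passed by k - i maps of odd degree.\<close>

fun dsign :: "int list \<Rightarrow> 'k::field"
  where
    "dsign [] = 1"
  | "dsign (d # ds) = (-1) powi (d * int (length ds)) * dsign ds"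

lemma dsign_square: "dsign ds * dsign ds = (1 :: 'k::field)"
proof (induction ds)
  case (Cons d ds)
  let ?a = "(-1) powi (d * int (length ds)) :: 'k"
  have "dsign (d # ds) * dsign (d # ds) = (?a * ?a) * (dsign ds * dsign ds)"
    by (simp add: mult_ac)
  then show ?case using Cons by (simp add: power_int_minus_one_mult_self)
qed simp

lemma sum_lookup_superset:
  assumes "finite A" "Poly_Mapping.keys p \<subseteq> A"
  shows "(\<Sum>n\<in>Poly_Mapping.keys p. Poly_Mapping.lookup p n) = (\<Sum>n\<in>A. Poly_Mapping.lookup p n)"
  using assms by (intro sum.mono_neutral_left) (auto simp: in_keys_iff)

context cc_module
begin

section \<open>Homogeneous components\<close>

lemma act_zero: "act W h 0 = 0"
  using act_add_right[of h 0 0] by simp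

lemma act_sum: "act W h (\<Sum>i\<in>I. f i) = (\<Sum>i\<in>I. act W h (f i))"
  by (induction I rule: infinite_finite_induct) (auto simp: act_add_right act_zero)

lemma components_ex1: "\<exists>!p :: int \<Rightarrow>\<^sub>0 'l. (\<forall>n. Poly_Mapping.lookup p n \<in> grade W n) \<and>
         x = (\<Sum>n\<in>Poly_Mapping.keys p. Poly_Mapping.lookup p n)"
  using graded unfolding graded_module_def by blast

lemma components_grade: "Poly_Mapping.lookup (components W x) n \<in> grade W n"
  and components_sum: "x = (\<Sum>n\<in>Poly_Mapping.keys (components W x). Poly_Mapping.lookup (components W x) n)"
  using theI'[OF components_ex1[of x]] unfolding components_def by blast+

lemma components_eqI:
  assumes "\<And>n. Poly_Mapping.lookup p n \<in> grade W n"
    and "x = (\<Sum>n\<in>Poly_Mapping.keys p. Poly_Mapping.lookup p n)"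
  shows "components W x = p"
  unfolding components_def using assms by (intro the1_equality[OF components_ex1]) blast

lemma components_add: "components W (x + y) = components W x + components W y"
proof (rule components_eqI)
  let ?A = "Poly_Mapping.keys (components W x) \<union> Poly_Mapping.keys (components W y)"
  show "Poly_Mapping.lookup (components W x + components W y) n \<in> grade W n" for n
    by (simp add: lookup_add grade_add components_grade)
  have "(\<Sum>n\<in>Poly_Mapping.keys (components W x + components W y).
        Poly_Mapping.lookup (components W x + components W y) n)
      = (\<Sum>n\<in>?A. Poly_Mapping.lookup (components W x) n) + (\<Sum>n\<in>?A. Poly_Mapping.lookup (components W y) n)"
    by (subst sum_lookup_superset[of ?A]) (auto simp: Poly_Mapping.keys_add lookup_add sum.distrib)
  also have "\<dots> = x + y"
    using components_sum[of x] components_sum[of y]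
      sum_lookup_superset[of ?A "components W x"] sum_lookup_superset[of ?A "components W y"]
    by simp
  finally show "x + y = (\<Sum>n\<in>Poly_Mapping.keys (components W x + components W y).
        Poly_Mapping.lookup (components W x + components W y) n)" ..
qed

lemma lookup_map_act: "Poly_Mapping.lookup (Poly_Mapping.map (act W h) p) n = act W h (Poly_Mapping.lookup p n)"
  by (simp add: Poly_Mapping.map.rep_eq when_def act_zero)

lemma components_act: "components W (act W h x) = Poly_Mapping.map (act W h) (components W x)"
proof (rule components_eqI)
  let ?p = "Poly_Mapping.map (act W h) (components W x)"
  show "Poly_Mapping.lookup ?p n \<in> grade W n" for n
    by (simp add: lookup_map_act grade_act components_grade)
  have "Poly_Mapping.keys ?p \<subseteq> Poly_Mapping.keys (components W x)"
    by (auto simp: in_keys_iff lookup_map_act act_zero)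
  then have "(\<Sum>n\<in>Poly_Mapping.keys ?p. Poly_Mapping.lookup ?p n)
      = (\<Sum>n\<in>Poly_Mapping.keys (components W x). Poly_Mapping.lookup ?p n)"
    by (intro sum_lookup_superset) auto
  also have "\<dots> = act W h x"
    using components_sum[of x] by (simp add: lookup_map_act flip: act_sum)
  finally show "act W h x = (\<Sum>n\<in>Poly_Mapping.keys ?p. Poly_Mapping.lookup ?p n)" ..
qed

lemma components_homogeneous:
  assumes "x \<in> grade W d"
  shows "components W x = Poly_Mapping.single d x"
  by (rule components_eqI) (use assms grade_zero in \<open>auto simp: lookup_single when_def\<close>)

text \<open>\<open>gen [0]\<close> is a nonzero vector of the free space; it vanishes only modulo
  additivity, applied to 0 + 0. Degrees outside the support of an element therefore contribute
  nothing only up to congruence.\<close>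

lemma gen_zero_head: 
  assumes "hom_len m q"
  shows "eqv (TL (Suc m)) (tcat (gen [0]) q) 0"
proof -
  have "eqv (TL 1) (gen [0 + 0]) (gen [0] + gen [0])"
    using tensor_add[of "[0]" 1 0 "lscale H W" 0 0] by simp
  then have "eqv (TL 1) (gen [0]) 0"
    using eqv_sym[of "TL 1" "gen [0]" "gen [0] + gen [0]"] by (simp add: eqv_def)
  from tcat_eqv_left[OF assms this] show ?thesis by simp
qed

text \<open>One step of the recursion of \<open>desusp\<close> as a function of the component
  decomposition, so that additivity in the first argument becomes additivity in
  \<open>c\<close>.\<close>

definition dsum :: "(int \<Rightarrow>\<^sub>0 'l) \<Rightarrow> nat \<Rightarrow> ('l list \<Rightarrow>\<^sub>0 'k) \<Rightarrow> ('l list \<Rightarrow>\<^sub>0 'k)"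
  where "dsum c m q = (\<Sum>n\<in>Poly_Mapping.keys c.
       fscale ((-1) powi (n * int m)) (tcat (gen [Poly_Mapping.lookup c n]) q))"

lemma desusp_Cons: "desusp W (u # us) = dsum (components W u) (length us) (desusp W us)"
  by (simp add: dsum_def)

lemma dsum_superset:
  assumes "hom_len m q" "finite A" "Poly_Mapping.keys c \<subseteq> A"
  shows "eqv (TL (Suc m)) (dsum c m q) (\<Sum>n\<in>A.
       fscale ((-1) powi (n * int m)) (tcat (gen [Poly_Mapping.lookup c n]) q))"
    (is "eqv _ _ (sum ?f A)")
proof -
  let ?K = "Poly_Mapping.keys c"
  have "eqv (TL (Suc m)) (sum ?f (A - ?K)) (sum (\<lambda>n. fscale ((-1) powi (n * int m)) 0) (A - ?K))"
    by (intro eqv_sum eqv_scale) (auto simp: in_keys_iff intro: gen_zero_head[OF assms(1)])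
  then have "eqv (TL (Suc m)) (sum ?f ?K + sum ?f (A - ?K)) (sum ?f ?K + 0)"
    by (intro eqv_add eqv_refl) simp
  moreover have "sum ?f A = sum ?f ?K + sum ?f (A - ?K)"
    using sum.subset_diff[OF assms(3,2), of ?f] by (simp add: add.commute)
  ultimately show ?thesis
    unfolding dsum_def by (simp add: eqv_sym)
qed

lemma hom_len_dsum: "hom_len m q \<Longrightarrow> hom_len (Suc m) (dsum c m q)"
  unfolding dsum_def using hom_len_tcat[of 1 "gen [_]" m q]
  by (intro hom_len_sum hom_len_scale) simp

lemma hom_len_desusp: "hom_len (length us) (desusp W us :: 'l list \<Rightarrow>\<^sub>0 'k)"
proof (induction us)
  case (Cons u us)
  then show ?case unfolding desusp_Cons by (auto intro: hom_len_dsum)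
qed simp

lemma dsum_add:
  assumes q: "hom_len m q"
  shows "eqv (TL (Suc m)) (dsum (c + c') m q) (dsum c m q + dsum c' m q)"
proof -
  let ?A = "Poly_Mapping.keys c \<union> Poly_Mapping.keys c'"
  let ?f = "\<lambda>c n. fscale ((-1) powi (n * int m)) (tcat (gen [Poly_Mapping.lookup c n]) q)"
  have "eqv (TL (Suc m)) (dsum (c + c') m q) (sum (?f (c + c')) ?A)"
    by (rule dsum_superset[OF q]) (auto simp: Poly_Mapping.keys_add)
  also have "eqv (TL (Suc m)) \<dots> (sum (\<lambda>n. ?f c n + ?f c' n) ?A)"
  proof (rule eqv_sum)
    fix n
    have "eqv (TL 1) (gen [Poly_Mapping.lookup (c + c') n])
        (gen [Poly_Mapping.lookup c n] + gen [Poly_Mapping.lookup c' n])"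
      using tensor_add[of "[0]" 1 0 "lscale H W"] by (simp add: lookup_add)
    from eqv_scale[OF tcat_eqv_left[OF q this], of "(-1) powi (n * int m)"]
    show "eqv (TL (Suc m)) (?f (c + c') n) (?f c n + ?f c' n)"
      by (simp add: tcat_add_left fs.scale_right_distrib)
  qed
  also have "sum (\<lambda>n. ?f c n + ?f c' n) ?A = sum (?f c) ?A + sum (?f c') ?A"
    by (rule sum.distrib)
  also have "eqv (TL (Suc m)) \<dots> (dsum c m q + dsum c' m q)"
    by (intro eqv_add eqv_sym[OF dsum_superset] q) auto
  finally show ?thesis .
qed

lemma dsum_scale:
  assumes q: "hom_len m q"
  shows "eqv (TL (Suc m)) (dsum (Poly_Mapping.map (lscale H W a) c) m q) (fscale a (dsum c m q))"
proof -
  let ?A = "Poly_Mapping.keys c"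
  let ?f = "\<lambda>c n. fscale ((-1) powi (n * int m)) (tcat (gen [Poly_Mapping.lookup c n]) q)"
  have lookup: "Poly_Mapping.lookup (Poly_Mapping.map (lscale H W a) c) n = lscale H W a (Poly_Mapping.lookup c n)" for n
    unfolding lscale_def by (rule lookup_map_act)
  have "eqv (TL (Suc m)) (dsum (Poly_Mapping.map (lscale H W a) c) m q)
      (sum (?f (Poly_Mapping.map (lscale H W a) c)) ?A)"
    by (rule dsum_superset[OF q]) (auto simp: in_keys_iff lookup lscale_def act_zero)
  also have "eqv (TL (Suc m)) \<dots> (sum (\<lambda>n. fscale a (?f c n)) ?A)"
  proof (rule eqv_sum)
    fix n
    have "eqv (TL 1) (gen [Poly_Mapping.lookup (Poly_Mapping.map (lscale H W a) c) n])
        (fscale a (gen [Poly_Mapping.lookup c n]))"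
      using tensor_scale[of "[0]" 1 0 "lscale H W"] by (simp add: lookup)
    from eqv_scale[OF tcat_eqv_left[OF q this], of "(-1) powi (n * int m)"]
    show "eqv (TL (Suc m)) (?f (Poly_Mapping.map (lscale H W a) c) n) (fscale a (?f c n))"
      by (simp add: tcat_scale_left mult.commute)
  qed
  also have "sum (\<lambda>n. fscale a (?f c n)) ?A = fscale a (dsum c m q)"
    by (simp add: dsum_def fs.scale_sum_right)
  finally show ?thesis .
qed

lemma dsum_eqv:
  assumes "eqv (TL m) q q'"
  shows "eqv (TL (Suc m)) (dsum c m q) (dsum c m q')"
  unfolding dsum_def using tcat_eqv_right[OF _ assms, of 1 "gen [_]"]
  by (intro eqv_sum eqv_scale) simp

lemma dsum_add_right: "dsum c m (q + q') = dsum c m q + dsum c m q'"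
  by (simp add: dsum_def tcat_add_right fs.scale_right_distrib sum.distrib)

lemma dsum_scale_right: "dsum c m (fscale a q) = fscale a (dsum c m q)"
  by (simp add: dsum_def tcat_scale_right fs.scale_sum_right mult.commute)

lemma desusp_add:
  "i < length us \<Longrightarrow> eqv (TL (length us)) (desusp W (us[i := x + y]))
    (desusp W (us[i := x]) + desusp W (us[i := y]))"
proof (induction us arbitrary: i)
  case (Cons u us)
  show ?case
  proof (cases i)
    case 0
    then show ?thesis
      using dsum_add[OF hom_len_desusp] by (simp del: desusp.simps add: desusp_Cons components_add)
  next
    case (Suc j)
    then have "eqv (TL (length us)) (desusp W (us[j := x + y])) (desusp W (us[j := x]) + desusp W (us[j := y]))"
      using Cons by simp
    from dsum_eqv[OF this] show ?thesis
      using Suc by (simp del: desusp.simps add: desusp_Cons dsum_add_right)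
  qed
qed simp

lemma desusp_scale:
  "i < length us \<Longrightarrow> eqv (TL (length us)) (desusp W (us[i := lscale H W c x]))
    (fscale c (desusp W (us[i := x])))"
proof (induction us arbitrary: i)
  case (Cons u us)
  have comp: "components W (lscale H W c x) = Poly_Mapping.map (lscale H W c) (components W x)"
    unfolding lscale_def by (rule components_act)
  show ?case
  proof (cases i)
    case 0
    then show ?thesis
      using dsum_scale[OF hom_len_desusp] by (simp del: desusp.simps add: desusp_Cons comp)
  next
    case (Suc j)
    then have "eqv (TL (length us)) (desusp W (us[j := lscale H W c x])) (fscale c (desusp W (us[j := x])))"
      using Cons by simp
    from dsum_eqv[OF this] show ?thesis
      using Suc by (simp del: desusp.simps add: desusp_Cons dsum_scale_right)
  qed
qed simp

abbreviation desuspr :: "('l list \<Rightarrow>\<^sub>0 'k) \<Rightarrow> ('l list \<Rightarrow>\<^sub>0 'k)"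
  where "desuspr p \<equiv> fext (desusp W) p"

lemma desuspr_eqv: "eqv (TL n) p q \<Longrightarrow> eqv (TL n) (desuspr p) (desuspr q)"
  by (rule fext_tensor[rotated 2]) (auto intro: desusp_add desusp_scale)

lemma hom_len_desuspr: "hom_len n p \<Longrightarrow> hom_len n (desuspr p)"
  by (rule hom_len_fext) (metis hom_lenD hom_len_desusp)

lemma desusp_homogeneous:
  "homogeneous W ds us \<Longrightarrow> eqv (TL (length us)) (desusp W us) (fscale (dsign ds) (gen us))"
proof (induction us arbitrary: ds)
  case Nil
  then show ?case by (simp add: homogeneous_def)
next
  case (Cons u us)
  then obtain d ds' where ds: "ds = d # ds'" "u \<in> grade W d" "homogeneous W ds' us"
    by (auto simp: homogeneous_def list_all2_Cons2)
  have len: "length ds' = length us"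
    using ds(3) by (auto simp: homogeneous_def dest: list_all2_lengthD)
  let ?m = "length us"
  have "eqv (TL (Suc ?m)) (desusp W (u # us)) (dsum (components W u) ?m (fscale (dsign ds') (gen us)))"
    unfolding desusp_Cons by (intro dsum_eqv Cons.IH ds)
  \<comment> \<open>The index set is {d} even if \<open>u\<close> is 0 and has empty support; the
    extra term then vanishes modulo the relations.\<close>
  also have "eqv (TL (Suc ?m)) \<dots> (\<Sum>n\<in>{d}.
       fscale ((-1) powi (n * int ?m)) (tcat (gen [Poly_Mapping.lookup (components W u) n]) (fscale (dsign ds') (gen us))))"
    by (rule dsum_superset) (auto simp: hom_len_scale components_homogeneous[OF ds(2)] keys_def lookup_single when_def)
  also have "\<dots> = fscale (dsign ds) (gen (u # us))"
    by (simp add: components_homogeneous[OF ds(2)] ds(1) len tcat_scale_right)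
  finally show ?case by simp
qed

text \<open>Pure tensors of homogeneous elements span: one argument at a time is decomposed into
  components and expanded by additivity.\<close>

lemma gen_homogeneous_expansion:
  "\<exists>p. eqv (TL (length us)) (gen us) p \<and> (\<forall>xs\<in>Poly_Mapping.keys p. \<exists>ds. homogeneous W ds xs \<and> length xs = length us)"
proof (induction us)
  case Nil
  have "homogeneous W [] []" by (simp add: homogeneous_def)
  then show ?case by (intro exI[of _ "gen []"]) auto
next
  case (Cons u us)
  then obtain p where p: "eqv (TL (length us)) (gen us) p"
    "\<And>xs. xs \<in> Poly_Mapping.keys p \<Longrightarrow> \<exists>ds. homogeneous W ds xs \<and> length xs = length us"
    by blast
  have plen: "hom_len (length us) p" using p(2) by (auto simp: hom_len_def)
  let ?c = "components W u"
  let ?m = "length us"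
  let ?p = "\<Sum>n\<in>Poly_Mapping.keys ?c. tcat (gen [Poly_Mapping.lookup ?c n]) p"
  have sum: "eqv (TL (Suc ?m)) (tcat (gen [\<Sum>n\<in>K. g n]) p) (\<Sum>n\<in>K. tcat (gen [g n]) p)"
    for g :: "int \<Rightarrow> 'l" and K
  proof (induction K rule: infinite_finite_induct)
    case (insert n K)
    have "eqv (TL 1) (gen [g n + sum g K]) (gen [g n] + gen [sum g K])"
      using tensor_add[of "[0]" 1 0 "lscale H W"] by simp
    from tcat_eqv_left[OF plen this]
    have "eqv (TL (Suc ?m)) (tcat (gen [g n + sum g K]) p) (tcat (gen [g n]) p + tcat (gen [sum g K]) p)"
      by (simp add: tcat_add_left)
    also have "eqv (TL (Suc ?m)) \<dots> (tcat (gen [g n]) p + (\<Sum>n\<in>K. tcat (gen [g n]) p))"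
      by (intro eqv_add insert.IH eqv_refl)
    finally show ?case using insert.hyps by simp
  qed (auto intro: gen_zero_head[OF plen])
  have "eqv (TL (Suc ?m)) (gen (u # us)) (tcat (gen [u]) p)"
    using tcat_eqv_right[OF _ p(1), of 1 "gen [u]"] by simp
  also have "eqv (TL (Suc ?m)) \<dots> ?p"
    using sum[of "Poly_Mapping.lookup ?c" "Poly_Mapping.keys ?c"] components_sum[of u] by simp
  finally have "eqv (TL (Suc ?m)) (gen (u # us)) ?p" .
  moreover have "\<exists>ds. homogeneous W ds xs \<and> length xs = Suc ?m" if xs: "xs \<in> Poly_Mapping.keys ?p" for xs
  proof -
    obtain n where "xs \<in> Poly_Mapping.keys (tcat (gen [Poly_Mapping.lookup ?c n]) p)"
      using subsetD[OF keys_sum xs] by blast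
    then obtain ys where ys: "ys \<in> Poly_Mapping.keys p" "xs = Poly_Mapping.lookup ?c n # ys"
      unfolding tcat_gen_left
      using keys_fext[of "\<lambda>ys. gen ([Poly_Mapping.lookup ?c n] @ ys) :: 'l list \<Rightarrow>\<^sub>0 'k" p] by auto
    obtain ds where "homogeneous W ds ys" "length ys = ?m" using p(2)[OF ys(1)] by blast
    then have "homogeneous W (n # ds) xs \<and> length xs = Suc ?m"
      using ys(2) components_grade by (simp add: homogeneous_def)
    then show ?thesis by blast
  qed
  ultimately show ?case by auto
qed

text \<open>Linear maps that descend to the tensor power are determined by homogeneous pure tensors.
  Through this, statements about \<open>desusp\<close> reduce to statements about the scalar
  \<open>dsign\<close>.\<close>

lemma homogeneous_agree:
  assumes F: "\<And>p q. eqv (TL n) p q \<Longrightarrow> eqv R (fext F p) (fext F q)"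
    and G: "\<And>p q. eqv (TL n) p q \<Longrightarrow> eqv R (fext G p) (fext G q)"
    and FG: "\<And>xs ds. length xs = n \<Longrightarrow> homogeneous W ds xs \<Longrightarrow> eqv R (F xs) (G xs)"
    and p: "hom_len n p"
  shows "eqv R (fext F p) (fext G p)"
proof (rule fext_eqv)
  fix us assume "us \<in> Poly_Mapping.keys p"
  then have "length us = n" using p by (rule hom_lenD[rotated])
  then obtain r where r: "eqv (TL n) (gen us) r"
    "\<And>xs. xs \<in> Poly_Mapping.keys r \<Longrightarrow> \<exists>ds. homogeneous W ds xs \<and> length xs = n"
    using gen_homogeneous_expansion[of us] by blast
  have "eqv R (F us) (fext F r)" using F[OF r(1)] by simp
  also have "eqv R \<dots> (fext G r)"
    by (rule fext_eqv) (use r(2) FG in blast)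
  also have "eqv R \<dots> (G us)" using G[OF eqv_sym[OF r(1)]] by simp
  finally show "eqv R (F us) (G us)" .
qed

lemma desuspr_desuspr:
  assumes "hom_len n p"
  shows "eqv (TL n) (desuspr (desuspr p)) p"
proof -
  have "eqv (TL n) (fext (\<lambda>us. desuspr (desusp W us)) p) (fext gen p)"
  proof (rule homogeneous_agree[OF _ _ _ assms])
    fix us ds assume us: "length us = n" "homogeneous W ds us"
    have "eqv (TL n) (desuspr (desusp W us)) (desuspr (fscale (dsign ds) (gen us)))"
      using desusp_homogeneous[OF us(2)] us(1) by (intro desuspr_eqv) simp
    also have "\<dots> = fscale (dsign ds) (desusp W us)" by (simp add: fext_scale)
    also have "eqv (TL n) \<dots> (fscale (dsign ds) (fscale (dsign ds) (gen us)))"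
      using desusp_homogeneous[OF us(2)] us(1) by (intro eqv_scale) simp
    also have "\<dots> = gen us" by (simp add: dsign_square)
    finally show "eqv (TL n) (desuspr (desusp W us)) (gen us)" .
  qed (auto simp flip: fext_fext intro: desuspr_eqv)
  then show ?thesis by (simp add: fext_fext)
qed

lemma homogeneous_act:
  "homogeneous W ds us \<Longrightarrow> length hs = length us \<Longrightarrow> homogeneous W ds (map2 (act W) hs us)"
  by (auto simp: homogeneous_def list_all2_conv_all_nth intro: grade_act)

text \<open>\<open>H\<close> sits in degree 0, so the action keeps the degrees of the arguments and
  both sides carry the same \<open>dsign ds\<close> on homogeneous ones.\<close>

lemma desuspr_tactr:
  assumes "hom_len n a" "hom_len n p"
  shows "eqv (TL n) (desuspr (tactr a p)) (tactr a (desuspr p))"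
proof -
  have "eqv (TL n) (desuspr (tactr (gen hs) p)) (tactr (gen hs) (desuspr p))" if hs: "length hs = n" for hs
  proof -
    have 1: "desuspr (tactr (gen hs) r) = fext (\<lambda>us. desusp W (map2 (act W) hs us)) r" for r
      by (simp add: tactr_gen fext_fext)
    have 2: "tactr (gen hs) (desuspr r) = fext (\<lambda>us. tactr (gen hs) (desusp W us)) r" for r
      by (simp add: tactr_gen fext_fext)
    have hom: "hom_len n (gen hs :: 'h list \<Rightarrow>\<^sub>0 'k)" by (simp add: hs)
    show ?thesis
      unfolding 1 2
    proof (rule homogeneous_agree[OF _ _ _ assms(2)], unfold 1[symmetric] 2[symmetric])
      fix us ds assume us: "length us = n" "homogeneous W ds us"
      have "eqv (TL n) (desusp W (map2 (act W) hs us)) (fscale (dsign ds) (gen (map2 (act W) hs us)))"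
        using desusp_homogeneous[OF homogeneous_act[OF us(2), of hs]] hs us(1) by simp
      also have "\<dots> = tactr (gen hs) (fscale (dsign ds) (gen us))"
        by (simp add: tactr_gen fext_scale)
      also have "eqv (TL n) \<dots> (tactr (gen hs) (desusp W us))"
        using eqv_sym[OF desusp_homogeneous[OF us(2)]] us(1) by (intro tactr_eqv_right hom) simp
      finally show "eqv (TL n) (desusp W (map2 (act W) hs us)) (tactr (gen hs) (desusp W us))" .
    qed (intro desuspr_eqv tactr_eqv_right hom; assumption)+
  qed
  note base = this
  have "desuspr (tactr a p) = fext (\<lambda>hs. desuspr (tactr (gen hs) p)) a"
    by (simp add: tactr_expand[of a] fext_fext)
  then show ?thesis
    unfolding tactr_expand[of a "desuspr p"]
    using hom_lenD[OF assms(1)] base by (auto intro!: fext_eqv)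
qed


section \<open>Decalage in a single arity\<close>

text \<open>The correspondence in one arity, used with \<open>W\<close> the shifted module: source
  and target are the same sets before and after the shift, so a second module does not appear. The
  scalar \<open>c\<close> later becomes \<open>tsign n\<close>.\<close>

definition dmap :: "'k \<Rightarrow> nat \<Rightarrow> ('k, 'h, 'l) polymap \<Rightarrow> ('k, 'h, 'l) polymap"
  where "dmap c n f = (\<lambda>t\<in>tpow (lscale H W) n.
    qscale (pnull H W n) c (f (tcls (lscale H W) n (fext (desusp W) (rep t)))))"

lemma dmap_tcls:
  assumes "hom_len n p"
  shows "dmap c n f (tcls (lscale H W) n p) = qscale (pnull H W n) c (f (tcls (lscale H W) n (desuspr p)))"
proof -
  have "tcls (lscale H W) n (desuspr (rep (tcls (lscale H W) n p))) = tcls (lscale H W) n (desuspr p)"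
    unfolding tcls_eq_iff by (intro desuspr_eqv rep_tcls)
  then show ?thesis using assms by (simp add: dmap_def tpow_mem)
qed

lemma dmap_tcls_pv:
  assumes "lhom n f" "n \<ge> 1" "hom_len n p"
  shows "dmap c n f (tcls (lscale H W) n p) = pcls H W n (fscale c (pv n f (desuspr p)))"
  using assms by (simp add: dmap_tcls lhom_tcls hom_len_desuspr qscale_pcls)

lemma dmap_homogeneous:
  assumes "lhom n f" "n \<ge> 1" "length us = n" "homogeneous W ds us"
  shows "dmap c n f (tcls (lscale H W) n (gen us))
    = qscale (pnull H W n) (c * dsign ds) (f (tcls (lscale H W) n (gen us)))"
proof -
  have len: "hom_len n (gen us :: 'l list \<Rightarrow>\<^sub>0 'k)" using assms by simp
  have "pv n f (desuspr (gen us)) = pv n f (fscale (dsign ds) (gen us))"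
    using desusp_homogeneous[OF assms(4)] assms(3) by (intro pv_cong) simp
  then have "eqv (P n) (fscale c (pv n f (desuspr (gen us)))) (fscale (c * dsign ds) (pv n f (gen us)))"
    using eqv_scale[OF pv_scale[OF assms(1,2) len, of "dsign ds"], of c] by simp
  then show ?thesis
    unfolding dmap_tcls_pv[OF assms(1,2) len] lhom_tcls(1)[OF assms(1,2) len] qscale_pcls pcls_eq_iff .
qed

lemma lhom_dmap:
  assumes f: "lhom n f" and n: "n \<ge> 1"
  shows "lhom n (dmap c n f)"
  unfolding lhom_def
proof (intro conjI ballI)
  note plen = lhom_tcls(2)[OF f n hom_len_desuspr]
  show "dmap c n f \<in> tpow (lscale H W) n \<rightarrow>\<^sub>E ptensor H W n"
  proof (rule PiE_I)
    fix t assume "t \<in> tpow (lscale H W) n"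
    then obtain p where p: "hom_len n p" "t = tcls (lscale H W) n p" by (rule tpow_cases)
    show "dmap c n f t \<in> ptensor H W n"
      unfolding p(2) dmap_tcls_pv[OF f n p(1)]
      by (intro ptensor_mem ph_len_scale plen p)
  qed (auto simp: dmap_def)
  fix t assume "t \<in> tpow (lscale H W) n"
  then obtain p where p: "hom_len n p" "t = tcls (lscale H W) n p" by (rule tpow_cases)
  {
    fix s assume "s \<in> tpow (lscale H W) n"
    then obtain q where q: "hom_len n q" "s = tcls (lscale H W) n q" by (rule tpow_cases)
    have "eqv (P n) (fscale c (pv n f (desuspr (q + p))))
        (fscale c (pv n f (desuspr q)) + fscale c (pv n f (desuspr p)))"
      using eqv_scale[OF pv_add[OF f n hom_len_desuspr[OF q(1)] hom_len_desuspr[OF p(1)]], of c]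
      by (simp add: fext_add fs.scale_right_distrib)
    then show "dmap c n f (qadd (tnull (lscale H W) n) s t)
        = qadd (pnull H W n) (dmap c n f s) (dmap c n f t)"
      unfolding p(2) q(2) qadd_tcls
      by (simp add: dmap_tcls_pv[OF f n] p q hom_len_add qadd_pcls pcls_eq_iff)
  }
  {
    fix b assume "b \<in> tpow (smult H) n"
    then obtain a where a: "hom_len n a" "b = tcls (smult H) n a" by (rule tpow_cases)
    have "pv n f (desuspr (tactr a p)) = pv n f (tactr a (desuspr p))"
      by (intro pv_cong desuspr_tactr a p)
    moreover have "eqv (P n) (pv n f (tactr a (desuspr p))) (pactr a (pv n f (desuspr p)))"
      by (intro pv_tactr f n a hom_len_desuspr p)
    ultimately have "eqv (P n) (fscale c (pv n f (desuspr (tactr a p))))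
        (fscale c (pactr a (pv n f (desuspr p))))"
      by (intro eqv_scale) simp
    also have "\<dots> = pactr a (fscale c (pv n f (desuspr p)))"
      by (simp add: pactr_eq fext_scale)
    finally show "dmap c n f (tact H W n b t) = pact H W n b (dmap c n f t)"
      unfolding p(2) a(2) tact_tcls[OF a(1) p(1)]
      by (simp add: dmap_tcls_pv[OF f n] p a hom_len_tactr pact_pcls[OF n a(1)] ph_len_scale plen pcls_eq_iff)
  }
qed

lemma dmap_dmap:
  assumes f: "lhom n f" and n: "n \<ge> 1" and c: "c * c = 1"
  shows "dmap c n (dmap c n f) = f"
proof
  fix t
  show "dmap c n (dmap c n f) t = f t"
  proof (cases "t \<in> tpow (lscale H W) n")
    case True
    then obtain p where p: "hom_len n p" "t = tcls (lscale H W) n p" by (rule tpow_cases)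
    have "pv n f (desuspr (desuspr p)) = pv n f p"
      by (intro pv_cong desuspr_desuspr p)
    then show ?thesis
      unfolding p(2) dmap_tcls[OF p(1), of c "dmap c n f"] dmap_tcls_pv[OF f n hom_len_desuspr[OF p(1)]]
        qscale_pcls lhom_tcls(1)[OF f n p(1)]
      by (simp add: c)
  next
    case False
    \<comment> \<open>Extensionality fixes the value off the tensor power, which makes the
      conclusion an equality of functions.\<close>
    moreover have "f t = undefined" using f False unfolding lhom_def by (auto simp: PiE_def extensional_def)
    ultimately show ?thesis by (simp add: dmap_def)
  qed
qed

lemma pgrade_qscale:
  assumes "t \<in> pgrade H W n d"
  shows "qscale (pnull H W n) c t \<in> pgrade H W n d"
proof -
  obtain p where p: "t = pcls H W n p" "\<forall>(hs, e)\<in>Poly_Mapping.keys p. length hs = n \<and> e \<in> grade W d"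
    using assms unfolding pgrade_def by blast
  then have "\<forall>(hs, e)\<in>Poly_Mapping.keys (fscale c p). length hs = n \<and> e \<in> grade W d"
    using keys_fscale[of c p] by blast
  then show ?thesis
    unfolding p(1) qscale_pcls pgrade_def by blast
qed

lemma polyhom_dmap:
  assumes "f \<in> polyhom H W n d" "n \<ge> 1"
  shows "dmap c n f \<in> polyhom H W n d"
  unfolding polyhom_iff
proof (intro conjI allI impI)
  have f: "lhom n f" using assms(1) by (simp add: polyhom_iff)
  then show "lhom n (dmap c n f)" using assms(2) by (rule lhom_dmap)
  fix xs ds assume "length xs = n \<and> homogeneous W ds xs"
  then show "dmap c n f (tcls (lscale H W) n (gen xs)) \<in> pgrade H W n (sum_list ds + d)"
    using dmap_homogeneous[OF f assms(2), of xs ds] pgrade_qscale assms(1)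
    by (auto simp: polyhom_iff)
qed

end


section \<open>Signs\<close>

lemma minus_one_powi_add: "(-1 :: 'k::field) powi (a + b) = (-1) powi a * (-1) powi b"
  by (simp add: power_int_add)

definition pairs :: "nat \<Rightarrow> (nat \<times> nat) set"
  where "pairs n = (SIGMA i:{..<n}. {i<..<n})"

lemma mem_pairs: "(i, j) \<in> pairs n \<longleftrightarrow> i < j \<and> j < n"
  by (auto simp: pairs_def)

lemma finite_pairs [simp]: "finite (pairs n)"
  by (simp add: pairs_def)

text \<open>A permutation acts bijectively on two-element subsets. Sorting the image by
  \<open>min\<close> and \<open>max\<close> turns this into a bijection of the pairs i < j, and
  symmetry of \<open>g\<close> makes the sorting harmless.\<close>

lemma prod_pairs_permutes:
  fixes g :: "nat \<Rightarrow> nat \<Rightarrow> 'a::comm_monoid_mult"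
  assumes \<sigma>: "\<sigma> permutes {..<n}" and sym: "\<And>a b. g a b = g b a"
  shows "(\<Prod>(i, j)\<in>pairs n. g (\<sigma> i) (\<sigma> j)) = (\<Prod>(i, j)\<in>pairs n. g i j)"
proof -
  define \<phi> where "\<phi> = (\<lambda>(\<tau> :: nat \<Rightarrow> nat) (i, j). (min (\<tau> i) (\<tau> j :: nat), max (\<tau> i) (\<tau> j)))"
  have mem: "\<phi> \<tau> x \<in> pairs n" if "\<tau> permutes {..<n}" "x \<in> pairs n" for \<tau> x
  proof -
    obtain i j where x: "x = (i, j)" "i < j" "j < n" using \<open>x \<in> pairs n\<close> by (cases x) (auto simp: mem_pairs)
    have "\<tau> i < n" "\<tau> j < n" "\<tau> i \<noteq> \<tau> j"
      using permutes_in_image[OF that(1), of i] permutes_in_image[OF that(1), of j] x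
        permutes_inj[OF that(1)] by (auto dest: injD)
    then show ?thesis by (auto simp: \<phi>_def x(1) mem_pairs)
  qed
  have inverse: "\<phi> \<tau>' (\<phi> \<tau> x) = x" if "x \<in> pairs n" "\<And>i. \<tau>' (\<tau> i) = i" for \<tau> \<tau>' x
    using that by (cases x) (auto simp: \<phi>_def mem_pairs min_def max_def)
  show ?thesis
  proof (rule prod.reindex_bij_witness[where i = "\<phi> (inv \<sigma>)" and j = "\<phi> \<sigma>"])
    fix x assume x: "x \<in> pairs n"
    show "\<phi> (inv \<sigma>) (\<phi> \<sigma> x) = x" using permutes_inverses[OF \<sigma>] by (intro inverse x) auto
    show "\<phi> \<sigma> (\<phi> (inv \<sigma>) x) = x" using permutes_inverses[OF \<sigma>] by (intro inverse x) auto
    show "\<phi> \<sigma> x \<in> pairs n" by (intro mem \<sigma> x)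
    show "\<phi> (inv \<sigma>) x \<in> pairs n" by (intro mem permutes_inv \<sigma> x)
    show "(case \<phi> \<sigma> x of (i, j) \<Rightarrow> g i j) = (case x of (i, j) \<Rightarrow> g (\<sigma> i) (\<sigma> j))"
      using sym[of "\<sigma> (fst x)" "\<sigma> (snd x)"] by (cases x) (auto simp: \<phi>_def min_def max_def)
  qed
qed

text \<open>An adjacent transposition has exactly one inversion. For a composition, a pair is
  inverted iff exactly one of the two successive permutations inverts it, and the factor of the
  outer one is reindexed along the inner one.\<close>

lemma sign_eq_prod_inversions:
  assumes "\<sigma> permutes {..<n}"
  shows "of_int (sign \<sigma>) = (\<Prod>(i, j)\<in>pairs n. if \<sigma> j < \<sigma> i then -1 else 1 :: 'k::field)"
  using assms
proof (induction rule: permutes_adjacent_induct)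
  case id
  have "(\<Prod>(i, j)\<in>pairs n. if id j < id i then -1 else 1 :: 'k) = 1"
    by (rule prod.neutral) (auto simp: mem_pairs)
  then show ?case by simp
next
  case (adjacent i)
  let ?\<tau> = "Transposition.transpose i (Suc i)"
  have "(\<Prod>(a, b)\<in>pairs n. if ?\<tau> b < ?\<tau> a then -1 else 1 :: 'k)
      = (\<Prod>x\<in>pairs n. if x = (i, Suc i) then -1 else 1)"
    by (rule prod.cong) (auto simp: mem_pairs Transposition.transpose_def split: if_splits)
  also have "\<dots> = -1" using adjacent by (simp add: mem_pairs)
  finally show ?case by (simp add: sign_swap_id)
next
  case (comp \<sigma> \<tau>)
  \<comment> \<open>The inversion sign made symmetric: it asks whether the order of a and b is
    preserved, whichever is larger, so that \<open>prod_pairs_permutes\<close> applies.\<close>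
  let ?g = "\<lambda>\<sigma> a b :: nat. if a < b \<longleftrightarrow> \<sigma> a < (\<sigma> b :: nat) then 1 else -1 :: 'k"
  have inj: "\<sigma> a = \<sigma> b \<longleftrightarrow> a = b" "\<tau> a = \<tau> b \<longleftrightarrow> a = b" for a b
    using permutes_inj[OF comp(1)] permutes_inj[OF comp(2)] by (auto dest: injD)
  have sym: "?g \<sigma> a b = ?g \<sigma> b a" for a b
    using inj(1)[of a b] by (auto simp: not_less order.order_iff_strict)
  have "(\<Prod>(i, j)\<in>pairs n. if (\<sigma> \<circ> \<tau>) j < (\<sigma> \<circ> \<tau>) i then -1 else 1)
      = (\<Prod>(i, j)\<in>pairs n. (if \<tau> j < \<tau> i then -1 else 1) * ?g \<sigma> (\<tau> i) (\<tau> j))"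
  proof (rule prod.cong[OF refl], clarify)
    fix i j assume "(i, j) \<in> pairs n"
    then have "i \<noteq> j" by (simp add: mem_pairs)
    then have "\<tau> i \<noteq> \<tau> j" "\<sigma> (\<tau> i) \<noteq> \<sigma> (\<tau> j)" using inj by auto
    then show "(if (\<sigma> \<circ> \<tau>) j < (\<sigma> \<circ> \<tau>) i then -1 else 1)
        = (if \<tau> j < \<tau> i then -1 else 1) * ?g \<sigma> (\<tau> i) (\<tau> j)"
      by auto
  qed
  also have "\<dots> = (\<Prod>(i, j)\<in>pairs n. if \<tau> j < \<tau> i then -1 else 1) * (\<Prod>(i, j)\<in>pairs n. ?g \<sigma> (\<tau> i) (\<tau> j))"
    by (simp add: split_def prod.distrib)
  also have "(\<Prod>(i, j)\<in>pairs n. ?g \<sigma> (\<tau> i) (\<tau> j)) = (\<Prod>(i, j)\<in>pairs n. ?g \<sigma> i j)"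
    by (rule prod_pairs_permutes[OF comp(2) sym])
  also have "\<dots> = (\<Prod>(i, j)\<in>pairs n. if \<sigma> j < \<sigma> i then -1 else 1)"
  proof (rule prod.cong[OF refl], clarify)
    fix i j assume "(i, j) \<in> pairs n"
    then have "i < j" by (simp add: mem_pairs)
    then show "?g \<sigma> i j = (if \<sigma> j < \<sigma> i then -1 else 1)"
      using inj(1)[of i j] by auto
  qed
  finally have prod: "(\<Prod>(i, j)\<in>pairs n. if (\<sigma> \<circ> \<tau>) j < (\<sigma> \<circ> \<tau>) i then -1 else 1)
      = (of_int (sign \<tau>) * of_int (sign \<sigma>) :: 'k)"
    unfolding comp .
  have "sign (\<sigma> \<circ> \<tau>) = sign \<sigma> * sign \<tau>"
    by (intro sign_compose permutes_imp_permutation[OF finite_lessThan comp(1)]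
        permutes_imp_permutation[OF finite_lessThan comp(2)])
  then show ?case using prod by (simp add: comp_def)
qed

lemma dsign_eq_prod_power: "dsign ds = (\<Prod>i<length ds. ((-1) powi (ds ! i)) ^ (length ds - 1 - i) :: 'k::field)"
proof (induction ds)
  case (Cons d ds)
  have "(-1 :: 'k) powi (d * int (length ds)) = ((-1) powi d) ^ length ds"
    by (simp add: power_int_power')
  then show ?case
    using Cons by (simp only: length_Cons prod.lessThan_Suc_shift) simp
qed simp

text \<open>The exponent n - 1 - i of the degree at index i counts the indices j > i.\<close>

lemma dsign_eq_prod_pairs: "dsign ds = (\<Prod>(i, j)\<in>pairs (length ds). (-1) powi (ds ! i) :: 'k::field)"
proof -
  have "(\<Prod>(i, j)\<in>pairs (length ds). (-1) powi (ds ! i) :: 'k)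
      = (\<Prod>i<length ds. \<Prod>j\<in>{i<..<length ds}. (-1) powi (ds ! i))"
    unfolding pairs_def by (rule prod.Sigma[symmetric]) auto
  then show ?thesis by (simp add: dsign_eq_prod_power)
qed

lemma koszul_eq_prod_pairs:
  "koszul \<sigma> ds = (\<Prod>(i, j)\<in>pairs (length ds).
    if \<sigma> j < \<sigma> i then (-1) powi (ds ! \<sigma> i * ds ! \<sigma> j) else 1 :: 'k::field)"
proof -
  have "{(i, j). i < j \<and> j < length ds \<and> \<sigma> j < \<sigma> i} = {x \<in> pairs (length ds). case x of (i, j) \<Rightarrow> \<sigma> j < \<sigma> i}"
    by (auto simp: mem_pairs)
  then show ?thesis
    unfolding koszul_def by (simp add: prod.inter_filter split_def)
qed

text \<open>
  Modulo two, \<open>(a - 1) (b - 1) + a b = a + b + 1\<close>: an inversion contributes to the signature and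
  exchanges the degree of its smaller index with that of its larger one in \<open>dsign\<close>.
\<close>

lemma koszul_shift:
  assumes \<sigma>: "\<sigma> permutes {..<length ds}"
  shows "koszul \<sigma> ds * dsign (permute_list \<sigma> ds)
    = of_int (sign \<sigma>) * koszul \<sigma> (map (\<lambda>d. d - 1) ds) * (dsign ds :: 'k::field)"
proof -
  let ?n = "length ds"
  let ?s = "\<lambda>a. (-1) powi a :: 'k"
  let ?inv = "\<lambda>i j. if \<sigma> j < \<sigma> i then -1 else 1 :: 'k"
  let ?k = "\<lambda>i j. if \<sigma> j < \<sigma> i then ?s (ds ! \<sigma> i * ds ! \<sigma> j) else 1"
  let ?k' = "\<lambda>i j. if \<sigma> j < \<sigma> i then ?s ((ds ! \<sigma> i - 1) * (ds ! \<sigma> j - 1)) else 1"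
  have lt: "\<sigma> i < ?n" if "i < ?n" for i
    using permutes_in_image[OF \<sigma>, of i] that by simp
  have "dsign (permute_list \<sigma> ds) = (\<Prod>(i, j)\<in>pairs ?n. ?s (ds ! \<sigma> i))"
    unfolding dsign_eq_prod_pairs length_permute_list
    by (rule prod.cong) (auto simp: mem_pairs nth_permute_list)
  then have "koszul \<sigma> ds * dsign (permute_list \<sigma> ds) = (\<Prod>(i, j)\<in>pairs ?n. ?k i j * ?s (ds ! \<sigma> i))"
    by (simp add: koszul_eq_prod_pairs split_def prod.distrib)
  \<comment> \<open>Besides the two inversion signs, what remains depends only on the set {\<sigma>
    i, \<sigma> j}, so it can be reindexed; for a pair in order the smaller index is \<sigma> i
    already.\<close>
  also have "\<dots> = (\<Prod>(i, j)\<in>pairs ?n. ?inv i j * ?k' i j * ?s (ds ! min (\<sigma> i) (\<sigma> j)))"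
  proof (rule prod.cong[OF refl], clarify)
    fix i j assume "(i, j) \<in> pairs ?n"
    let ?a = "ds ! \<sigma> i" and ?b = "ds ! \<sigma> j"
    have "(?a - 1) * (?b - 1) + ?b = ?a * ?b + (1 + - ?a)" by (simp add: algebra_simps)
    then have "?s ((?a - 1) * (?b - 1)) * ?s ?b = ?s (?a * ?b) * (?s 1 * ?s (- ?a))"
      by (metis minus_one_powi_add)
    then have "- (?s ((?a - 1) * (?b - 1)) * ?s ?b) = ?s (?a * ?b) * ?s ?a"
      by (simp add: power_int_minus flip: power_int_inverse)
    then show "?k i j * ?s ?a = ?inv i j * ?k' i j * ?s (ds ! min (\<sigma> i) (\<sigma> j))"
      by (auto simp: min_def)
  qed
  also have "\<dots> = (\<Prod>(i, j)\<in>pairs ?n. ?inv i j) * (\<Prod>(i, j)\<in>pairs ?n. ?k' i j)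
      * (\<Prod>(i, j)\<in>pairs ?n. ?s (ds ! min (\<sigma> i) (\<sigma> j)))"
    by (simp add: split_def prod.distrib)
  also have "(\<Prod>(i, j)\<in>pairs ?n. ?s (ds ! min (\<sigma> i) (\<sigma> j))) = (\<Prod>(i, j)\<in>pairs ?n. ?s (ds ! min i j))"
    by (rule prod_pairs_permutes[OF \<sigma>]) (simp add: min.commute)
  also have "\<dots> = dsign ds"
    unfolding dsign_eq_prod_pairs by (rule prod.cong) (auto simp: mem_pairs min_def)
  also have "(\<Prod>(i, j)\<in>pairs ?n. ?k' i j) = koszul \<sigma> (map (\<lambda>d. d - 1) ds)"
    unfolding koszul_eq_prod_pairs length_map
    by (rule prod.cong) (auto simp: mem_pairs lt)
  finally show ?thesis by (simp add: sign_eq_prod_inversions[OF \<sigma>])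
qed

text \<open>The cross term arises because every argument of the first block is also passed by the
  \<open>length ys\<close> maps of the second.\<close>

lemma dsign_append:
  "dsign (xs @ ys) = dsign xs * (-1) powi (sum_list xs * int (length ys)) * (dsign ys :: 'k::field)"
  by (induction xs) (simp_all add: distrib_left distrib_right minus_one_powi_add mult_ac)

definition tsign :: "nat \<Rightarrow> 'k::field"
  where "tsign n = (-1) ^ (n * (n - 1) div 2)"

lemma tsign_square: "tsign n * tsign n = (1 :: 'k::field)"
  by (simp add: tsign_def flip: power_mult_distrib)

lemma triangle_Suc: "Suc n * n div 2 = n + n * (n - 1) div 2"
proof -
  have "Suc n * n = n * (n - 1) + n * 2" by (cases n) (auto simp: algebra_simps)
  then show ?thesis by simp
qed

lemma tsign_Suc: "tsign (Suc n) = (-1) ^ n * (tsign n :: 'k::field)"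
  unfolding tsign_def diff_Suc_1 triangle_Suc by (rule power_add)

lemma tsign_add: "tsign (l + m) = tsign l * tsign m * ((-1) ^ (l * m) :: 'k::field)"
proof (induction m)
  case (Suc m)
  have "tsign (l + Suc m) = (-1) ^ (l + m) * (tsign (l + m) :: 'k)"
    by (simp add: tsign_Suc)
  then show ?case
    using Suc by (simp add: tsign_Suc power_add mult_ac)
qed (simp add: tsign_def)

text \<open>Here m = k - 1 and \<open>sum_list ds1 + -1\<close> is the degree of the inner value, so
  the signs of the inner and outer map are multiplied. The -1 contributes (-1)^m, which cancels the
  (-1)^m from \<open>tsign (Suc m)\<close>; the cross term of the triangular numbers
  remains.\<close>

lemma dsign_composition:
  assumes l: "length ds1 = l" and m: "length ds2 = m"
  shows "tsign l * dsign ds1 * (tsign (Suc m) * dsign ((sum_list ds1 + -1) # ds2))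
    = tsign (l + m) * (-1) ^ (l * m) * (dsign (ds1 @ ds2) :: 'k::field)"
proof -
  let ?s = "(-1) powi (sum_list ds1 * int m) :: 'k"
  have "(-1 :: 'k) powi ((sum_list ds1 + -1) * int m) = (-1) powi (sum_list ds1 * int m + - int m)"
    by (simp add: algebra_simps)
  also have "\<dots> = ?s * (-1) ^ m"
    unfolding minus_one_powi_add by (simp add: power_int_minus flip: power_inverse)
  finally have "tsign l * dsign ds1 * (tsign (Suc m) * dsign ((sum_list ds1 + -1) # ds2))
      = ((-1) ^ m * (-1) ^ m) * (tsign l * tsign m) * (dsign ds1 * ?s * (dsign ds2 :: 'k))"
    by (simp add: m tsign_Suc mult_ac)
  \<comment> \<open>Both sides are 1. Of the two copies of (-1)^(lm), one completes
    \<open>tsign (l + m)\<close> and the other stays in the result.\<close>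
  also have "(-1 :: 'k) ^ m * (-1) ^ m = ((-1) ^ (l * m)) * ((-1) ^ (l * m))"
    by (simp flip: power_mult_distrib)
  finally show ?thesis
    by (simp add: tsign_add dsign_append m mult_ac)
qed


section \<open>The shifted module\<close>

lemma shift_simps [simp]:
  "act (shift L) = act L"
  "grade (shift L) n = grade L (n - 1)"
  by (simp_all add: shift_def)

lemma lscale_shift [simp]: "lscale H (shift L) = lscale H L"
  by (simp add: lscale_def fun_eq_iff)

lemma shift_target [simp]:
  "pnull H (shift L) n = pnull H L n"
  "ptensor H (shift L) n = ptensor H L n"
  "tact H (shift L) n = tact H L n"
  "pact H (shift L) n = pact H L n"
  "slots H (shift L) n = slots H L n"
  "pev H (shift L) = pev H L"
  by (auto simp: pnull_def prels_def ptensor_def tact_def pact_def slots_def pev_def fun_eq_iff)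

lemma shift_jacobi_term [simp]: "jacobi_term H (shift L) = jacobi_term H L"
  by (auto simp: jacobi_term_def pcomp_def fun_eq_iff)

lemma pgrade_shift: "pgrade H (shift L) n d = pgrade H L n (d - 1)"
  by (simp add: pgrade_def)

lemma homogeneous_shift: "homogeneous (shift L) ds xs \<longleftrightarrow> homogeneous L (map (\<lambda>d. d - 1) ds) xs"
  by (simp add: homogeneous_def list_all2_map1)

text \<open>Lowering all entries by one is a bijection of degree lists; it matches quantifiers over
  degrees in L with those in L[-1].\<close>

lemma all_degrees_shift: "(\<forall>ds. Q ds) \<longleftrightarrow> (\<forall>ds :: int list. Q (map (\<lambda>d. d - 1) ds))"
proof (intro iffI allI)
  fix ds assume "\<forall>ds. Q (map (\<lambda>d. d - 1) ds)"
  then have "Q (map (\<lambda>d. d - 1) (map (\<lambda>d. d + 1) ds))" by blast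
  then show "Q ds" by (simp add: comp_def)
qed blast

lemma sum_list_map_minus_one: "sum_list (map (\<lambda>d. d - 1) ds) = sum_list ds - int (length ds)"
  by (induction ds) auto

lemma homogeneous_length: "homogeneous W ds xs \<Longrightarrow> length ds = length xs"
  by (auto simp: homogeneous_def dest: list_all2_lengthD)

text \<open>Each of the n arguments gains one degree and so does the value, which turns d into d - n
  + 1, and in particular k - 2 into -1.\<close>

lemma polyhom_shift: "polyhom H L n d = polyhom H (shift L) n (d - int n + 1)"
proof -
  have "(length xs = n \<and> homogeneous L (map (\<lambda>d. d - 1) ds) xs \<longrightarrow>
        t \<in> pgrade H L n (sum_list (map (\<lambda>d. d - 1) ds) + d)) \<longleftrightarrow>
      (length xs = n \<and> homogeneous (shift L) ds xs \<longrightarrow>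
        t \<in> pgrade H (shift L) n (sum_list ds + (d - int n + 1)))" for xs t ds
    by (auto simp: homogeneous_shift pgrade_shift sum_list_map_minus_one algebra_simps
        dest: homogeneous_length)
  then have "(\<forall>ds. length xs = n \<and> homogeneous L ds xs \<longrightarrow> t \<in> pgrade H L n (sum_list ds + d)) \<longleftrightarrow>
      (\<forall>ds. length xs = n \<and> homogeneous (shift L) ds xs \<longrightarrow>
        t \<in> pgrade H (shift L) n (sum_list ds + (d - int n + 1)))" for xs t
    by (subst all_degrees_shift) simp
  then show ?thesis unfolding polyhom_def by simp
qed

lemma graded_module_shift:
  fixes L :: "('h::ring_1, 'l::ab_group_add) gmod"
  assumes "graded_module H L"
  shows "graded_module H (shift L)"
proof -
  have inj: "inj (\<lambda>n :: int. n - 1)" "inj (\<lambda>n :: int. n + 1)" by (auto intro: injI)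
  have ex1: "\<exists>!p :: int \<Rightarrow>\<^sub>0 'l. (\<forall>n. Poly_Mapping.lookup p n \<in> grade L (n - 1)) \<and>
         x = (\<Sum>n\<in>Poly_Mapping.keys p. Poly_Mapping.lookup p n)" for x
  proof -
    let ?Q = "\<lambda>q :: int \<Rightarrow>\<^sub>0 'l. (\<forall>n. Poly_Mapping.lookup q n \<in> grade L n) \<and>
         x = (\<Sum>n\<in>Poly_Mapping.keys q. Poly_Mapping.lookup q n)"
    \<comment> \<open>\<open>map_key\<close> pulls back along its argument, so subtracting 1 moves
      the component of degree n to degree n + 1.\<close>
    let ?up = "Poly_Mapping.map_key (\<lambda>n :: int. n - 1) :: (int \<Rightarrow>\<^sub>0 'l) \<Rightarrow> _"
    let ?down = "Poly_Mapping.map_key (\<lambda>n :: int. n + 1) :: (int \<Rightarrow>\<^sub>0 'l) \<Rightarrow> _"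
    have lookup: "Poly_Mapping.lookup (?up q) n = Poly_Mapping.lookup q (n - 1)"
      "Poly_Mapping.lookup (?down q) n = Poly_Mapping.lookup q (n + 1)" for q n
      by (simp_all add: map_key.rep_eq inj)
    have sum: "(\<Sum>n\<in>Poly_Mapping.keys (?up q). Poly_Mapping.lookup (?up q) n)
        = (\<Sum>n\<in>Poly_Mapping.keys q. Poly_Mapping.lookup q n)" for q
      by (rule sum.reindex_bij_witness[where i = "\<lambda>n. n + 1" and j = "\<lambda>n. n - 1"])
        (auto simp: lookup in_keys_iff)
    have up_down: "?up (?down p) = p" for p
      by (rule poly_mapping_eqI) (simp add: lookup)
    obtain q where q: "?Q q" "\<And>r. ?Q r \<Longrightarrow> r = q"
      using assms unfolding graded_module_def by metis
    show ?thesis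
    proof (rule ex1I[of _ "?up q"])
      show "(\<forall>n. Poly_Mapping.lookup (?up q) n \<in> grade L (n - 1)) \<and>
         x = (\<Sum>n\<in>Poly_Mapping.keys (?up q). Poly_Mapping.lookup (?up q) n)"
        using q(1) unfolding sum by (simp add: lookup)
      fix p assume p: "(\<forall>n. Poly_Mapping.lookup p n \<in> grade L (n - 1)) \<and>
         x = (\<Sum>n\<in>Poly_Mapping.keys p. Poly_Mapping.lookup p n)"
      have "Poly_Mapping.lookup (?down p) n \<in> grade L n" for n
        using p spec[of "\<lambda>n. Poly_Mapping.lookup p n \<in> grade L (n - 1)" "n + 1"] by (simp add: lookup)
      then have "?Q (?down p)"
        using p sum[of "?down p"] unfolding up_down by simp
      then have "?down p = q" by (rule q(2))
      then show "p = ?up q" using up_down[of p] by simp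
    qed
  qed
  have "(\<forall>n. 0 \<in> grade L n \<and> (\<forall>x\<in>grade L n. \<forall>y\<in>grade L n. x + y \<in> grade L n) \<and>
         (\<forall>h. \<forall>x\<in>grade L n. act L h x \<in> grade L n))"
    using assms unfolding graded_module_def by (elim conjE)
  then have "(\<forall>n. 0 \<in> grade L (n - 1) \<and> (\<forall>x\<in>grade L (n - 1). \<forall>y\<in>grade L (n - 1). x + y \<in> grade L (n - 1)) \<and>
         (\<forall>h. \<forall>x\<in>grade L (n - 1). act L h x \<in> grade L (n - 1)))"
    by blast
  moreover have "\<forall>x. \<exists>!p :: int \<Rightarrow>\<^sub>0 'l. (\<forall>n. Poly_Mapping.lookup p n \<in> grade L (n - 1)) \<and>
         x = (\<Sum>n\<in>Poly_Mapping.keys p. Poly_Mapping.lookup p n)"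
    by (rule allI) (rule ex1)
  ultimately show ?thesis
    using assms unfolding graded_module_def shift_simps by (elim conjE) (intro conjI; assumption)
qed


section \<open>Comparison of the identities\<close>

text \<open>Signs are scalars of the ground field, of any characteristic, that are their own
  inverses; this is the form in which they are cancelled.\<close>

lemma eqv_unit_iff:
  assumes "c * c = 1"
  shows "eqv R (fscale c p) (fscale c q) \<longleftrightarrow> eqv R p q"
  using eqv_scale[of R p q c] eqv_scale[of R "fscale c p" "fscale c q" c] assms by auto

lemma span_unit_iff:
  assumes "c * c = 1"
  shows "fscale c p \<in> fs.span R \<longleftrightarrow> p \<in> fs.span R"
  using eqv_unit_iff[OF assms, of R p 0] by (simp add: eqv_def)

context cc_module
begin

lemma slotr_scale: "slotr \<sigma> (fscale c p) = fscale c (slotr \<sigma> p)"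
  by (simp add: slotr_def fext_scale)

lemma homogeneous_permute:
  assumes "\<sigma> permutes {..<length xs}" "homogeneous W ds xs"
  shows "homogeneous W (permute_list \<sigma> ds) (permute_list \<sigma> xs)"
  using assms homogeneous_length[OF assms(2)]
  by (simp add: homogeneous_def list_all2_permute_list_iff)

text \<open>With \<open>W\<close> the shifted module, the right side is graded skew-symmetry of
  \<open>f\<close> with degrees read in L. The two values of \<open>dmap\<close> carry
  \<open>dsign\<close> of the given and of the permuted degrees, and \<open>koszul_shift\<close>
  trades these for the signature and the change of Koszul sign.\<close>

lemma graded_symmetric_dmap:
  assumes f: "lhom n f" and n: "n \<ge> 1" and c: "c * c = 1"
  shows "graded_symmetric H W n (dmap c n f) \<longleftrightarrow>
    (\<forall>\<sigma> xs ds. \<sigma> permutes {..<n} \<and> length xs = n \<and> homogeneous W ds xs \<longrightarrow>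
       pev H W f xs = qscale (pnull H W n) (of_int (sign \<sigma>) * koszul \<sigma> (map (\<lambda>d. d - 1) ds))
         (slots H W n \<sigma> (pev H W f (permute_list \<sigma> xs))))"
proof -
  have "pev H W (dmap c n f) xs = qscale (pnull H W n) (koszul \<sigma> ds)
        (slots H W n \<sigma> (pev H W (dmap c n f) (permute_list \<sigma> xs))) \<longleftrightarrow>
      pev H W f xs = qscale (pnull H W n) (of_int (sign \<sigma>) * koszul \<sigma> (map (\<lambda>d. d - 1) ds))
         (slots H W n \<sigma> (pev H W f (permute_list \<sigma> xs)))"
    if \<sigma>: "\<sigma> permutes {..<n}" and xs: "length xs = n" "homogeneous W ds xs" for \<sigma> xs ds
  proof -
    define p where "p = pv n f (gen xs)"
    define q where "q = pv n f (gen (permute_list \<sigma> xs))"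
    let ?d = "c * dsign ds" and ?s = "of_int (sign \<sigma>) * koszul \<sigma> (map (\<lambda>d. d - 1) ds) :: 'k"
    have ds: "length ds = n" using homogeneous_length[OF xs(2)] xs(1) by simp
    have hom: "homogeneous W (permute_list \<sigma> ds) (permute_list \<sigma> xs)"
      using homogeneous_permute[OF _ xs(2)] \<sigma> xs(1) by simp
    have f1: "pev H W f xs = pcls H W n p"
      using lhom_tcls(1)[OF f n, of "gen xs"] xs(1) by (simp add: pev_def p_def)
    have f2: "pev H W f (permute_list \<sigma> xs) = pcls H W n q"
      using lhom_tcls(1)[OF f n, of "gen (permute_list \<sigma> xs)"] xs(1) by (simp add: pev_def q_def)
    have d1: "pev H W (dmap c n f) xs = pcls H W n (fscale ?d p)"
      using dmap_homogeneous[OF f n xs, of c] f1 xs(1) by (simp add: pev_def qscale_pcls)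
    have d2: "pev H W (dmap c n f) (permute_list \<sigma> xs) = pcls H W n (fscale (c * dsign (permute_list \<sigma> ds)) q)"
      using dmap_homogeneous[OF f n _ hom, of c] f2 xs(1) by (simp add: pev_def qscale_pcls)
    have "koszul \<sigma> ds * (c * dsign (permute_list \<sigma> ds)) = c * (koszul \<sigma> ds * dsign (permute_list \<sigma> ds))"
      by (simp add: mult_ac)
    also have "\<dots> = ?d * ?s"
      using \<sigma> ds by (subst koszul_shift) (simp_all only: mult_ac)
    finally have sgn: "koszul \<sigma> ds * (c * dsign (permute_list \<sigma> ds)) = ?d * ?s" .
    have unit: "?d * ?d = 1"
    proof -
      have "?d * ?d = (c * c) * (dsign ds * dsign ds)" by (simp only: mult_ac)
      then show ?thesis by (simp add: c dsign_square)
    qed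
    have "pev H W (dmap c n f) xs = qscale (pnull H W n) (koszul \<sigma> ds)
          (slots H W n \<sigma> (pev H W (dmap c n f) (permute_list \<sigma> xs)))
        \<longleftrightarrow> eqv (P n) (fscale ?d p) (fscale ?d (fscale ?s (slotr \<sigma> q)))"
      by (simp only: d1 d2 slots_pcls[OF \<sigma>] qscale_pcls pcls_eq_iff slotr_scale fs.scale_scale sgn)
    also have "\<dots> \<longleftrightarrow> eqv (P n) p (fscale ?s (slotr \<sigma> q))"
      by (rule eqv_unit_iff[OF unit])
    finally show ?thesis
      by (simp only: f1 f2 slots_pcls[OF \<sigma>] qscale_pcls pcls_eq_iff)
  qed
  then show ?thesis unfolding graded_symmetric_def by blast
qed

text \<open>A single \<open>q\<close> represents one term and, up to the displayed sign, the other.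
  The maps see the arguments in permuted order, hence \<open>dsign\<close> of the permuted
  degrees.\<close>

lemma jacobi_term_dmap:
  assumes fk: "\<beta> k \<in> polyhom H W k (-1)" and fl: "\<beta> l \<in> polyhom H W l (-1)"
    and \<eta>: "\<eta> k = dmap (tsign k) k (\<beta> k)" "\<eta> l = dmap (tsign l) l (\<beta> l)"
    and l: "l \<ge> 1" and k: "k = Suc m" and \<sigma>: "\<sigma> permutes {..<l + m}"
    and us: "length us = l + m" "homogeneous W ds us"
  obtains q where "jacobi_term H W \<beta> k l \<sigma> us = pcls H W (l + m) q"
    "jacobi_term H W \<eta> k l \<sigma> us = pcls H W (l + m)
      (fscale (tsign (l + m) * (-1) ^ (l * m) * dsign (permute_list \<sigma> ds)) q)"
proof -
  define ys where "ys = take l (permute_list \<sigma> us)"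
  define zs where "zs = drop l (permute_list \<sigma> us)"
  define es where "es = take l (permute_list \<sigma> ds)"
  define gs where "gs = drop l (permute_list \<sigma> ds)"
  have k1: "k \<ge> 1" using k by simp
  have ds: "length ds = l + m" using homogeneous_length[OF us(2)] us(1) by simp
  have len: "length ys = l" "length zs = m" "length es = l" "length gs = m"
    using us ds by (simp_all add: ys_def zs_def es_def gs_def)
  have hom: "homogeneous W (permute_list \<sigma> ds) (permute_list \<sigma> us)"
    using homogeneous_permute[OF _ us(2)] \<sigma> us(1) by simp
  have hom': "homogeneous W es ys" "homogeneous W gs zs"
    using hom unfolding homogeneous_def ys_def zs_def es_def gs_def
    by (auto intro: list_all2_takeI list_all2_dropI)
  have cat: "es @ gs = permute_list \<sigma> ds" by (simp add: es_def gs_def)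
  have k': "lhom k (\<beta> k)" and l': "lhom l (\<beta> l)"
    and deg: "\<beta> l (tcls (lscale H W) l (gen ys)) \<in> pgrade H W l (sum_list es + -1)"
    using fk fl hom'(1) len(1) unfolding polyhom_iff by blast+
  \<comment> \<open>This representative comes from \<open>pgrade\<close> and not from
    \<open>rep\<close>: all its module elements have degree \<open>sum_list es - 1\<close>, so the
    outer map meets homogeneous arguments only and contributes one uniform sign.\<close>
  obtain p where p: "\<beta> l (tcls (lscale H W) l (gen ys)) = pcls H W l p"
    "\<forall>(hs, e)\<in>Poly_Mapping.keys p. length hs = l \<and> e \<in> grade W (sum_list es + -1)"
    using deg unfolding pgrade_def by blast
  \<comment> \<open>\<open>?a\<close> is the sign of the inner map, \<open>?b\<close> that of the
    outer map with the inner value in its first slot.\<close>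
  let ?a = "tsign l * dsign es :: 'k" and ?b = "tsign k * dsign ((sum_list es + -1) # gs) :: 'k"
  have pev_\<beta>: "pev H W (\<beta> l) ys = pcls H W l p"
    by (simp add: pev_def len p(1))
  have pev_\<eta>: "pev H W (\<eta> l) ys = pcls H W l (fscale ?a p)"
    unfolding pev_def len \<eta> dmap_homogeneous[OF l' l len(1) hom'(1)] p(1) qscale_pcls ..
  have inner: "eqv (P (l + m)) (compr l k (\<eta> k) zs p) (fscale ?b (compr l k (\<beta> k) zs p))"
    unfolding compr_def fext_fun_scale[symmetric]
  proof (rule fext_eqv, clarify)
    fix hs e assume "(hs, e) \<in> Poly_Mapping.keys p"
    then have hs: "length hs = l" and e: "e \<in> grade W (sum_list es + -1)" using p(2) by blast+
    have he: "homogeneous W ((sum_list es + -1) # gs) (e # zs)"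
      using hom'(2) e by (simp add: homogeneous_def)
    have lk: "length (e # zs) = k" "hom_len k (gen (e # zs) :: 'l list \<Rightarrow>\<^sub>0 'k)" using len k by simp_all
    have "pcls H W k (pv k (\<eta> k) (gen (e # zs))) = pcls H W k (fscale ?b (pv k (\<beta> k) (gen (e # zs))))"
      using dmap_homogeneous[OF k' k1 lk(1) he, of "tsign k"]
        lhom_tcls(1)[OF lhom_dmap[OF k' k1] k1 lk(2), of "tsign k"]
      unfolding lhom_tcls(1)[OF k' k1 lk(2)] qscale_pcls \<eta>(1) by simp
    then have "eqv (P k) (pv k (\<eta> k) (gen (e # zs))) (fscale ?b (pv k (\<beta> k) (gen (e # zs))))"
      unfolding pcls_eq_iff .
    from comp1_eqv_right[OF l k _ this, of "gen hs"] hs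
    show "eqv (P (l + m)) (comp1 l (gen hs) (pv k (\<eta> k) (gen (e # zs))))
        (fscale ?b (comp1 l (gen hs) (pv k (\<beta> k) (gen (e # zs)))))"
      by (simp add: comp1_scale)
  qed
  have lhom_\<eta>: "lhom k (\<eta> k)" unfolding \<eta> by (rule lhom_dmap[OF k' k1])
  have zs: "length zs = k - 1" using len k by simp
  let ?r = "slotr \<sigma> (compr l k (\<beta> k) zs p)"
  have "?a * ?b = tsign (l + m) * (-1) ^ (l * m) * dsign (permute_list \<sigma> ds)"
    unfolding k cat[symmetric] by (rule dsign_composition[OF len(3,4)])
  moreover have "eqv (P (l + m)) (slotr \<sigma> (compr l k (\<eta> k) zs (fscale ?a p))) (fscale (?a * ?b) ?r)"
  proof -
    have "compr l k (\<eta> k) zs (fscale ?a p) = fscale ?a (compr l k (\<eta> k) zs p)"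
      unfolding compr_def by (rule fext_scale)
    then show ?thesis
      using slotr_eqv[OF \<sigma> eqv_scale[OF inner, of ?a]] by (simp only: fs.scale_scale slotr_scale)
  qed
  ultimately have outer: "eqv (P (l + m)) (slotr \<sigma> (compr l k (\<eta> k) zs (fscale ?a p)))
      (fscale (tsign (l + m) * (-1) ^ (l * m) * dsign (permute_list \<sigma> ds)) ?r)"
    by (simp only:)
  have lk: "l + k - 1 = l + m" using k by simp
  show ?thesis
  proof (rule that)
    show "jacobi_term H W \<beta> k l \<sigma> us = pcls H W (l + m) ?r"
      unfolding jacobi_term_def us(1) ys_def[symmetric] zs_def[symmetric] pev_\<beta>
        pcomp_pcls[OF k' l k1 zs] lk by (rule slots_pcls[OF \<sigma>])
    show "jacobi_term H W \<eta> k l \<sigma> us = pcls H W (l + m)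
        (fscale (tsign (l + m) * (-1) ^ (l * m) * dsign (permute_list \<sigma> ds)) ?r)"
      unfolding jacobi_term_def us(1) ys_def[symmetric] zs_def[symmetric] pev_\<eta>
        pcomp_pcls[OF lhom_\<eta> l k1 zs] lk slots_pcls[OF \<sigma>] pcls_eq_iff by (rule outer)
  qed
qed

lemma jacobi_dmap:
  assumes \<beta>: "\<And>k. k \<ge> 1 \<Longrightarrow> \<beta> k \<in> polyhom H W k (-1)"
    and \<eta>: "\<And>k. k \<ge> 1 \<Longrightarrow> \<eta> k = dmap (tsign k) k (\<beta> k)"
    and us: "length us = N" "homogeneous W ds us"
  shows "(\<Sum>(k, l)\<in>{(k, l). 1 \<le> k \<and> 1 \<le> l \<and> k + l = N + 1}. \<Sum>\<sigma>\<in>shuffles l (k - 1).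
         fscale (koszul \<sigma> ds) (rep (jacobi_term H W \<eta> k l \<sigma> us))) \<in> pnull H W N \<longleftrightarrow>
    (\<Sum>(k, l)\<in>{(k, l). 1 \<le> k \<and> 1 \<le> l \<and> k + l = N + 1}. \<Sum>\<sigma>\<in>shuffles l (k - 1).
         fscale (of_int (sign \<sigma>) * koszul \<sigma> (map (\<lambda>d. d - 1) ds) * (-1) ^ (l * (k - 1)))
           (rep (jacobi_term H W \<beta> k l \<sigma> us))) \<in> pnull H W N"
    (is "(\<Sum>(k, l)\<in>?I. sum (?A k l) _) \<in> _ \<longleftrightarrow> (\<Sum>(k, l)\<in>?I. sum (?B k l) _) \<in> _")
proof -
  \<comment> \<open>By \<open>koszul_shift\<close> this is the factor left in every summand,
    independent of k, l and \<sigma>; its square is 1, so it cancels from the whole sum.\<close>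
  let ?c = "tsign N * dsign ds :: 'k"
  have ds: "length ds = N" using homogeneous_length[OF us(2)] us(1) by simp
  have summand: "eqv (P N) (?A k l \<sigma>) (fscale ?c (?B k l \<sigma>))"
    if kl: "1 \<le> k" "1 \<le> l" "k + l = N + 1" and \<sigma>: "\<sigma> \<in> shuffles l (k - 1)" for k l \<sigma>
  proof -
    define m where "m = k - 1"
    have m: "k = Suc m" "l + m = N" "k - 1 = m" using kl by (auto simp: m_def)
    have perm: "\<sigma> permutes {..<l + m}" using \<sigma> m by (simp add: shuffles_def)
    have us': "length us = l + m" using us m by simp
    obtain q where q: "jacobi_term H W \<beta> k l \<sigma> us = pcls H W (l + m) q"
      "jacobi_term H W \<eta> k l \<sigma> us = pcls H W (l + m)
        (fscale (tsign (l + m) * (-1) ^ (l * m) * dsign (permute_list \<sigma> ds)) q)"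
      by (rule jacobi_term_dmap[OF \<beta>[OF kl(1)] \<beta>[OF kl(2)] \<eta>[OF kl(1)] \<eta>[OF kl(2)] kl(2) m(1) perm us' us(2)])
    have "koszul \<sigma> ds * (tsign N * (-1) ^ (l * m) * dsign (permute_list \<sigma> ds))
        = tsign N * (-1) ^ (l * m) * (koszul \<sigma> ds * dsign (permute_list \<sigma> ds))"
      by (simp only: mult_ac)
    also have "\<dots> = ?c * (of_int (sign \<sigma>) * koszul \<sigma> (map (\<lambda>d. d - 1) ds) * (-1) ^ (l * m))"
      using perm ds m by (subst koszul_shift) (simp_all only: mult_ac)
    finally have sgn: "koszul \<sigma> ds * (tsign N * (-1) ^ (l * m) * dsign (permute_list \<sigma> ds))
        = ?c * (of_int (sign \<sigma>) * koszul \<sigma> (map (\<lambda>d. d - 1) ds) * (-1) ^ (l * m))" .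
    have "eqv (P N) (?A k l \<sigma>)
        (fscale (koszul \<sigma> ds) (fscale (tsign N * (-1) ^ (l * m) * dsign (permute_list \<sigma> ds)) q))"
      unfolding q(2) m(2) by (intro eqv_scale rep_pcls)
    also have "\<dots> = fscale ?c (fscale (of_int (sign \<sigma>) * koszul \<sigma> (map (\<lambda>d. d - 1) ds) * (-1) ^ (l * m)) q)"
      by (simp only: fs.scale_scale sgn)
    also have "eqv (P N) \<dots> (fscale ?c (?B k l \<sigma>))"
      unfolding q(1) m(2,3) by (intro eqv_scale eqv_sym[OF rep_pcls])
    finally show ?thesis .
  qed
  have "eqv (P N) (\<Sum>(k, l)\<in>?I. sum (?A k l) (shuffles l (k - 1)))
      (\<Sum>(k, l)\<in>?I. \<Sum>\<sigma>\<in>shuffles l (k - 1). fscale ?c (?B k l \<sigma>))"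
    by (intro eqv_sum, clarify, intro eqv_sum summand) auto
  also have "(\<Sum>(k, l)\<in>?I. \<Sum>\<sigma>\<in>shuffles l (k - 1). fscale ?c (?B k l \<sigma>))
      = fscale ?c (\<Sum>(k, l)\<in>?I. sum (?B k l) (shuffles l (k - 1)))"
    by (simp only: fs.scale_sum_right split_def)
  finally have eq: "eqv (P N) (\<Sum>(k, l)\<in>?I. sum (?A k l) (shuffles l (k - 1)))
      (fscale ?c (\<Sum>(k, l)\<in>?I. sum (?B k l) (shuffles l (k - 1))))" .
  have unit: "?c * ?c = 1"
  proof -
    have "?c * ?c = (tsign N * tsign N) * (dsign ds * dsign ds)" by (simp only: mult_ac)
    then show ?thesis by (simp add: tsign_square dsign_square)
  qed
  show ?thesis
    unfolding pnull_def eqv_mem[OF eq] span_unit_iff[OF unit] ..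
qed

end

lemma decalage_eq:
  assumes "cc_module H (shift L)" "k \<ge> 1"
  shows "decalage H L \<beta> k = cc_module.dmap H (shift L) (tsign k) k (\<beta> k)"
  using assms(2) unfolding decalage_def cc_module.dmap_def[OF assms(1)] tsign_def by simp

theorem proposition3p7:
  fixes H :: "('k::field, 'h::ring_1) hopf" and L :: "('h, 'l::ab_group_add) gmod"
  assumes "cocommutative_hopf_algebra H" and "graded_module H L"
  shows "(\<forall>\<beta> \<in> (\<Pi>\<^sub>E k\<in>{1..}. polyhom H L k (int k - 2)).
            L_infinity H L \<beta> \<longleftrightarrow> symmetric_L_infinity H (shift L) (decalage H L \<beta>))
       \<and> bij_betw (decalage H L) {\<beta>. L_infinity H L \<beta>} {\<eta>. symmetric_L_infinity H (shift L) \<eta>}"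
proof -
  \<comment> \<open>Everything happens over L[-1]; structures on L are read there through
    \<open>polyhom_shift\<close> and the rules \<open>shift_target\<close>.\<close>
  interpret U: cc_module H "shift L"
    by unfold_locales (use assms graded_module_shift in auto)
  let ?X = "\<Pi>\<^sub>E k\<in>{1..}. polyhom H (shift L) k (-1)"
  note decalage = decalage_eq[OF U.cc_module_axioms]
  have polyhom: "polyhom H L k (int k - 2) = polyhom H (shift L) k (-1)" for k
    by (subst polyhom_shift) simp
  have mem: "\<beta> k \<in> polyhom H (shift L) k (-1)" if "\<beta> \<in> ?X" "k \<ge> 1" for \<beta> k
    using that by (auto simp: PiE_def)
  have closed: "decalage H L \<beta> \<in> ?X" if "\<beta> \<in> ?X" for \<beta>
  proof (rule PiE_I)
    fix k :: nat assume "k \<in> {1..}"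
    then show "decalage H L \<beta> k \<in> polyhom H (shift L) k (-1)"
      using U.polyhom_dmap[OF mem[OF that]] by (simp add: decalage)
  qed (simp add: decalage_def)
  have involution: "decalage H L (decalage H L \<beta>) = \<beta>" if "\<beta> \<in> ?X" for \<beta>
  proof (rule PiE_ext[OF closed[OF closed[OF that]] that])
    fix k :: nat assume "k \<in> {1..}"
    then have k: "k \<ge> 1" by simp
    have "U.lhom k (\<beta> k)" using mem[OF that k] by (simp add: U.polyhom_iff)
    then show "decalage H L (decalage H L \<beta>) k = \<beta> k"
      unfolding decalage[OF k] by (intro U.dmap_dmap k tsign_square)
  qed
  have equiv: "L_infinity H L \<beta> \<longleftrightarrow> symmetric_L_infinity H (shift L) (decalage H L \<beta>)" if \<beta>: "\<beta> \<in> ?X" for \<beta>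
  proof -
    have skew: "graded_skew_symmetric H L k (\<beta> k) \<longleftrightarrow> graded_symmetric H (shift L) k (decalage H L \<beta> k)"
      if "k \<ge> 1" for k
    proof -
      have "U.lhom k (\<beta> k)" using mem[OF \<beta> that] by (simp add: U.polyhom_iff)
      from U.graded_symmetric_dmap[OF this that tsign_square] show ?thesis
        unfolding decalage[OF that] graded_skew_symmetric_def
        by (subst all_degrees_shift) (simp add: homogeneous_shift)
    qed
    have jacobi: "(\<forall>xs ds. length xs = N \<and> homogeneous L ds xs \<longrightarrow>
      (\<Sum>(k, l)\<in>{(k, l). 1 \<le> k \<and> 1 \<le> l \<and> k + l = N + 1}. \<Sum>\<sigma>\<in>shuffles l (k - 1).
         fscale (of_int (sign \<sigma>) * koszul \<sigma> ds * (-1) ^ (l * (k - 1)))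
           (rep (jacobi_term H L \<beta> k l \<sigma> xs))) \<in> pnull H L N) \<longleftrightarrow>
      (\<forall>us ds. length us = N \<and> homogeneous (shift L) ds us \<longrightarrow>
      (\<Sum>(k, l)\<in>{(k, l). 1 \<le> k \<and> 1 \<le> l \<and> k + l = N + 1}. \<Sum>\<sigma>\<in>shuffles l (k - 1).
         fscale (koszul \<sigma> ds) (rep (jacobi_term H (shift L) (decalage H L \<beta>) k l \<sigma> us)))
         \<in> pnull H (shift L) N)" for N
      using U.jacobi_dmap[where \<beta> = \<beta> and \<eta> = "decalage H L \<beta>" and N = N, OF mem[OF \<beta>] decalage]
      by (subst all_degrees_shift) (simp add: homogeneous_shift)
    show ?thesis
      unfolding L_infinity_def symmetric_L_infinity_def polyhom using \<beta> closed[OF \<beta>] skew jacobi by simp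
  qed
  have "bij_betw (decalage H L) {\<beta>. L_infinity H L \<beta>} {\<eta>. symmetric_L_infinity H (shift L) \<eta>}"
  proof (rule bij_betw_byWitness[where f' = "decalage H L"])
    have L: "\<beta> \<in> ?X" if "L_infinity H L \<beta>" for \<beta>
      using that unfolding L_infinity_def polyhom by blast
    have S: "\<eta> \<in> ?X" if "symmetric_L_infinity H (shift L) \<eta>" for \<eta>
      using that unfolding symmetric_L_infinity_def by blast
    show "\<forall>\<beta>\<in>{\<beta>. L_infinity H L \<beta>}. decalage H L (decalage H L \<beta>) = \<beta>"
      using involution L by blast
    show "\<forall>\<eta>\<in>{\<eta>. symmetric_L_infinity H (shift L) \<eta>}. decalage H L (decalage H L \<eta>) = \<eta>"
      using involution S by blast
    show "decalage H L ` {\<beta>. L_infinity H L \<beta>} \<subseteq> {\<eta>. symmetric_L_infinity H (shift L) \<eta>}"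
      using equiv L by blast
    \<comment> \<open>The equivalence is applied to the image of \<eta>, whose own image is \<eta>
      again.\<close>
    show "decalage H L ` {\<eta>. symmetric_L_infinity H (shift L) \<eta>} \<subseteq> {\<beta>. L_infinity H L \<beta>}"
      using equiv[OF closed[OF S]] involution[OF S] by auto
  qed
  then show ?thesis using equiv by (simp add: polyhom)
qed

end
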